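(* Let $E$ be an exact real Courant algebroid over a smooth manifold $M$, with anchor $\pi$ and bracket $[\cdot,\cdot]$. Fix a background isotropic splitting $s_0:TM\to E$ of $\pi$, with associated closed three-form $H_0=H_{s_0}$. Let $\mathbf{G}_t$ be a one-parameter family of generalized metrics on $E$, and let $(g_t,b_t)$ be the induced one-parameter family of Riemannian metrics and torsion potentials (relative to $s_0$). Then $\mathbf{G}_t$ is a solution of the generalized Ricci flow $$\frac{\partial}{\partial t}\mathbf{G}=-2[\mathbf{R},\mathbf{G}],$$ where $\mathbf{R}$ is the generalized Ricci tensor of $\mathbf{G}$, if and only if $(g_t,b_t)$ solves the $B$-field renormalization group flow $$\frac{\partial}{\partial t}g_{ij}=-2\,\mathrm{Rc}_{ij}+\tfrac12 H_{ipq}H_j{}^{pq},\qquad \frac{\partial}{\partial t}b=-d^*_gH,\qquad H=H_0+db .$$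
   Context: An exact Courant algebroid over $M^n$ is a vector bundle $E\to M$ with a nondegenerate symmetric pairing $\langle\cdot,\cdot\rangle$ of signature $(n,n)$, a bracket $[\cdot,\cdot]$ on sections and an anchor $\pi:E\to TM$ satisfying the Courant algebroid axioms, such that $0\to T^*M\xrightarrow{\pi^*}E\xrightarrow{\pi}TM\to 0$ is exact, where $\langle\pi^*\xi,e\rangle=\xi(\pi e)$. We identify $E\cong E^*$ by the pairing; adjoints $A^*$ of $A\in\mathrm{End}(E)$ are taken with respect to it, and $\mathfrak{so}(E)=\{A: A^*=-A\}$. In $[\mathbf R,\mathbf G]$ the bracket is the commutator of endomorphisms. For an isotropic splitting $s:TM\to E$ of $\pi$ put $H_s(X,Y,Z)=\langle[sX,sY],sZ\rangle$, a closed 3-form. For a two-form $b$, viewed as a map $TM\to T^*M$, $X\mapsto b(X,\cdot)$, put $e^b=\mathrm{Id}+\pi^*b\pi$; then $e^bs$ is again an isotropic splitting and $H_{e^bs}=H_s+db$. A generalized metric is $\mathbf{G}\in\mathrm{End}(E)$ with $\mathbf{G}^2=\mathrm{Id}$, $\mathbf{G}^*=\mathbf{G}$ and $\langle\mathbf{G}\cdot,\cdot\rangle$ positive definite. Put $P_\pm=\frac12(\mathrm{Id}\pm\mathbf{G})$. The induced Riemannian metric $g$ is defined by $g^{-1}=\pi\mathbf{G}\pi^*:T^*M\to TM$; the induced isotropic splitting is $s_{\mathbf{G}}=\mathbf{G}\pi^*g$; the torsion potential $b$ relative to $s_0$ is defined by $s_{\mathbf{G}}=e^bs_0$; the induced three-form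 is $H=H_{s_{\mathbf{G}}}=H_0+db$. With $s_\pm=(\mathbf{G}\pm\mathrm{Id})\pi^*g$ and $X^\pm=s_\pm X$, the Bismut connections on $TM$ are $\nabla^\pm_XY=\pi P_\pm[X^\mp,Y^\pm]$; they equal $\nabla^\pm=\nabla\pm\frac12g^{-1}H$, where $\nabla$ is the Levi-Civita connection of $g$ and $g((g^{-1}H)(X,Y),Z)=H(X,Y,Z)$. The Ricci tensor of a connection is $\mathrm{Ric}(Y,Z)=\mathrm{tr}(X\mapsto R(X,Y)Z)$; one has $\mathrm{Ric}(\nabla^\pm)=\mathrm{Ric}(\nabla)-\frac14H^2\mp\frac12d^*H$, with $(H^2)_{ij}=H_{ipq}H_j{}^{pq}$ and $(d^*H)_{ij}=-\nabla^kH_{kij}$. For $h\in\mathrm{Sym}^2T^*M$, $k\in\Lambda^2T^*M$, put $\eta=\pi^*(h+k)\pi$, with $h+k$ viewed as the map $X\mapsto (h+k)(X,\cdot)$, and $R_{h,k}=P_-\eta P_+-P_+\eta^*P_-\in\mathfrak{so}(E)$. The generalized Ricci tensor $\mathbf{R}$ of $\mathbf{G}$ is $R_{h,k}$ with $h$ and $k$ the symmetric and skew parts of $\mathrm{Ric}(\nabla^-)$. *)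

theory Defs
  imports "HOL-Analysis.Analysis"
begin

section \<open>Smooth manifolds and their tangent bundles\<close>

text \<open>
  The library has no smooth manifolds. A manifold is a Hausdorff second countable type
  \<open>'m\<close> with an atlas \<open>A\<close> of charts \<open>(U, \<phi>)\<close> into \<open>real ^ 'n\<close>; the atlas is
  not required to be maximal.
\<close>

primrec Ck_on :: "nat \<Rightarrow> 'a::real_normed_vector set \<Rightarrow> ('a \<Rightarrow> 'b::real_normed_vector) \<Rightarrow> bool" where
  "Ck_on 0 S f \<longleftrightarrow> continuous_on S f"
| "Ck_on (Suc k) S f \<longleftrightarrow> (\<forall>x\<in>S. f differentiable (at x)) \<and>
     (\<forall>v. Ck_on k S (\<lambda>x. frechet_derivative f (at x) v))"

text \<open>Only used for open \<open>S\<close>.\<close>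

definition Cinf_on :: "'a::real_normed_vector set \<Rightarrow> ('a \<Rightarrow> 'b::real_normed_vector) \<Rightarrow> bool" where
  "Cinf_on S f \<longleftrightarrow> (\<forall>k. Ck_on k S f)"

type_synonym ('m, 'n) chart = "'m set \<times> ('m \<Rightarrow> real ^ 'n)"

abbreviation chart_inv :: "('m, 'n::finite) chart \<Rightarrow> real ^ 'n \<Rightarrow> 'm" where
  "chart_inv c \<equiv> inv_into (fst c) (snd c)"

definition smooth_atlas ::
  "('m::{t2_space,second_countable_topology}, 'n::finite) chart set \<Rightarrow> bool" where
  "smooth_atlas A \<longleftrightarrow>
     \<Union> (fst ` A) = UNIV \<and>
     (\<forall>c\<in>A. open (fst c) \<and> open (snd c ` fst c) \<and>
        homeomorphism (fst c) (snd c ` fst c) (snd c) (chart_inv c)) \<and>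
     (\<forall>c\<in>A. \<forall>d\<in>A. Cinf_on (snd c ` (fst c \<inter> fst d)) (snd d \<circ> chart_inv c))"

definition smooth_on_mfd ::
  "('m, 'n::finite) chart set \<Rightarrow> 'm set \<Rightarrow> ('m \<Rightarrow> 'b::real_normed_vector) \<Rightarrow> bool" where
  "smooth_on_mfd A W f \<longleftrightarrow> (\<forall>c\<in>A. Cinf_on (snd c ` (fst c \<inter> W)) (f \<circ> chart_inv c))"

text \<open>
  A tangent vector at \<open>p\<close> is represented by its components in one selected chart around
  \<open>p\<close>, so every tangent space is \<open>real ^ 'n\<close> as a vector space. The selected chart
  changes from point to point in an arbitrary way: smoothness of vector fields is always
  tested after transforming the components to one and the same chart.
\<close>

definition chart_at :: "('m, 'n::finite) chart set \<Rightarrow> 'm \<Rightarrow> ('m, 'n) chart" where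
  "chart_at A p = (SOME c. c \<in> A \<and> p \<in> fst c)"

definition tangent_coord ::
  "('m, 'n::finite) chart set \<Rightarrow> ('m, 'n) chart \<Rightarrow> 'm \<Rightarrow> real ^ 'n \<Rightarrow> real ^ 'n" where
  "tangent_coord A c p v =
     frechet_derivative (snd c \<circ> chart_inv (chart_at A p)) (at (snd (chart_at A p) p)) v"

text \<open>The value \<open>df\<^sub>p(v)\<close>, for \<open>v\<close> tangent at \<open>p\<close>.\<close>

definition mderiv ::
  "('m, 'n::finite) chart set \<Rightarrow> ('m \<Rightarrow> real) \<Rightarrow> 'm \<Rightarrow> real ^ 'n \<Rightarrow> real" where
  "mderiv A f p v =
     frechet_derivative (f \<circ> chart_inv (chart_at A p)) (at (snd (chart_at A p) p)) v"


section \<open>Vector bundles and vector fields\<close>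

text \<open>
  Choosing a basis of every fibre separately identifies the total space of a rank
  \<open>r\<close> vector bundle, fibrewise linearly but only as a set, with \<open>'m \<times> real ^ 'r\<close>. The
  smooth structure is carried by a family \<open>B\<close> of local trivializations \<open>(U, \<Phi>)\<close>: the
  map \<open>\<Phi> p\<close> is an isomorphism from the fibre over \<open>p \<in> U\<close> to the model fibre, and the
  transition functions are smooth. The bundle need not be trivial, since neither the
  identity nor any other global trivialization is assumed to belong to the structure.
\<close>

type_synonym ('m, 'r) triv = "'m set \<times> ('m \<Rightarrow> real ^ 'r \<Rightarrow> real ^ 'r)"

definition smooth_vector_bundle ::
  "('m::{t2_space,second_countable_topology}, 'n::finite) chart set \<Rightarrow> ('m, 'r::finite) triv set \<Rightarrow> bool" where
  "smooth_vector_bundle A B \<longleftrightarrow>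
     \<Union> (fst ` B) = UNIV \<and>
     (\<forall>(U, \<Phi>)\<in>B. open U \<and> (\<forall>p\<in>U. linear (\<Phi> p) \<and> bij (\<Phi> p))) \<and>
     (\<forall>(U, \<Phi>)\<in>B. \<forall>(V, \<Psi>)\<in>B. \<forall>v. smooth_on_mfd A (U \<inter> V) (\<lambda>p. \<Psi> p (inv (\<Phi> p) v)))"

definition smooth_section ::
  "('m, 'n::finite) chart set \<Rightarrow> ('m, 'r::finite) triv set \<Rightarrow> ('m \<Rightarrow> real ^ 'r) \<Rightarrow> bool" where
  "smooth_section A B a \<longleftrightarrow> (\<forall>(U, \<Phi>)\<in>B. smooth_on_mfd A U (\<lambda>p. \<Phi> p (a p)))"

definition tangent_triv :: "('m, 'n::finite) chart set \<Rightarrow> ('m, 'n) triv set" where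
  "tangent_triv A = (\<lambda>c. (fst c, tangent_coord A c)) ` A"

definition smooth_vf :: "('m, 'n::finite) chart set \<Rightarrow> ('m \<Rightarrow> real ^ 'n) \<Rightarrow> bool" where
  "smooth_vf A X \<longleftrightarrow> smooth_section A (tangent_triv A) X"

text \<open>The Lie bracket \<open>X\<^sup>j \<partial>\<^sub>j Y\<^sup>i - Y\<^sup>j \<partial>\<^sub>j X\<^sup>i\<close>, computed at \<open>p\<close> in the chart \<open>chart_at A p\<close>.\<close>

definition lie_bracket ::
  "('m, 'n::finite) chart set \<Rightarrow> ('m \<Rightarrow> real ^ 'n) \<Rightarrow> ('m \<Rightarrow> real ^ 'n) \<Rightarrow> 'm \<Rightarrow> real ^ 'n" where
  "lie_bracket A X Y p =
     (let c = chart_at A p;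
          loc = (\<lambda>Z x. tangent_coord A c (chart_inv c x) (Z (chart_inv c x)))
      in frechet_derivative (loc Y) (at (snd c p)) (X p)
       - frechet_derivative (loc X) (at (snd c p)) (Y p))"

text \<open>
  Tensors are often defined by a formula in vector fields that is function-linear in each
  argument. Their value on tangent vectors at \<open>p\<close> is obtained by extending the vectors to
  smooth vector fields, and does not depend on the extensions.
\<close>

definition vf_ext :: "('m, 'n::finite) chart set \<Rightarrow> 'm \<Rightarrow> real ^ 'n \<Rightarrow> 'm \<Rightarrow> real ^ 'n" where
  "vf_ext A p v = (SOME X. smooth_vf A X \<and> X p = v)"

type_synonym ('m, 'n) form2 = "'m \<Rightarrow> real ^ 'n \<Rightarrow> real ^ 'n \<Rightarrow> real"
type_synonym ('m, 'n) form3 = "'m \<Rightarrow> real ^ 'n \<Rightarrow> real ^ 'n \<Rightarrow> real ^ 'n \<Rightarrow> real"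

definition tensor3 ::
  "('m, 'n::finite) chart set \<Rightarrow>
   (('m \<Rightarrow> real ^ 'n) \<Rightarrow> ('m \<Rightarrow> real ^ 'n) \<Rightarrow> ('m \<Rightarrow> real ^ 'n) \<Rightarrow> 'm \<Rightarrow> real) \<Rightarrow> ('m, 'n) form3" where
  "tensor3 A T p x y z = T (vf_ext A p x) (vf_ext A p y) (vf_ext A p z) p"

definition ext_deriv2 :: "('m, 'n::finite) chart set \<Rightarrow> ('m, 'n) form2 \<Rightarrow> ('m, 'n) form3" where
  "ext_deriv2 A b = tensor3 A (\<lambda>X Y Z p.
       mderiv A (\<lambda>q. b q (Y q) (Z q)) p (X p)
     - mderiv A (\<lambda>q. b q (X q) (Z q)) p (Y p)
     + mderiv A (\<lambda>q. b q (X q) (Y q)) p (Z p)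
     - b p (lie_bracket A X Y p) (Z p)
     + b p (lie_bracket A X Z p) (Y p)
     - b p (lie_bracket A Y Z p) (X p))"


section \<open>Connections and Riemannian geometry\<close>

type_synonym ('m, 'n) conn = "('m \<Rightarrow> real ^ 'n) \<Rightarrow> ('m \<Rightarrow> real ^ 'n) \<Rightarrow> 'm \<Rightarrow> real ^ 'n"

definition connection :: "('m, 'n::finite) chart set \<Rightarrow> ('m, 'n) conn \<Rightarrow> bool" where
  "connection A D \<longleftrightarrow>
     (\<forall>X Y. smooth_vf A X \<and> smooth_vf A Y \<longrightarrow> smooth_vf A (D X Y)) \<and>
     (\<forall>X X' Y p. smooth_vf A X \<and> smooth_vf A X' \<and> smooth_vf A Y \<longrightarrow>
        D (\<lambda>q. X q + X' q) Y p = D X Y p + D X' Y p) \<and>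
     (\<forall>f X Y p. smooth_on_mfd A UNIV f \<and> smooth_vf A X \<and> smooth_vf A Y \<longrightarrow>
        D (\<lambda>q. f q *\<^sub>R X q) Y p = f p *\<^sub>R D X Y p) \<and>
     (\<forall>X Y Y' p. smooth_vf A X \<and> smooth_vf A Y \<and> smooth_vf A Y' \<longrightarrow>
        D X (\<lambda>q. Y q + Y' q) p = D X Y p + D X Y' p) \<and>
     (\<forall>f X Y p. smooth_on_mfd A UNIV f \<and> smooth_vf A X \<and> smooth_vf A Y \<longrightarrow>
        D X (\<lambda>q. f q *\<^sub>R Y q) p = mderiv A f p (X p) *\<^sub>R Y p + f p *\<^sub>R D X Y p)"

definition torsion_free :: "('m, 'n::finite) chart set \<Rightarrow> ('m, 'n) conn \<Rightarrow> bool" where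
  "torsion_free A D \<longleftrightarrow> (\<forall>X Y p. smooth_vf A X \<and> smooth_vf A Y \<longrightarrow>
     D X Y p - D Y X p = lie_bracket A X Y p)"

definition metric_compatible ::
  "('m, 'n::finite) chart set \<Rightarrow> ('m, 'n) form2 \<Rightarrow> ('m, 'n) conn \<Rightarrow> bool" where
  "metric_compatible A g D \<longleftrightarrow> (\<forall>X Y Z p. smooth_vf A X \<and> smooth_vf A Y \<and> smooth_vf A Z \<longrightarrow>
     mderiv A (\<lambda>q. g q (Y q) (Z q)) p (X p) = g p (D X Y p) (Z p) + g p (Y p) (D X Z p))"

text \<open>
  For a Riemannian metric the choice is unique on smooth vector fields; the operator is
  never applied to other arguments.
\<close>

definition levi_civita :: "('m, 'n::finite) chart set \<Rightarrow> ('m, 'n) form2 \<Rightarrow> ('m, 'n) conn" where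
  "levi_civita A g = (SOME D. connection A D \<and> torsion_free A D \<and> metric_compatible A g D)"

definition curvature ::
  "('m, 'n::finite) chart set \<Rightarrow> ('m, 'n) conn \<Rightarrow>
   ('m \<Rightarrow> real ^ 'n) \<Rightarrow> ('m \<Rightarrow> real ^ 'n) \<Rightarrow> ('m \<Rightarrow> real ^ 'n) \<Rightarrow> 'm \<Rightarrow> real ^ 'n" where
  "curvature A D X Y Z p = D X (D Y Z) p - D Y (D X Z) p - D (lie_bracket A X Y) Z p"

definition ricci :: "('m, 'n::finite) chart set \<Rightarrow> ('m, 'n) conn \<Rightarrow> ('m, 'n) form2" where
  "ricci A D p y z =
     trace (matrix (\<lambda>x. curvature A D (vf_ext A p x) (vf_ext A p y) (vf_ext A p z) p))"

text \<open>Coefficients \<open>g\<^sup>i\<^sup>j\<close> with respect to the standard basis of the tangent space at \<open>p\<close>.\<close>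

definition inv_metric :: "('m, 'n::finite) form2 \<Rightarrow> 'm \<Rightarrow> 'n \<Rightarrow> 'n \<Rightarrow> real" where
  "inv_metric g p i j = matrix_inv (\<chi> k l. g p (axis k 1) (axis l 1)) $ i $ j"

definition form3_square :: "('m, 'n::finite) form2 \<Rightarrow> ('m, 'n) form3 \<Rightarrow> ('m, 'n) form2" where
  "form3_square g H p x y =
     (\<Sum>i\<in>UNIV. \<Sum>j\<in>UNIV. \<Sum>k\<in>UNIV. \<Sum>l\<in>UNIV. inv_metric g p i k * inv_metric g p j l *
        H p x (axis i 1) (axis j 1) * H p y (axis k 1) (axis l 1))"

text \<open>The covariant derivative \<open>(\<nabla>\<^sub>w H)(x, y, z)\<close>.\<close>

definition cov_deriv3 ::
  "('m, 'n::finite) chart set \<Rightarrow> ('m, 'n) conn \<Rightarrow> ('m, 'n) form3 \<Rightarrow> 'm \<Rightarrow> real ^ 'n \<Rightarrow>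
   real ^ 'n \<Rightarrow> real ^ 'n \<Rightarrow> real ^ 'n \<Rightarrow> real" where
  "cov_deriv3 A D H p w =
     (let W = vf_ext A p w in
      tensor3 A (\<lambda>X Y Z q.
          mderiv A (\<lambda>r. H r (X r) (Y r) (Z r)) q (W q)
        - H q (D W X q) (Y q) (Z q) - H q (X q) (D W Y q) (Z q) - H q (X q) (Y q) (D W Z q)) p)"

definition codiff3 ::
  "('m, 'n::finite) chart set \<Rightarrow> ('m, 'n) form2 \<Rightarrow> ('m, 'n) form3 \<Rightarrow> ('m, 'n) form2" where
  "codiff3 A g H p y z =
     - (\<Sum>k\<in>UNIV. \<Sum>l\<in>UNIV. inv_metric g p k l *
          cov_deriv3 A (levi_civita A g) H p (axis l 1) (axis k 1) y z)"

text \<open>The equations are understood as equations between tensors at each time in \<open>I\<close> and each point.\<close>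

definition bfield_rg_flow ::
  "('m, 'n::finite) chart set \<Rightarrow> ('m, 'n) form3 \<Rightarrow> real set \<Rightarrow>
   (real \<Rightarrow> ('m, 'n) form2) \<Rightarrow> (real \<Rightarrow> ('m, 'n) form2) \<Rightarrow> bool" where
  "bfield_rg_flow A H0 I g b \<longleftrightarrow>
     (\<forall>t\<in>I. \<forall>p x y.
       (let H = (\<lambda>q u v w. H0 q u v w + ext_deriv2 A (b t) q u v w) in
        ((\<lambda>\<tau>. g \<tau> p x y) has_real_derivative
           - 2 * ricci A (levi_civita A (g t)) p x y + 1 / 2 * form3_square (g t) H p x y)
          (at t within I) \<and>
        ((\<lambda>\<tau>. b \<tau> p x y) has_real_derivative - codiff3 A (g t) H p x y) (at t within I)))"


section \<open>Exact Courant algebroids\<close>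

record ('m, 'n, 'r) courant_data =
  atlas :: "('m, 'n) chart set"
  trivs :: "('m, 'r) triv set"
  pairing :: "'m \<Rightarrow> real ^ 'r \<Rightarrow> real ^ 'r \<Rightarrow> real"
  cbracket :: "('m \<Rightarrow> real ^ 'r) \<Rightarrow> ('m \<Rightarrow> real ^ 'r) \<Rightarrow> 'm \<Rightarrow> real ^ 'r"
  anchor :: "'m \<Rightarrow> real ^ 'r \<Rightarrow> real ^ 'n"

text \<open>Covectors at \<open>p\<close> are the linear functions on \<open>real ^ 'n\<close>; \<open>anchor_dual\<close> is \<open>\<pi>\<^sup>*\<close>.\<close>

definition anchor_dual ::
  "('m, 'n::finite, 'r::finite) courant_data \<Rightarrow> 'm \<Rightarrow> (real ^ 'n \<Rightarrow> real) \<Rightarrow> real ^ 'r" where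
  "anchor_dual C p \<xi> = (THE e. \<forall>e'. pairing C p e e' = \<xi> (anchor C p e'))"

definition has_signature :: "('v::euclidean_space \<Rightarrow> 'v \<Rightarrow> real) \<Rightarrow> nat \<Rightarrow> nat \<Rightarrow> bool" where
  "has_signature \<beta> k l \<longleftrightarrow> (\<exists>P N. subspace P \<and> subspace N \<and> dim P = k \<and> dim N = l \<and>
     (\<forall>x. \<exists>u\<in>P. \<exists>v\<in>N. x = u + v) \<and>
     (\<forall>u\<in>P. \<forall>v\<in>N. \<beta> u v = 0) \<and>
     (\<forall>u\<in>P. u \<noteq> 0 \<longrightarrow> \<beta> u u > 0) \<and> (\<forall>v\<in>N. v \<noteq> 0 \<longrightarrow> \<beta> v v < 0))"

abbreviation csection ::
  "('m, 'n::finite, 'r::finite) courant_data \<Rightarrow> ('m \<Rightarrow> real ^ 'r) \<Rightarrow> bool" where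
  "csection C \<equiv> smooth_section (atlas C) (trivs C)"

text \<open>
  Smoothness of bundle maps is expressed by saying that smooth sections are taken to smooth
  sections. Below, the blocks are: smooth bundle with a pairing, smooth anchor, bilinear
  bracket on sections, the Courant algebroid axioms, exactness.
\<close>

definition exact_courant_algebroid ::
  "('m::{t2_space,second_countable_topology}, 'n::finite, 'r::finite) courant_data \<Rightarrow> bool" where
  "exact_courant_algebroid C \<longleftrightarrow>
     smooth_atlas (atlas C) \<and> smooth_vector_bundle (atlas C) (trivs C) \<and>
     (\<forall>p. bilinear (pairing C p) \<and>
          (\<forall>x y. pairing C p x y = pairing C p y x) \<and>
          (\<forall>x. (\<forall>y. pairing C p x y = 0) \<longrightarrow> x = 0) \<and>
          has_signature (pairing C p) CARD('n) CARD('n)) \<and>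
     (\<forall>a b. csection C a \<and> csection C b \<longrightarrow>
        smooth_on_mfd (atlas C) UNIV (\<lambda>p. pairing C p (a p) (b p))) \<and>

     (\<forall>p. linear (anchor C p)) \<and>
     (\<forall>a. csection C a \<longrightarrow> smooth_vf (atlas C) (\<lambda>p. anchor C p (a p))) \<and>

     (\<forall>a b. csection C a \<and> csection C b \<longrightarrow> csection C (cbracket C a b)) \<and>
     (\<forall>a a' b p. csection C a \<and> csection C a' \<and> csection C b \<longrightarrow>
        cbracket C (\<lambda>q. a q + a' q) b p = cbracket C a b p + cbracket C a' b p \<and>
        cbracket C b (\<lambda>q. a q + a' q) p = cbracket C b a p + cbracket C b a' p) \<and>
     (\<forall>(r::real) a b p. csection C a \<and> csection C b \<longrightarrow>
        cbracket C (\<lambda>q. r *\<^sub>R a q) b p = r *\<^sub>R cbracket C a b p \<and>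
        cbracket C a (\<lambda>q. r *\<^sub>R b q) p = r *\<^sub>R cbracket C a b p) \<and>

     (\<forall>a b c p. csection C a \<and> csection C b \<and> csection C c \<longrightarrow>
        cbracket C a (cbracket C b c) p =
        cbracket C (cbracket C a b) c p + cbracket C b (cbracket C a c) p) \<and>
     (\<forall>a b p. csection C a \<and> csection C b \<longrightarrow>
        anchor C p (cbracket C a b p) =
        lie_bracket (atlas C) (\<lambda>q. anchor C q (a q)) (\<lambda>q. anchor C q (b q)) p) \<and>
     (\<forall>f a b p. smooth_on_mfd (atlas C) UNIV f \<and> csection C a \<and> csection C b \<longrightarrow>
        cbracket C a (\<lambda>q. f q *\<^sub>R b q) p =
        f p *\<^sub>R cbracket C a b p + mderiv (atlas C) f p (anchor C p (a p)) *\<^sub>R b p) \<and>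
     (\<forall>a b c p. csection C a \<and> csection C b \<and> csection C c \<longrightarrow>
        mderiv (atlas C) (\<lambda>q. pairing C q (b q) (c q)) p (anchor C p (a p)) =
        pairing C p (cbracket C a b p) (c p) + pairing C p (b p) (cbracket C a c p)) \<and>
     (\<forall>a b p. csection C a \<and> csection C b \<longrightarrow>
        cbracket C a b p + cbracket C b a p =
        anchor_dual C p (mderiv (atlas C) (\<lambda>q. pairing C q (a q) (b q)) p)) \<and>

     (\<forall>p. inj_on (anchor_dual C p) {\<xi>. linear \<xi>} \<and>
          anchor_dual C p ` {\<xi>. linear \<xi>} = {e. anchor C p e = 0} \<and>
          surj (anchor C p))"

definition isotropic_splitting ::
  "('m, 'n::finite, 'r::finite) courant_data \<Rightarrow> ('m \<Rightarrow> real ^ 'n \<Rightarrow> real ^ 'r) \<Rightarrow> bool" where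
  "isotropic_splitting C s \<longleftrightarrow>
     (\<forall>p. linear (s p) \<and> (\<forall>x. anchor C p (s p x) = x) \<and> (\<forall>x y. pairing C p (s p x) (s p y) = 0)) \<and>
     (\<forall>X. smooth_vf (atlas C) X \<longrightarrow> csection C (\<lambda>p. s p (X p)))"

definition splitting_form ::
  "('m, 'n::finite, 'r::finite) courant_data \<Rightarrow> ('m \<Rightarrow> real ^ 'n \<Rightarrow> real ^ 'r) \<Rightarrow> ('m, 'n) form3" where
  "splitting_form C s = tensor3 (atlas C) (\<lambda>X Y Z p.
     pairing C p (cbracket C (\<lambda>q. s q (X q)) (\<lambda>q. s q (Y q)) p) (s p (Z p)))"

text \<open>
  A two-form, like any bilinear form \<open>b p\<close> on tangent vectors, is by currying also the map
  \<open>X \<mapsto> b(X, \<cdot>)\<close> from tangent vectors to covectors.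
\<close>

definition exp_form2 ::
  "('m, 'n::finite, 'r::finite) courant_data \<Rightarrow> 'm \<Rightarrow> (real ^ 'n \<Rightarrow> real ^ 'n \<Rightarrow> real) \<Rightarrow>
   real ^ 'r \<Rightarrow> real ^ 'r" where
  "exp_form2 C p \<beta> e = e + anchor_dual C p (\<beta> (anchor C p e))"

definition pairing_adjoint ::
  "('m, 'n::finite, 'r::finite) courant_data \<Rightarrow> 'm \<Rightarrow> (real ^ 'r \<Rightarrow> real ^ 'r) \<Rightarrow>
   real ^ 'r \<Rightarrow> real ^ 'r" where
  "pairing_adjoint C p S = (THE S'. \<forall>x y. pairing C p (S x) y = pairing C p x (S' y))"


section \<open>Generalized metrics\<close>

type_synonym ('m, 'r) endo = "'m \<Rightarrow> real ^ 'r \<Rightarrow> real ^ 'r"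

definition generalized_metric ::
  "('m, 'n::finite, 'r::finite) courant_data \<Rightarrow> ('m, 'r) endo \<Rightarrow> bool" where
  "generalized_metric C G \<longleftrightarrow>
     (\<forall>p. linear (G p) \<and> (\<forall>e. G p (G p e) = e) \<and> pairing_adjoint C p (G p) = G p \<and>
          (\<forall>e. e \<noteq> 0 \<longrightarrow> pairing C p (G p e) e > 0)) \<and>
     (\<forall>a. csection C a \<longrightarrow> csection C (\<lambda>p. G p (a p)))"

definition induced_metric ::
  "('m, 'n::finite, 'r::finite) courant_data \<Rightarrow> ('m, 'r) endo \<Rightarrow> ('m, 'n) form2" where
  "induced_metric C G p =
     inv_into {\<xi>. linear \<xi>} (\<lambda>\<xi>. anchor C p (G p (anchor_dual C p \<xi>)))"

definition induced_splitting ::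
  "('m, 'n::finite, 'r::finite) courant_data \<Rightarrow> ('m, 'r) endo \<Rightarrow> 'm \<Rightarrow> real ^ 'n \<Rightarrow> real ^ 'r" where
  "induced_splitting C G p x = G p (anchor_dual C p (induced_metric C G p x))"

definition torsion_potential ::
  "('m, 'n::finite, 'r::finite) courant_data \<Rightarrow> ('m \<Rightarrow> real ^ 'n \<Rightarrow> real ^ 'r) \<Rightarrow>
   ('m, 'r) endo \<Rightarrow> ('m, 'n) form2" where
  "torsion_potential C s0 G p =
     (THE \<beta>. bilinear \<beta> \<and> (\<forall>x. \<beta> x x = 0) \<and>
        (\<forall>x. induced_splitting C G p x = exp_form2 C p \<beta> (s0 p x)))"

text \<open>In the following three definitions the sign \<open>\<sigma>\<close> is \<open>1\<close> or \<open>-1\<close>.\<close>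

definition gproj :: "('m, 'r::finite) endo \<Rightarrow> real \<Rightarrow> ('m, 'r) endo" where
  "gproj G \<sigma> p e = (1 / 2) *\<^sub>R (e + \<sigma> *\<^sub>R G p e)"

definition glift ::
  "('m, 'n::finite, 'r::finite) courant_data \<Rightarrow> ('m, 'r) endo \<Rightarrow> real \<Rightarrow>
   ('m \<Rightarrow> real ^ 'n) \<Rightarrow> 'm \<Rightarrow> real ^ 'r" where
  "glift C G \<sigma> X p =
     (let \<epsilon> = anchor_dual C p (induced_metric C G p (X p)) in G p \<epsilon> + \<sigma> *\<^sub>R \<epsilon>)"

definition bismut ::
  "('m, 'n::finite, 'r::finite) courant_data \<Rightarrow> ('m, 'r) endo \<Rightarrow> real \<Rightarrow> ('m, 'n) conn" where
  "bismut C G \<sigma> X Y p =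
     anchor C p (gproj G \<sigma> p (cbracket C (glift C G (- \<sigma>) X) (glift C G \<sigma> Y) p))"

definition ricci_endo ::
  "('m, 'n::finite, 'r::finite) courant_data \<Rightarrow> ('m, 'r) endo \<Rightarrow>
   ('m, 'n) form2 \<Rightarrow> ('m, 'n) form2 \<Rightarrow> ('m, 'r) endo" where
  "ricci_endo C G h k p =
     (let \<eta> = (\<lambda>e. anchor_dual C p (\<lambda>y. h p (anchor C p e) y + k p (anchor C p e) y));
          Pp = gproj G 1 p; Pm = gproj G (- 1) p
      in (\<lambda>e. Pm (\<eta> (Pp e)) - Pp (pairing_adjoint C p \<eta> (Pm e))))"

definition generalized_ricci ::
  "('m, 'n::finite, 'r::finite) courant_data \<Rightarrow> ('m, 'r) endo \<Rightarrow> ('m, 'r) endo" where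
  "generalized_ricci C G =
     (let Rm = ricci (atlas C) (bismut C G (- 1)) in
      ricci_endo C G (\<lambda>p x y. 1 / 2 * (Rm p x y + Rm p y x)) (\<lambda>p x y. 1 / 2 * (Rm p x y - Rm p y x)))"

text \<open>The fibre of \<open>End(E)\<close> is finite dimensional, so its elements are differentiated in \<open>t\<close> pointwise.\<close>

definition generalized_ricci_flow ::
  "('m, 'n::finite, 'r::finite) courant_data \<Rightarrow> real set \<Rightarrow> (real \<Rightarrow> ('m, 'r) endo) \<Rightarrow> bool" where
  "generalized_ricci_flow C I G \<longleftrightarrow>
     (\<forall>t\<in>I. \<forall>p e.
       (let R = generalized_ricci C (G t) in
        ((\<lambda>\<tau>. G \<tau> p e) has_vector_derivative (- 2) *\<^sub>R (R p (G t p e) - G t p (R p e)))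
          (at t within I)))"

end

theory Submission
  imports Defs
begin

text \<open>
  In the splitting \<open>s\<^sub>G\<close> the generalized metric exchanges \<open>TM\<close> and \<open>T\<^sup>*M\<close> through \<open>g\<close>, so
  prescribing \<open>\<partial>\<^sub>t G\<close> is equivalent to prescribing the derivatives of \<open>g\<close> and \<open>b\<close>. With \<open>N = Ric (\<nabla>\<^sup>-)\<close>, the
  pairing of \<open>-2 [R, G]\<close> with the blocks of \<open>E\<close> gives \<open>\<partial>\<^sub>t g = -(N + N\<^sup>T)\<close> and
  \<open>\<partial>\<^sub>t b = -(N - N\<^sup>T)\<close>.

  The axioms of the bracket show that \<open>\<nabla>\<^sup>\<plusminus>\<close> are metric connections with torsion \<open>\<plusminus> g\<^sup>-\<^sup>1 H\<close>. Hence
  \<open>(\<nabla>\<^sup>+ + \<nabla>\<^sup>-) / 2\<close> is the Levi-Civita connection, which thereby exists, and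
  \<open>\<nabla>\<^sup>- = \<nabla> - g\<^sup>-\<^sup>1 H / 2\<close>. Expanding the curvature and taking the trace yields
  \<open>N = Ric (\<nabla>) + d\<^sup>*H / 2 - H\<^sup>2 / 4\<close>, whose symmetric and skew parts are the two right-hand sides of
  the \<open>B\<close>-field flow; \<open>Ric (\<nabla>)\<close> is symmetric by the pair symmetry of the curvature.

  The analysis on \<open>M\<close> enters only through bump functions, which make operations that are linear
  over functions pointwise, and through Cramer's rule, by which the lifts \<open>TM \<rightarrow> V\<^sub>\<plusminus>\<close> are smooth.
\<close>

section \<open>Calculus of smooth maps\<close>

text \<open>Nothing is assumed about how the family depends on t, so each side of the equivalence
  has to supply the differentiability used on the other. Time derivatives are therefore taken in a
  single fibre and relative to \<open>s0\<close>, which does not move with t: there \<open>G\<close>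
  has a block form in the inverse of g, in g and in b, and g is recovered by inverting
  \<open>\<pi> G \<pi>\<^sup>*\<close>. The delicate point is that the inverse of a family that is
  differentiable at t is again differentiable at t. The right-hand sides involve only one fixed
  time.

  Tensors are evaluated on arbitrarily chosen extensions of tangent vectors, and the extension of a
  sum need not be the sum of the extensions. So even the bilinearity of N has to be derived from
  tensoriality, and it is this bilinearity that gives the adjoint in \<open>\<bold>R\<close> its
  value.

  Coordinates disappear early: the rules for Lie brackets, and the smoothness of X f, are read off
  from the axioms of the Courant bracket, whose sections lift all vector fields.\<close>

text \<open>Congruence at order k is a hypothesis because \<open>Ck_on_cong\<close> is itself proved
  by induction through this rule; \<open>Ck_on_derivI\<close> later discharges it.\<close>

lemma Ck_on_SucI:
  assumes "open S" "\<And>x. x \<in> S \<Longrightarrow> (f has_derivative f' x) (at x)"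
    and "\<And>v. Ck_on k S (\<lambda>x. f' x v)"
    and cong: "\<And>f g :: 'a \<Rightarrow> 'b. Ck_on k S f \<Longrightarrow> (\<And>x. x \<in> S \<Longrightarrow> f x = g x) \<Longrightarrow> Ck_on k S g"
  shows "Ck_on (Suc k) S (f :: 'a::real_normed_vector \<Rightarrow> 'b::real_normed_vector)"
proof -
  have "frechet_derivative f (at x) v = f' x v" if "x \<in> S" for x v
    using frechet_derivative_at[OF assms(2)[OF that]] by simp
  then show ?thesis
    using assms(2) by (auto simp: differentiable_def intro: cong[OF assms(3)])
qed

lemma Ck_on_cong:
  assumes "open S" "\<And>x. x \<in> S \<Longrightarrow> f x = g x" "Ck_on k S f"
  shows "Ck_on k S g"
  using assms(2,3)
proof (induction k arbitrary: f g)
  case 0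
  then show ?case by (auto cong: continuous_on_cong)
next
  case (Suc k)
  show ?case
  proof (rule Ck_on_SucI[OF assms(1)])
    fix x assume "x \<in> S"
    then have "(f has_derivative frechet_derivative f (at x)) (at x)"
      using Suc.prems frechet_derivative_works by auto
    then show "(g has_derivative frechet_derivative f (at x)) (at x)"
      by (rule has_derivative_transform_within_open[OF _ assms(1) \<open>x \<in> S\<close>]) (use Suc.prems in auto)
  qed (use Suc in auto)
qed

lemma Ck_on_derivI:
  assumes "open S" "\<And>x. x \<in> S \<Longrightarrow> (f has_derivative f' x) (at x)" "\<And>v. Ck_on k S (\<lambda>x. f' x v)"
  shows "Ck_on (Suc k) S f"
  by (rule Ck_on_SucI[OF assms Ck_on_cong[OF assms(1)]]) auto

lemma Ck_on_Suc_has_derivative: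
  "Ck_on (Suc k) S f \<Longrightarrow> x \<in> S \<Longrightarrow> (f has_derivative frechet_derivative f (at x)) (at x)"
  using frechet_derivative_works by auto

lemma Ck_on_subset: "Ck_on k T f \<Longrightarrow> S \<subseteq> T \<Longrightarrow> Ck_on k S f"
  by (induction k arbitrary: f) (auto intro: continuous_on_subset)

lemma Ck_on_UnionI:
  assumes "\<And>x. x \<in> S \<Longrightarrow> \<exists>T. open T \<and> x \<in> T \<and> Ck_on k T f"
  shows "Ck_on k S f"
  using assms
proof (induction k arbitrary: f)
  case 0
  then show ?case
    by (meson Ck_on.simps(1) continuous_at_imp_continuous_on continuous_on_eq_continuous_at)
next
  case (Suc k)
  have "f differentiable at x" if "x \<in> S" for x
    using Suc.prems[OF that] by auto
  moreover have "Ck_on k S (\<lambda>x. frechet_derivative f (at x) v)" for v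
    by (rule Suc.IH) (use Suc.prems in fastforce)
  ultimately show ?case by simp
qed

lemma Ck_on_Suc_imp: "Ck_on (Suc k) S f \<Longrightarrow> Ck_on k S f"
proof (induction k arbitrary: f)
  case 0
  then show ?case
    by (auto intro!: continuous_at_imp_continuous_on differentiable_imp_continuous_within)
qed simp

lemma Ck_on_const: "open S \<Longrightarrow> Ck_on k S (\<lambda>x. c)"
proof (induction k arbitrary: c)
  case (Suc k)
  show ?case
    by (rule Ck_on_derivI[where f' = "\<lambda>x v. 0"]) (use Suc in auto)
qed auto

lemma Ck_on_bounded_linear_comp:
  assumes "bounded_linear L" "open S" "Ck_on k S f"
  shows "Ck_on k S (\<lambda>x. L (f x))"
  using assms(3)
proof (induction k arbitrary: f)
  case 0
  then show ?case using assms(1) by (auto intro: bounded_linear.continuous_on)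
next
  case (Suc k)
  show ?case
    by (rule Ck_on_derivI[OF assms(2) bounded_linear.has_derivative[OF assms(1) Ck_on_Suc_has_derivative[OF Suc.prems]]])
      (use Suc in auto)
qed

lemma Ck_on_bounded_linear:
  assumes "bounded_linear L" "open S"
  shows "Ck_on k S L"
proof (cases k)
  case 0
  then show ?thesis using assms by (simp add: linear_continuous_on)
next
  case (Suc j)
  show ?thesis unfolding Suc
    by (rule Ck_on_derivI[where f' = "\<lambda>x. L"])
      (use assms in \<open>auto intro: bounded_linear_imp_has_derivative Ck_on_const\<close>)
qed

lemma Ck_on_add:
  assumes "open S" "Ck_on k S f" "Ck_on k S g"
  shows "Ck_on k S (\<lambda>x. f x + g x)"
  using assms(2,3)
proof (induction k arbitrary: f g)
  case 0
  then show ?case by (auto intro: continuous_on_add)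
next
  case (Suc k)
  show ?case
    by (rule Ck_on_derivI[OF assms(1) has_derivative_add[OF Suc.prems[THEN Ck_on_Suc_has_derivative]]])
      (use Suc in auto)
qed

lemma Ck_on_sum:
  assumes "open S" "\<And>i. i \<in> J \<Longrightarrow> Ck_on k S (f i)"
  shows "Ck_on k S (\<lambda>x. \<Sum>i\<in>J. f i x)"
  using assms(2)
proof (induction J rule: infinite_finite_induct)
  case (insert i J)
  then show ?case by (simp add: Ck_on_add[OF assms(1)])
qed (auto simp: Ck_on_const assms(1))

lemma Ck_on_bilinear:
  assumes "bounded_bilinear B" "open S" "Ck_on k S f" "Ck_on k S g"
  shows "Ck_on k S (\<lambda>x. B (f x) (g x))"
  using assms(3,4)
proof (induction k arbitrary: f g)
  case 0
  then show ?case by (auto intro: bounded_bilinear.continuous_on[OF assms(1)])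
next
  case (Suc k)
  have d: "Ck_on k S (\<lambda>x. B (f x) (frechet_derivative g (at x) v) + B (frechet_derivative f (at x) v) (g x))" for v
    using Suc.prems Suc.prems[THEN Ck_on_Suc_imp] by (intro Ck_on_add[OF assms(2)] Suc.IH) auto
  show ?case
    by (rule Ck_on_derivI[OF assms(2) bounded_bilinear.FDERIV[OF assms(1) Suc.prems[THEN Ck_on_Suc_has_derivative]] d])
qed

lemma Ck_on_inverse:
  fixes f :: "'a::real_normed_vector \<Rightarrow> real"
  assumes "open S" "\<And>x. x \<in> S \<Longrightarrow> f x \<noteq> 0" "Ck_on k S f"
  shows "Ck_on k S (\<lambda>x. inverse (f x))"
  using assms(3)
proof (induction k)
  case 0
  then show ?case using assms(2) by (auto intro!: continuous_on_inverse)
next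
  case (Suc k)
  have i: "Ck_on k S (\<lambda>x. inverse (f x))"
    using Suc Ck_on_Suc_imp by blast
  have m: "Ck_on k S (\<lambda>x. u x * v x)" if "Ck_on k S u" "Ck_on k S v" for u v :: "'a \<Rightarrow> real"
    by (rule Ck_on_bilinear[OF bounded_bilinear_mult assms(1) that])
  show ?case
  proof (rule Ck_on_derivI[OF assms(1)])
    show "((\<lambda>x. inverse (f x)) has_derivative
        (\<lambda>h. - 1 * (inverse (f x) * frechet_derivative f (at x) h * inverse (f x)))) (at x)"
      if "x \<in> S" for x
      using Deriv.has_derivative_inverse[OF assms(2)[OF that] Ck_on_Suc_has_derivative[OF Suc.prems that]] by simp
    show "Ck_on k S (\<lambda>x. - 1 * (inverse (f x) * frechet_derivative f (at x) v * inverse (f x)))" for v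
      using Suc.prems by (intro m i Ck_on_const assms(1)) auto
  qed
qed

text \<open>The derivative of f at g x is applied to a direction that varies with x, while
  \<open>Ck_on\<close> tests fixed directions only. Expanding the direction in the basis of the
  euclidean space in the middle yields a finite sum of products to which the induction hypothesis
  applies.\<close>

lemma Ck_on_compose:
  fixes g :: "'a::real_normed_vector \<Rightarrow> 'b::euclidean_space"
  assumes "open S" "open T" "g ` S \<subseteq> T" "Ck_on k S g" "Ck_on k T f"
  shows "Ck_on k S (\<lambda>x. f (g x))"
  using assms(4,5)
proof (induction k arbitrary: f)
  case 0
  then show ?case using assms(3) by (auto intro: continuous_on_compose2)
next
  case (Suc k)
  have d: "((\<lambda>x. f (g x)) has_derivative
      (\<lambda>v. frechet_derivative f (at (g x)) (frechet_derivative g (at x) v))) (at x)" if "x \<in> S" for x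
    by (rule has_derivative_compose[OF Ck_on_Suc_has_derivative[OF Suc.prems(1) that]
          Ck_on_Suc_has_derivative[OF Suc.prems(2)]]) (use that assms(3) in auto)
  have e: "frechet_derivative f (at (g x)) w =
      (\<Sum>b\<in>Basis. (w \<bullet> b) *\<^sub>R frechet_derivative f (at (g x)) b)" if "x \<in> S" for x w
  proof -
    have l: "linear (frechet_derivative f (at (g x)))"
      by (rule has_derivative_linear[OF Ck_on_Suc_has_derivative[OF Suc.prems(2)]])
        (use assms(3) that in blast)
    have "frechet_derivative f (at (g x)) w = frechet_derivative f (at (g x)) (\<Sum>b\<in>Basis. (w \<bullet> b) *\<^sub>R b)"
      by (simp only: euclidean_representation)
    then show ?thesis by (simp only: linear_sum[OF l] linear_cmul[OF l])
  qed
  show ?case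
  proof (rule Ck_on_derivI[OF assms(1), where f' = "\<lambda>x v. \<Sum>b\<in>Basis.
        (frechet_derivative g (at x) v \<bullet> b) *\<^sub>R frechet_derivative f (at (g x)) b"])
    show "((\<lambda>x. f (g x)) has_derivative (\<lambda>v. \<Sum>b\<in>Basis.
        (frechet_derivative g (at x) v \<bullet> b) *\<^sub>R frechet_derivative f (at (g x)) b)) (at x)" if "x \<in> S" for x
      by (rule has_derivative_eq_rhs[OF d[OF that]]) (rule ext, rule e[OF that])
    show "Ck_on k S (\<lambda>x. \<Sum>b\<in>Basis.
        (frechet_derivative g (at x) v \<bullet> b) *\<^sub>R frechet_derivative f (at (g x)) b)" for v
    proof (intro Ck_on_sum[OF assms(1)] Ck_on_bilinear[OF bounded_bilinear_scaleR assms(1)])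
      fix b :: 'b
      show "Ck_on k S (\<lambda>x. frechet_derivative g (at x) v \<bullet> b)"
        by (rule Ck_on_bounded_linear_comp[OF bounded_linear_inner_left assms(1)]) (use Suc.prems in auto)
      show "Ck_on k S (\<lambda>x. frechet_derivative f (at (g x)) b)"
        by (rule Suc.IH[OF Ck_on_Suc_imp]) (use Suc.prems in auto)
    qed
  qed
qed

lemma Cinf_on_cong: "open S \<Longrightarrow> (\<And>x. x \<in> S \<Longrightarrow> f x = g x) \<Longrightarrow> Cinf_on S f \<Longrightarrow> Cinf_on S g"
  unfolding Cinf_on_def by (blast intro: Ck_on_cong)

lemma Cinf_on_subset: "Cinf_on T f \<Longrightarrow> S \<subseteq> T \<Longrightarrow> Cinf_on S f"
  unfolding Cinf_on_def by (blast intro: Ck_on_subset)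

lemma Cinf_on_UnionI:
  assumes "\<And>x. x \<in> S \<Longrightarrow> \<exists>T. open T \<and> x \<in> T \<and> Cinf_on T f"
  shows "Cinf_on S f"
  using assms unfolding Cinf_on_def by (meson Ck_on_UnionI)

lemma Cinf_on_const: "open S \<Longrightarrow> Cinf_on S (\<lambda>x. c)"
  unfolding Cinf_on_def by (blast intro: Ck_on_const)

lemma Cinf_on_bounded_linear_comp:
  "bounded_linear L \<Longrightarrow> open S \<Longrightarrow> Cinf_on S f \<Longrightarrow> Cinf_on S (\<lambda>x. L (f x))"
  unfolding Cinf_on_def by (blast intro: Ck_on_bounded_linear_comp)

lemma Cinf_on_bounded_linear: "bounded_linear L \<Longrightarrow> open S \<Longrightarrow> Cinf_on S L"
  unfolding Cinf_on_def by (blast intro: Ck_on_bounded_linear)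

lemma Cinf_on_add: "open S \<Longrightarrow> Cinf_on S f \<Longrightarrow> Cinf_on S g \<Longrightarrow> Cinf_on S (\<lambda>x. f x + g x)"
  unfolding Cinf_on_def by (blast intro: Ck_on_add)

lemma Cinf_on_bilinear:
  "bounded_bilinear B \<Longrightarrow> open S \<Longrightarrow> Cinf_on S f \<Longrightarrow> Cinf_on S g \<Longrightarrow> Cinf_on S (\<lambda>x. B (f x) (g x))"
  unfolding Cinf_on_def by (blast intro: Ck_on_bilinear)

lemma Cinf_on_inverse:
  fixes f :: "'a::real_normed_vector \<Rightarrow> real"
  shows "open S \<Longrightarrow> (\<And>x. x \<in> S \<Longrightarrow> f x \<noteq> 0) \<Longrightarrow> Cinf_on S f \<Longrightarrow> Cinf_on S (\<lambda>x. inverse (f x))"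
  unfolding Cinf_on_def by (blast intro: Ck_on_inverse)

lemma Cinf_on_compose:
  fixes g :: "'a::real_normed_vector \<Rightarrow> 'b::euclidean_space"
  shows "open S \<Longrightarrow> open T \<Longrightarrow> g ` S \<subseteq> T \<Longrightarrow> Cinf_on S g \<Longrightarrow> Cinf_on T f \<Longrightarrow> Cinf_on S (\<lambda>x. f (g x))"
  unfolding Cinf_on_def by (blast intro: Ck_on_compose)

lemma Cinf_on_has_derivative:
  "Cinf_on S f \<Longrightarrow> x \<in> S \<Longrightarrow> (f has_derivative frechet_derivative f (at x)) (at x)"
  unfolding Cinf_on_def using Ck_on_Suc_has_derivative[of 0] by blast

lemma Cinf_on_frechet_derivative: "Cinf_on S f \<Longrightarrow> Cinf_on S (\<lambda>x. frechet_derivative f (at x) v)"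
  unfolding Cinf_on_def using Ck_on.simps(2) by blast

section \<open>A smooth bump function on Euclidean space\<close>

text \<open>The case n = 0 is the usual smooth function that is flat at 0. The powers make the
  family closed under differentiation up to linear combinations, so that smoothness follows by
  induction over all n at once.\<close>

definition flat :: "nat \<Rightarrow> real \<Rightarrow> real" where
  "flat n x = (if x > 0 then inverse x ^ n * exp (- inverse x) else 0)"

text \<open>With y = 1/x, the limit from the right is the decay of y^n / exp y at infinity.\<close>

lemma flat_tendsto_0: "(flat n \<longlongrightarrow> 0) (at 0)"
proof -
  have "((\<lambda>x::real. inverse x ^ n / exp (inverse x)) \<longlongrightarrow> 0) (at_right 0)"
    by (rule filterlim_compose[OF tendsto_power_div_exp_0 filterlim_inverse_at_top_right])
  then have "(flat n \<longlongrightarrow> 0) (at_right 0)"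
    by (rule Lim_transform_eventually)
      (auto simp: eventually_at_filter flat_def exp_minus field_simps)
  moreover have "(flat n \<longlongrightarrow> 0) (at_left 0)"
    by (rule Lim_transform_eventually[OF tendsto_const]) (auto simp: eventually_at_filter flat_def)
  ultimately show ?thesis
    by (simp add: filterlim_split_at)
qed

lemma flat_has_real_derivative:
  "(flat n has_real_derivative (flat (n + 2) x - real n * flat (n + 1) x)) (at x)"
proof -
  consider "x > 0" | "x = 0" | "x < 0" by linarith
  then show ?thesis
  proof cases
    case 1
    have "((\<lambda>x. inverse x ^ n * exp (- inverse x)) has_real_derivative
        (flat (n + 2) x - real n * flat (n + 1) x)) (at x)"
    proof -
      have p: "((\<lambda>x. inverse x ^ n) has_real_derivative - real n * inverse x ^ (n + 1)) (at x)"
      proof (cases n)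
        case (Suc m)
        have "((\<lambda>x. inverse x ^ n) has_real_derivative
            real n * (- (inverse x * inverse x) * inverse x ^ m)) (at x)"
          using DERIV_power[OF DERIV_inverse[of x UNIV], of n] 1 Suc
          by (simp add: power2_eq_square algebra_simps)
        then show ?thesis by (simp add: Suc algebra_simps)
      qed simp
      have e: "((\<lambda>x. exp (- inverse x)) has_real_derivative exp (- inverse x) * inverse x ^ 2) (at x)"
        using 1 by (auto intro!: derivative_eq_intros simp: power2_eq_square)
      show ?thesis
        using DERIV_mult[OF p e] 1 by (simp add: flat_def power_add power2_eq_square algebra_simps)
    qed
    then show ?thesis
      by (rule has_field_derivative_transform_within_open[where S = "{0<..}"])
        (use 1 in \<open>auto simp: flat_def\<close>)
  next
    case 2
    \<comment> \<open>The difference quotient of \<open>flat n\<close> at 0 is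
      \<open>flat (Suc n)\<close>.\<close>
    have "((\<lambda>h. (flat n (0 + h) - flat n 0) / h) \<longlongrightarrow> 0) (at 0)"
      by (rule Lim_transform_eventually[OF flat_tendsto_0[of "Suc n"]])
        (auto simp: flat_def eventually_at_filter field_simps)
    then show ?thesis using 2 by (simp add: DERIV_def flat_def)
  next
    case 3
    have "((\<lambda>x. 0) has_real_derivative (flat (n + 2) x - real n * flat (n + 1) x)) (at x)"
      using 3 by (simp add: flat_def)
    then show ?thesis
      by (rule has_field_derivative_transform_within_open[where S = "{..<0}"])
        (use 3 in \<open>auto simp: flat_def\<close>)
  qed
qed

lemma Cinf_on_flat: "Cinf_on UNIV (flat n)"
proof -
  have "Ck_on k UNIV (flat n)" for k
  proof (induction k arbitrary: n)
    case 0
    have "isCont (flat n) x" for x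
      using flat_has_real_derivative DERIV_isCont by blast
    then show ?case by (simp add: continuous_at_imp_continuous_on)
  next
    case (Suc k)
    have m: "Ck_on k UNIV (\<lambda>x. u x * v x)" if "Ck_on k UNIV u" "Ck_on k UNIV v" for u v :: "real \<Rightarrow> real"
      by (rule Ck_on_bilinear[OF bounded_bilinear_mult open_UNIV that])
    have "Ck_on k UNIV (\<lambda>x. (flat (n + 2) x + - real n * flat (n + 1) x) * v)" for v
      by (intro m Ck_on_add Ck_on_const Suc) auto
    then show ?case
      using flat_has_real_derivative[unfolded has_field_derivative_def]
      by (intro Ck_on_derivI) auto
  qed
  then show ?thesis by (simp add: Cinf_on_def)
qed

text \<open>The function is \<open>flat 0\<close> of r^2 - |x - a|^2, divided by its value at the
  centre; outside the ball the argument is not positive.\<close>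

lemma bump_function:
  fixes a :: "'a::euclidean_space"
  assumes "0 < r"
  obtains \<beta> :: "'a \<Rightarrow> real" where "Cinf_on UNIV \<beta>" "\<beta> a = 1" "\<forall>x. x \<notin> cball a r \<longrightarrow> \<beta> x = 0"
proof
  have q: "Cinf_on UNIV (\<lambda>x. r\<^sup>2 + - 1 *\<^sub>R ((x + - a) \<bullet> (x + - a)))"
    by (intro Cinf_on_add Cinf_on_const Cinf_on_bilinear[OF bounded_bilinear_scaleR]
        Cinf_on_bilinear[OF bounded_bilinear_inner] Cinf_on_bounded_linear[OF bounded_linear_ident]) auto
  have "Cinf_on UNIV (\<lambda>x. flat 0 (r\<^sup>2 + - 1 *\<^sub>R ((x + - a) \<bullet> (x + - a))))"
    by (rule Cinf_on_compose[OF _ _ _ q Cinf_on_flat]) auto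
  then show "Cinf_on UNIV (\<lambda>x. inverse (flat 0 (r\<^sup>2)) * flat 0 (r\<^sup>2 + - 1 *\<^sub>R ((x + - a) \<bullet> (x + - a))))"
    by (intro Cinf_on_bilinear[OF bounded_bilinear_mult] Cinf_on_const) auto
  show "inverse (flat 0 (r\<^sup>2)) * flat 0 (r\<^sup>2 + - 1 *\<^sub>R ((a + - a) \<bullet> (a + - a))) = 1"
    using assms by (simp add: flat_def)
  show "\<forall>x. x \<notin> cball a r \<longrightarrow>
      inverse (flat 0 (r\<^sup>2)) * flat 0 (r\<^sup>2 + - 1 *\<^sub>R ((x + - a) \<bullet> (x + - a))) = 0"
  proof (intro allI impI)
    fix x assume that: "x \<notin> cball a r"
    have "r\<^sup>2 \<le> (norm (x - a))\<^sup>2"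
      using that assms by (intro power_mono) (auto simp: dist_norm norm_minus_commute)
    then show "inverse (flat 0 (r\<^sup>2)) * flat 0 (r\<^sup>2 + - 1 *\<^sub>R ((x + - a) \<bullet> (x + - a))) = 0"
      by (simp add: flat_def dot_square_norm)
  qed
qed

section \<open>Derivatives of families of linear maps\<close>

text \<open>Derivatives of L at fixed vectors suffice because the domain has finite dimension:
  expanding m in the standard basis leaves a finite sum of products of a scalar and a vector
  function.\<close>

lemma has_vector_derivative_linear_family:
  fixes L :: "real \<Rightarrow> real ^ 'k \<Rightarrow> 'b::real_normed_vector"
  assumes t: "t \<in> I" and lin: "\<And>\<tau>. \<tau> \<in> I \<Longrightarrow> linear (L \<tau>)" and lin': "linear L'"
    and L: "\<And>x. ((\<lambda>\<tau>. L \<tau> x) has_vector_derivative L' x) (at t within I)"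
    and m: "(m has_vector_derivative m') (at t within I)"
  shows "((\<lambda>\<tau>. L \<tau> (m \<tau>)) has_vector_derivative L' (m t) + L t m') (at t within I)"
proof -
  have e: "f x = (\<Sum>i\<in>UNIV. x $ i *\<^sub>R f (axis i 1))" if "linear f" for f :: "real ^ 'k \<Rightarrow> 'b" and x
    using linear_sum[OF that, of "\<lambda>i. x $ i *\<^sub>R axis i 1" UNIV] basis_expansion[of x]
    by (simp add: linear_cmul[OF that] scalar_mult_eq_scaleR)
  have mi: "((\<lambda>\<tau>. m \<tau> $ i) has_real_derivative m' $ i) (at t within I)" for i
    using bounded_linear.has_vector_derivative[OF bounded_linear_vec_nth m]
    by (simp add: has_real_derivative_iff_has_vector_derivative)
  have "((\<lambda>\<tau>. \<Sum>i\<in>UNIV. m \<tau> $ i *\<^sub>R L \<tau> (axis i 1)) has_vector_derivative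
      (\<Sum>i\<in>UNIV. m t $ i *\<^sub>R L' (axis i 1) + m' $ i *\<^sub>R L t (axis i 1))) (at t within I)"
    by (intro has_vector_derivative_sum has_vector_derivative_scaleR mi L)
  moreover have "(\<Sum>i\<in>UNIV. m t $ i *\<^sub>R L' (axis i 1) + m' $ i *\<^sub>R L t (axis i 1)) = L' (m t) + L t m'"
    unfolding e[OF lin', of "m t"] e[OF lin[OF t], of m'] by (rule sum.distrib)
  ultimately have "((\<lambda>\<tau>. \<Sum>i\<in>UNIV. m \<tau> $ i *\<^sub>R L \<tau> (axis i 1)) has_vector_derivative L' (m t) + L t m') (at t within I)"
    by simp
  then show ?thesis
    by (rule has_vector_derivative_transform[OF t, rotated]) (rule e[OF lin])
qed

lemma has_vector_derivative_vecI:
  fixes f :: "real \<Rightarrow> real ^ 'k"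
  assumes "\<And>k. ((\<lambda>\<tau>. f \<tau> $ k) has_real_derivative d $ k) (at t within I)"
  shows "(f has_vector_derivative d) (at t within I)"
proof -
  have e: "(\<Sum>k\<in>UNIV. x $ k *\<^sub>R axis k (1::real)) = x" for x :: "real ^ 'k"
    using basis_expansion[of x] by (simp add: scalar_mult_eq_scaleR)
  have "((\<lambda>\<tau>. \<Sum>k\<in>UNIV. f \<tau> $ k *\<^sub>R axis k (1::real)) has_vector_derivative
      (\<Sum>k\<in>UNIV. f t $ k *\<^sub>R 0 + d $ k *\<^sub>R axis k 1)) (at t within I)"
    by (intro has_vector_derivative_sum has_vector_derivative_scaleR assms has_vector_derivative_const)
  then show ?thesis by (simp add: e)
qed

lemma field_differentiable_det:
  fixes M :: "real \<Rightarrow> real ^ 'k ^ 'k"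
  assumes "\<And>i j. (\<lambda>\<tau>. M \<tau> $ i $ j) field_differentiable (at t within I)"
  shows "(\<lambda>\<tau>. det (M \<tau>)) field_differentiable (at t within I)"
proof -
  have "(\<lambda>\<tau>. \<Prod>i\<in>J. M \<tau> $ i $ \<pi> i) field_differentiable (at t within I)" for J \<pi>
    by (induction J rule: infinite_finite_induct) (auto intro: field_differentiable_mult assms)
  then show ?thesis
    unfolding det_def by (intro field_differentiable_sum field_differentiable_mult) auto
qed

text \<open>Differentiating L (M x) = x yields the formula once M x is known to be differentiable.
  Cramer's rule provides this, since it writes the components of M x as quotients of determinants in
  the entries of L.\<close>

lemma has_vector_derivative_inverse_family:
  fixes L M :: "real \<Rightarrow> real ^ 'k \<Rightarrow> real ^ 'k"
  assumes t: "t \<in> I" and lin: "\<And>\<tau>. \<tau> \<in> I \<Longrightarrow> linear (L \<tau>)" and lin': "linear L'"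
    and inv: "\<And>\<tau> x. \<tau> \<in> I \<Longrightarrow> L \<tau> (M \<tau> x) = x" "\<And>\<tau> x. \<tau> \<in> I \<Longrightarrow> M \<tau> (L \<tau> x) = x"
    and L: "\<And>x. ((\<lambda>\<tau>. L \<tau> x) has_vector_derivative L' x) (at t within I)"
  shows "((\<lambda>\<tau>. M \<tau> x) has_vector_derivative - M t (L' (M t x))) (at t within I)"
proof (cases "at t within I = bot")
  \<comment> \<open>Here t is not a limit point of I, every vector is a derivative, and the
    uniqueness used in the other case fails.\<close>
  case True
  then show ?thesis
    unfolding has_vector_derivative_def has_derivative_def
    by (simp only: bounded_linear_scaleR_left tendsto_bot simp_thms)
next
  case False
  have Lm: "matrix (L \<tau>) *v y = L \<tau> y" if "\<tau> \<in> I" for \<tau> y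
    using matrix_works[of "L \<tau>"] lin[OF that] by (simp add: linear_matrix_vector_mul_eq)
  have det: "det (matrix (L \<tau>)) \<noteq> 0" if "\<tau> \<in> I" for \<tau>
  proof -
    have "inj ((*v) (matrix (L \<tau>)))"
      using inv(2)[OF that] Lm[OF that] by (intro injI) metis
    then show ?thesis
      using matrix_left_invertible_injective invertible_left_inverse invertible_det_nz by blast
  qed
  have Lij: "(\<lambda>\<tau>. matrix (L \<tau>) $ i $ j) field_differentiable (at t within I)" for i j
    using bounded_linear.has_vector_derivative[OF bounded_linear_vec_nth L, of "axis j 1" i]
    unfolding field_differentiable_def has_real_derivative_iff_has_vector_derivative
    by (auto simp: matrix_def)
  have "\<exists>d. ((\<lambda>\<tau>. M \<tau> x $ k) has_real_derivative d) (at t within I)" for k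
  proof -
    have "(\<lambda>\<tau>. (\<chi> i j. if j = k then x $ i else matrix (L \<tau>) $ i $ j) $ i $ j) field_differentiable (at t within I)" for i j
      using Lij by (cases "j = k") simp_all
    then have "(\<lambda>\<tau>. det (\<chi> i j. if j = k then x $ i else matrix (L \<tau>) $ i $ j) / det (matrix (L \<tau>)))
        field_differentiable (at t within I)"
      by (intro field_differentiable_divide field_differentiable_det Lij det t)
    then obtain d where "((\<lambda>\<tau>. det (\<chi> i j. if j = k then x $ i else matrix (L \<tau>) $ i $ j) / det (matrix (L \<tau>)))
        has_real_derivative d) (at t within I)"
      unfolding field_differentiable_def by blast
    moreover have "M \<tau> x $ k = det (\<chi> i j. if j = k then x $ i else matrix (L \<tau>) $ i $ j) / det (matrix (L \<tau>))"
      if "\<tau> \<in> I" for \<tau>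
    proof -
      have "matrix (L \<tau>) *v M \<tau> x = x" using Lm inv that by simp
      then show ?thesis using cramer[OF det[OF that], of "M \<tau> x" x] by simp
    qed
    ultimately have "((\<lambda>\<tau>. M \<tau> x $ k) has_real_derivative d) (at t within I)"
      unfolding has_real_derivative_iff_has_vector_derivative
      by (auto intro: has_vector_derivative_transform[OF t])
    then show ?thesis by blast
  qed
  then obtain d where d: "\<And>k. ((\<lambda>\<tau>. M \<tau> x $ k) has_real_derivative d k) (at t within I)" by metis
  define v where "v = (\<chi> k. d k)"
  have v: "((\<lambda>\<tau>. M \<tau> x) has_vector_derivative v) (at t within I)"
    by (rule has_vector_derivative_vecI) (simp add: v_def d)
  have "((\<lambda>\<tau>. L \<tau> (M \<tau> x)) has_vector_derivative L' (M t x) + L t v) (at t within I)"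
    by (rule has_vector_derivative_linear_family[OF t lin lin' L v])
  moreover have "((\<lambda>\<tau>. L \<tau> (M \<tau> x)) has_vector_derivative 0) (at t within I)"
    by (rule has_vector_derivative_transform[OF t _ has_vector_derivative_const[of x]]) (simp add: inv)
  ultimately have "L' (M t x) + L t v = 0"
    using vector_derivative_unique_within[OF False] by blast
  then have "L t v = - L' (M t x)" by (rule minus_unique[symmetric])
  then have "L t v = L t (- M t (L' (M t x)))"
    by (simp add: linear_neg[OF lin[OF t]] inv(1)[OF t])
  then have "M t (L t v) = M t (L t (- M t (L' (M t x))))" by (rule arg_cong)
  then have "v = - M t (L' (M t x))" by (simp only: inv(2)[OF t])
  then show ?thesis using v by simp
qed

section \<open>Smooth functions on a manifold\<close>

locale smooth_manifold =
  fixes A :: "('m::{t2_space,second_countable_topology}, 'n::finite) chart set"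
  assumes atlas: "smooth_atlas A"
begin

lemma
  assumes "c \<in> A"
  shows open_chart_dom: "open (fst c)"
    and open_chart_im: "open (snd c ` fst c)"
    and chart_homeomorphism: "homeomorphism (fst c) (snd c ` fst c) (snd c) (chart_inv c)"
  using assms atlas unfolding smooth_atlas_def by auto

lemma chart_inv_chart [simp]: "c \<in> A \<Longrightarrow> p \<in> fst c \<Longrightarrow> chart_inv c (snd c p) = p"
  using chart_homeomorphism homeomorphism_apply1 by blast

lemma chart_inv_chart_pair [simp]: "(U, \<phi>) \<in> A \<Longrightarrow> p \<in> U \<Longrightarrow> inv_into U \<phi> (\<phi> p) = p"
  using chart_inv_chart[of "(U, \<phi>)"] by simp

lemma chart_transition:
  "c \<in> A \<Longrightarrow> d \<in> A \<Longrightarrow> Cinf_on (snd c ` (fst c \<inter> fst d)) (snd d \<circ> chart_inv c)"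
  using atlas unfolding smooth_atlas_def by blast

lemma open_chart_image:
  assumes "c \<in> A" "open W"
  shows "open (snd c ` (fst c \<inter> W))"
proof -
  have "openin (top_of_set (snd c ` fst c)) (snd c ` (fst c \<inter> W))"
    by (rule homeomorphism_imp_open_map[OF chart_homeomorphism[OF assms(1)]])
      (use assms open_chart_dom in \<open>auto simp: openin_open\<close>)
  then show ?thesis
    using open_chart_im[OF assms(1)] by (simp add: openin_open_eq)
qed

lemma
  shows chart_at_in: "chart_at A p \<in> A" and in_chart_at: "p \<in> fst (chart_at A p)"
proof -
  have "p \<in> \<Union> (fst ` A)"
    using atlas unfolding smooth_atlas_def by simp
  then have "\<exists>c. c \<in> A \<and> p \<in> fst c" by blast
  from someI_ex[OF this] show "chart_at A p \<in> A" "p \<in> fst (chart_at A p)"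
    by (auto simp: chart_at_def)
qed

lemma smooth_on_mfdD:
  "smooth_on_mfd A W f \<Longrightarrow> c \<in> A \<Longrightarrow> Cinf_on (snd c ` (fst c \<inter> W)) (\<lambda>x. f (chart_inv c x))"
  by (simp add: smooth_on_mfd_def comp_def)

lemma smooth_on_mfdI:
  "(\<And>c. c \<in> A \<Longrightarrow> Cinf_on (snd c ` (fst c \<inter> W)) (\<lambda>x. f (chart_inv c x))) \<Longrightarrow> smooth_on_mfd A W f"
  by (simp add: smooth_on_mfd_def comp_def)

lemma smooth_on_mfd_cong:
  assumes "open W" "\<And>q. q \<in> W \<Longrightarrow> f q = g q" "smooth_on_mfd A W f"
  shows "smooth_on_mfd A W g"
proof (rule smooth_on_mfdI)
  fix c assume c: "c \<in> A"
  show "Cinf_on (snd c ` (fst c \<inter> W)) (\<lambda>x. g (chart_inv c x))"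
    by (rule Cinf_on_cong[OF open_chart_image[OF c assms(1)] _ smooth_on_mfdD[OF assms(3) c]])
      (use c assms(2) in auto)
qed

lemma smooth_on_mfd_subset: "smooth_on_mfd A W f \<Longrightarrow> V \<subseteq> W \<Longrightarrow> smooth_on_mfd A V f"
  unfolding smooth_on_mfd_def by (meson Cinf_on_subset Int_mono image_mono subset_refl)

lemma smooth_on_mfd_local:
  assumes "\<And>p. p \<in> W \<Longrightarrow> \<exists>N. open N \<and> p \<in> N \<and> smooth_on_mfd A N f"
  shows "smooth_on_mfd A W f"
proof (rule smooth_on_mfdI)
  fix c assume c: "c \<in> A"
  show "Cinf_on (snd c ` (fst c \<inter> W)) (\<lambda>x. f (chart_inv c x))"
  proof (rule Cinf_on_UnionI)
    fix x assume "x \<in> snd c ` (fst c \<inter> W)"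
    then obtain p where p: "p \<in> fst c" "p \<in> W" "x = snd c p" by auto
    then obtain N where "open N" "p \<in> N" "smooth_on_mfd A N f" using assms by blast
    then show "\<exists>T. open T \<and> x \<in> T \<and> Cinf_on T (\<lambda>x. f (chart_inv c x))"
      using p c by (intro exI[of _ "snd c ` (fst c \<inter> N)"]) (auto intro: open_chart_image smooth_on_mfdD)
  qed
qed

lemma smooth_on_mfd_const: "open W \<Longrightarrow> smooth_on_mfd A W (\<lambda>q. k)"
  by (auto intro!: smooth_on_mfdI Cinf_on_const open_chart_image)

lemma smooth_on_mfd_add:
  "open W \<Longrightarrow> smooth_on_mfd A W f \<Longrightarrow> smooth_on_mfd A W g \<Longrightarrow> smooth_on_mfd A W (\<lambda>q. f q + g q)"
  by (rule smooth_on_mfdI, rule Cinf_on_add) (auto intro: open_chart_image smooth_on_mfdD)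

lemma smooth_on_mfd_bounded_linear:
  "bounded_linear L \<Longrightarrow> open W \<Longrightarrow> smooth_on_mfd A W f \<Longrightarrow> smooth_on_mfd A W (\<lambda>q. L (f q))"
  by (rule smooth_on_mfdI, rule Cinf_on_bounded_linear_comp) (auto intro: open_chart_image smooth_on_mfdD)

lemma smooth_on_mfd_bilinear:
  "bounded_bilinear L \<Longrightarrow> open W \<Longrightarrow> smooth_on_mfd A W f \<Longrightarrow> smooth_on_mfd A W g \<Longrightarrow>
    smooth_on_mfd A W (\<lambda>q. L (f q) (g q))"
  by (rule smooth_on_mfdI, rule Cinf_on_bilinear) (auto intro: open_chart_image smooth_on_mfdD)

lemmas smooth_on_mfd_scaleR = smooth_on_mfd_bilinear[OF bounded_bilinear_scaleR]
lemmas smooth_on_mfd_mult = smooth_on_mfd_bilinear[OF bounded_bilinear_mult]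

lemma smooth_on_mfd_inverse:
  fixes f :: "'m \<Rightarrow> real"
  assumes "open W" "\<And>q. q \<in> W \<Longrightarrow> f q \<noteq> 0" "smooth_on_mfd A W f"
  shows "smooth_on_mfd A W (\<lambda>q. inverse (f q))"
  by (rule smooth_on_mfdI, rule Cinf_on_inverse)
    (use assms in \<open>auto intro: open_chart_image smooth_on_mfdD\<close>)

lemma smooth_on_mfd_sum:
  assumes "open W" "\<And>i. i \<in> J \<Longrightarrow> smooth_on_mfd A W (f i)"
  shows "smooth_on_mfd A W (\<lambda>q. \<Sum>i\<in>J. f i q)"
  using assms(2)
  by (induction J rule: infinite_finite_induct)
    (simp_all add: smooth_on_mfd_add smooth_on_mfd_const assms(1))

lemma smooth_on_mfd_prod:
  fixes f :: "'i \<Rightarrow> 'm \<Rightarrow> real"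
  assumes "open W" "\<And>i. i \<in> J \<Longrightarrow> smooth_on_mfd A W (f i)"
  shows "smooth_on_mfd A W (\<lambda>q. \<Prod>i\<in>J. f i q)"
  using assms(2)
  by (induction J rule: infinite_finite_induct)
    (simp_all add: smooth_on_mfd_mult smooth_on_mfd_const assms(1))

lemma smooth_on_mfd_component: "open W \<Longrightarrow> smooth_on_mfd A W f \<Longrightarrow> smooth_on_mfd A W (\<lambda>q. f q $ i)"
  by (rule smooth_on_mfd_bounded_linear[OF bounded_linear_vec_nth])

lemma smooth_on_mfd_det:
  fixes M :: "'m \<Rightarrow> real ^ 'k ^ 'k"
  assumes "open W" "\<And>i j. smooth_on_mfd A W (\<lambda>q. M q $ i $ j)"
  shows "smooth_on_mfd A W (\<lambda>q. det (M q))"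
  unfolding det_def
  by (intro smooth_on_mfd_sum smooth_on_mfd_mult smooth_on_mfd_prod smooth_on_mfd_const assms)

lemma smooth_on_mfd_chart:
  assumes c: "c \<in> A" and W: "open W" "W \<subseteq> fst c" and f: "Cinf_on (snd c ` W) f"
  shows "smooth_on_mfd A W (\<lambda>q. f (snd c q))"
proof (rule smooth_on_mfdI)
  fix d assume d: "d \<in> A"
  have Wc: "fst c \<inter> W = W" using W by auto
  show "Cinf_on (snd d ` (fst d \<inter> W)) (\<lambda>x. f (snd c (chart_inv d x)))"
  proof (rule Cinf_on_compose[where T = "snd c ` W"])
    show "Cinf_on (snd d ` (fst d \<inter> W)) (\<lambda>x. snd c (chart_inv d x))"
      using chart_transition[OF d c, unfolded comp_def] by (rule Cinf_on_subset) (use W in auto)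
    show "(\<lambda>x. snd c (chart_inv d x)) ` snd d ` (fst d \<inter> W) \<subseteq> snd c ` W"
      using d by auto
    show "open (snd c ` W)" using open_chart_image[OF c W(1)] Wc by simp
  qed (use d W f open_chart_image in auto)
qed

text \<open>The sets W and - K form an open cover; on W the product is smooth, and on - K it is zero
  whatever f is there.\<close>

lemma smooth_extend_zero:
  assumes "smooth_on_mfd A UNIV \<phi>" "closed K" "\<forall>q. q \<notin> K \<longrightarrow> \<phi> q = 0" "K \<subseteq> W" "open W"
    and "smooth_on_mfd A W f"
  shows "smooth_on_mfd A UNIV (\<lambda>q. \<phi> q *\<^sub>R f q)"
proof (rule smooth_on_mfd_local)
  fix p
  show "\<exists>N. open N \<and> p \<in> N \<and> smooth_on_mfd A N (\<lambda>q. \<phi> q *\<^sub>R f q)"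
  proof (cases "p \<in> K")
    case True
    then show ?thesis
      using assms by (intro exI[of _ W]) (auto intro!: smooth_on_mfd_scaleR intro: smooth_on_mfd_subset)
  next
    case False
    have "smooth_on_mfd A (- K) (\<lambda>q. \<phi> q *\<^sub>R f q)"
      by (rule smooth_on_mfd_cong[OF _ _ smooth_on_mfd_const[of "- K" 0]]) (use assms in auto)
    then show ?thesis using False assms by (intro exI[of _ "- K"]) auto
  qed
qed

text \<open>The set K has to be closed in the whole manifold, not only in the chart. It is the image
  of a compact ball under the inverse chart, hence compact, and compact sets are closed because the
  manifold is Hausdorff.\<close>

lemma manifold_bump:
  assumes "open U" "p \<in> U"
  obtains \<phi> :: "'m \<Rightarrow> real" and K where "smooth_on_mfd A UNIV \<phi>" "\<phi> p = 1" "closed K" "K \<subseteq> U"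
    "\<forall>q. q \<notin> K \<longrightarrow> \<phi> q = 0"
proof -
  define c where "c = chart_at A p"
  have c: "c \<in> A" and p: "p \<in> fst c" by (auto simp: c_def chart_at_in in_chart_at)
  define W where "W = fst c \<inter> U"
  have W: "open W" "W \<subseteq> fst c" "p \<in> W" using open_chart_dom[OF c] assms p by (auto simp: W_def)
  have "open (snd c ` W)" using open_chart_image[OF c assms(1)] by (simp add: W_def)
  from open_contains_cball_eq[OF this, rule_format, of "snd c p"] obtain r where r: "r > 0" "cball (snd c p) r \<subseteq> snd c ` W"
    using W(3) by blast
  obtain \<beta> :: "real ^ 'n \<Rightarrow> real" where \<beta>: "Cinf_on UNIV \<beta>" "\<beta> (snd c p) = 1" "\<forall>x. x \<notin> cball (snd c p) r \<longrightarrow> \<beta> x = 0"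
    using bump_function[OF r(1)] by blast
  define K where "K = chart_inv c ` cball (snd c p) r"
  have "continuous_on (snd c ` fst c) (chart_inv c)"
    using chart_homeomorphism[OF c] by (simp add: homeomorphism_def)
  then have "compact K"
    unfolding K_def by (rule compact_continuous_image[OF continuous_on_subset]) (use r W in auto)
  then have K: "closed K" by (rule compact_imp_closed)
  have KW: "K \<subseteq> W"
  proof
    fix q assume "q \<in> K"
    then obtain x where x: "x \<in> cball (snd c p) r" "q = chart_inv c x" by (auto simp: K_def)
    then obtain w where "w \<in> W" "x = snd c w" using r(2) by auto
    then show "q \<in> W" using x c W by auto
  qed
  define \<phi> where "\<phi> q = (if q \<in> W then \<beta> (snd c q) else 0)" for q
  have z: "\<phi> q = 0" if "q \<notin> K" for q
  proof (cases "q \<in> W")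
    case True
    then have "snd c q \<notin> cball (snd c p) r"
      using that c W unfolding K_def by (metis chart_inv_chart image_eqI subsetD)
    then show ?thesis using \<beta>(3) by (simp add: \<phi>_def)
  qed (simp add: \<phi>_def)
  have "smooth_on_mfd A UNIV \<phi>"
  proof (rule smooth_on_mfd_local)
    fix q
    show "\<exists>N. open N \<and> q \<in> N \<and> smooth_on_mfd A N \<phi>"
    proof (cases "q \<in> K")
      case True
      have "smooth_on_mfd A W \<phi>"
        by (rule smooth_on_mfd_cong[OF W(1) _ smooth_on_mfd_chart[OF c W(1,2) Cinf_on_subset[OF \<beta>(1)]]])
          (auto simp: \<phi>_def)
      then show ?thesis using True KW W by auto
    next
      case False
      have "smooth_on_mfd A (- K) \<phi>"
        by (rule smooth_on_mfd_cong[OF _ _ smooth_on_mfd_const[of "- K" 0]]) (use z K in auto)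
      then show ?thesis using False K by (intro exI[of _ "- K"]) auto
    qed
  qed
  moreover have "\<phi> p = 1" using W(3) \<beta>(2) by (simp add: \<phi>_def)
  ultimately show thesis using that K KW z by (auto simp: W_def)
qed

lemma smooth_on_mfd_continuous:
  assumes "smooth_on_mfd A UNIV f"
  shows "continuous_on UNIV f"
proof -
  have "isCont f p" for p
  proof -
    define c where "c = chart_at A p"
    have c: "c \<in> A" and p: "p \<in> fst c" by (auto simp: c_def chart_at_in in_chart_at)
    have "Ck_on 0 (snd c ` fst c) (\<lambda>x. f (chart_inv c x))"
      using smooth_on_mfdD[OF assms c] unfolding Cinf_on_def by (metis Int_UNIV_right)
    then have "continuous_on (fst c) (\<lambda>q. f (chart_inv c (snd c q)))"
      using chart_homeomorphism[OF c] continuous_on_compose2[of "snd c ` fst c" "\<lambda>x. f (chart_inv c x)" "fst c" "snd c"]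
      by (simp add: homeomorphism_def)
    then have "continuous_on (fst c) f"
      by (rule continuous_on_eq) (simp add: c)
    then show ?thesis
      using open_chart_dom[OF c] p by (simp add: continuous_on_eq_continuous_at)
  qed
  then show ?thesis by (simp add: continuous_at_imp_continuous_on)
qed

lemma smooth_on_mfd_vecI:
  fixes f :: "'m \<Rightarrow> real ^ 'k"
  assumes "open W" "\<And>i. smooth_on_mfd A W (\<lambda>q. f q $ i)"
  shows "smooth_on_mfd A W f"
proof -
  have "smooth_on_mfd A W (\<lambda>q. \<Sum>i\<in>UNIV. f q $ i *\<^sub>R (axis i 1 :: real ^ 'k))"
    by (intro smooth_on_mfd_sum smooth_on_mfd_scaleR smooth_on_mfd_const assms)
  then show ?thesis
    by (simp only: scalar_mult_eq_scaleR[symmetric] basis_expansion)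
qed

section \<open>Coordinate changes and the tangent bundle\<close>

definition chart_change where
  "chart_change c d p = frechet_derivative (snd d \<circ> chart_inv c) (at (snd c p))"

lemma chart_change_has_derivative:
  assumes "c \<in> A" "d \<in> A" "p \<in> fst c" "p \<in> fst d"
  shows "((snd d \<circ> chart_inv c) has_derivative chart_change c d p) (at (snd c p))"
  unfolding chart_change_def
  by (rule Cinf_on_has_derivative[OF chart_transition[OF assms(1,2)]]) (use assms in auto)

lemma chart_change_chain:
  assumes "c \<in> A" "d \<in> A" "e \<in> A" "p \<in> fst c" "p \<in> fst d" "p \<in> fst e"
  shows "chart_change d e p (chart_change c d p v) = chart_change c e p v"
proof -
  have "((snd e \<circ> chart_inv d) has_derivative chart_change d e p) (at ((snd d \<circ> chart_inv c) (snd c p)))"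
    using chart_change_has_derivative assms by simp
  from diff_chain_at[OF chart_change_has_derivative[OF assms(1,2,4,5)] this]
  have "((snd e \<circ> chart_inv c) has_derivative chart_change d e p \<circ> chart_change c d p) (at (snd c p))"
    by (rule has_derivative_transform_within_open[where s = "snd c ` (fst c \<inter> fst d)"])
      (use assms open_chart_image open_chart_dom in auto)
  from frechet_derivative_at[OF this] show ?thesis
    by (simp add: chart_change_def fun_eq_iff)
qed

lemma chart_change_self:
  assumes "c \<in> A" "p \<in> fst c"
  shows "chart_change c c p v = v"
proof -
  have "((snd c \<circ> chart_inv c) has_derivative (\<lambda>v. v)) (at (snd c p))"
    by (rule has_derivative_transform_within_open[OF has_derivative_ident, where s = "snd c ` fst c"])
      (use assms open_chart_im in auto)
  from frechet_derivative_at[OF this] show ?thesis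
    by (simp add: chart_change_def fun_eq_iff)
qed

lemma tangent_coord_eq: "tangent_coord A c p = chart_change (chart_at A p) c p"
  by (auto simp: tangent_coord_def chart_change_def fun_eq_iff)

lemma inv_tangent_coord:
  assumes c: "c \<in> A" "p \<in> fst c"
  shows "inv (tangent_coord A c p) = chart_change c (chart_at A p) p"
    and "bij (tangent_coord A c p)"
proof -
  note a = chart_at_in[of p] in_chart_at[of p]
  have 1: "chart_change c (chart_at A p) p \<circ> tangent_coord A c p = id"
    "tangent_coord A c p \<circ> chart_change c (chart_at A p) p = id"
    using chart_change_chain chart_change_self c a by (auto simp: tangent_coord_eq fun_eq_iff)
  show "inv (tangent_coord A c p) = chart_change c (chart_at A p) p"
    by (rule inv_unique_comp[OF 1(2,1)])
  show "bij (tangent_coord A c p)" by (rule o_bij[OF 1])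
qed

text \<open>By the chain rule the arbitrarily selected chart at p cancels from the transition
  functions. What remains is the Jacobian between two fixed charts, which depends smoothly on the
  point.\<close>

lemma tangent_bundle: "smooth_vector_bundle A (tangent_triv A)"
  unfolding smooth_vector_bundle_def
proof (intro conjI)
  show "\<Union> (fst ` tangent_triv A) = UNIV"
    using chart_at_in in_chart_at by (force simp: tangent_triv_def)
  show "\<forall>(U, \<Phi>)\<in>tangent_triv A. open U \<and> (\<forall>p\<in>U. linear (\<Phi> p) \<and> bij (\<Phi> p))"
    using open_chart_dom inv_tangent_coord(2)
      has_derivative_linear[OF chart_change_has_derivative[OF chart_at_in _ in_chart_at]]
    unfolding tangent_triv_def tangent_coord_eq by fastforce
  have "smooth_on_mfd A (fst c \<inter> fst d) (\<lambda>p. tangent_coord A d p (inv (tangent_coord A c p) v))"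
    if c: "c \<in> A" and d: "d \<in> A" for c d v
  proof -
    have o: "open (fst c \<inter> fst d)" using open_chart_dom c d by (intro open_Int)
    have "smooth_on_mfd A (fst c \<inter> fst d) (\<lambda>p. frechet_derivative (snd d \<circ> chart_inv c) (at (snd c p)) v)"
      by (rule smooth_on_mfd_chart[OF c o _ Cinf_on_frechet_derivative[OF chart_transition[OF c d]]]) simp
    moreover have "tangent_coord A d p (inv (tangent_coord A c p) v) = chart_change c d p v"
      if "p \<in> fst c \<inter> fst d" for p
      using that c d chart_at_in in_chart_at
      by (simp add: inv_tangent_coord(1)) (simp add: tangent_coord_eq chart_change_chain)
    ultimately show ?thesis
      by (intro smooth_on_mfd_cong[OF o _ \<open>smooth_on_mfd A _ _\<close>]) (simp add: chart_change_def)
  qed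
  then show "\<forall>(U, \<Phi>)\<in>tangent_triv A. \<forall>(V, \<Psi>)\<in>tangent_triv A. \<forall>v.
      smooth_on_mfd A (U \<inter> V) (\<lambda>p. \<Psi> p (inv (\<Phi> p) v))"
    by (auto simp: tangent_triv_def)
qed

section \<open>Derivatives of functions along tangent vectors\<close>

lemma mderiv_has_derivative:
  assumes "smooth_on_mfd A UNIV f"
  shows "((\<lambda>x. f (chart_inv (chart_at A p) x)) has_derivative mderiv A f p) (at (snd (chart_at A p) p))"
proof -
  have "mderiv A f p = frechet_derivative (\<lambda>x. f (chart_inv (chart_at A p) x)) (at (snd (chart_at A p) p))"
    by (auto simp: mderiv_def comp_def)
  then show ?thesis
    using Cinf_on_has_derivative[OF smooth_on_mfdD[OF assms chart_at_in[of p]]] in_chart_at by simp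
qed

lemma mderiv_eqI:
  assumes "((\<lambda>x. f (chart_inv (chart_at A p) x)) has_derivative D) (at (snd (chart_at A p) p))"
  shows "mderiv A f p v = D v"
  using frechet_derivative_at[OF assms] by (simp add: mderiv_def comp_def)

lemma linear_mderiv: "smooth_on_mfd A UNIV f \<Longrightarrow> linear (mderiv A f p)"
  using mderiv_has_derivative has_derivative_linear by blast

lemma mderiv_const [simp]: "mderiv A (\<lambda>q. k) p v = 0"
  by (rule mderiv_eqI) auto

lemma mderiv_add:
  "smooth_on_mfd A UNIV f \<Longrightarrow> smooth_on_mfd A UNIV g \<Longrightarrow>
    mderiv A (\<lambda>q. f q + g q) p v = mderiv A f p v + mderiv A g p v"
  by (rule mderiv_eqI) (rule has_derivative_add[OF mderiv_has_derivative mderiv_has_derivative])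

lemma mderiv_mult:
  assumes "smooth_on_mfd A UNIV f" "smooth_on_mfd A UNIV g"
  shows "mderiv A (\<lambda>q. f q * g q) p v = f p * mderiv A g p v + mderiv A f p v * g p"
proof -
  have "chart_inv (chart_at A p) (snd (chart_at A p) p) = p"
    by (simp add: chart_at_in in_chart_at)
  then show ?thesis
    using mderiv_eqI[OF has_derivative_mult[OF mderiv_has_derivative[OF assms(1)] mderiv_has_derivative[OF assms(2)]]]
    by simp
qed

lemma mderiv_cmult:
  "smooth_on_mfd A UNIV f \<Longrightarrow> mderiv A (\<lambda>q. k * f q) p v = k * mderiv A f p v"
  by (simp add: mderiv_mult smooth_on_mfd_const)

end

section \<open>Sections of vector bundles\<close>

locale smooth_bundle = smooth_manifold A
  for A :: "('m::{t2_space,second_countable_topology}, 'n::finite) chart set" +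
  fixes B :: "('m, 'r::finite) triv set"
  assumes vbundle: "smooth_vector_bundle A B"
begin

lemma
  assumes "(U, \<Phi>) \<in> B"
  shows open_triv: "open U"
    and linear_triv: "p \<in> U \<Longrightarrow> linear (\<Phi> p)"
    and triv_inv: "p \<in> U \<Longrightarrow> \<Phi> p (inv (\<Phi> p) v) = v"
    and inv_triv: "p \<in> U \<Longrightarrow> inv (\<Phi> p) (\<Phi> p v) = v"
    and linear_inv_triv: "p \<in> U \<Longrightarrow> linear (inv (\<Phi> p))"
proof -
  have "open U" "p \<in> U \<Longrightarrow> linear (\<Phi> p)" "p \<in> U \<Longrightarrow> bij (\<Phi> p)"
    using assms vbundle unfolding smooth_vector_bundle_def by fastforce+
  then show "open U" "p \<in> U \<Longrightarrow> linear (\<Phi> p)" "p \<in> U \<Longrightarrow> \<Phi> p (inv (\<Phi> p) v) = v" "p \<in> U \<Longrightarrow> inv (\<Phi> p) (\<Phi> p v) = v"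
    "p \<in> U \<Longrightarrow> linear (inv (\<Phi> p))"
    by (auto simp: bij_def surj_f_inv_f inj_linear_imp_inv_linear)
qed

lemma triv_transition:
  "(U, \<Phi>) \<in> B \<Longrightarrow> (V, \<Psi>) \<in> B \<Longrightarrow> smooth_on_mfd A (U \<inter> V) (\<lambda>p. \<Psi> p (inv (\<Phi> p) v))"
  using vbundle unfolding smooth_vector_bundle_def by fastforce

lemma ex_triv: "\<exists>U \<Phi>. (U, \<Phi>) \<in> B \<and> p \<in> U"
proof -
  have "p \<in> \<Union> (fst ` B)" using vbundle unfolding smooth_vector_bundle_def by auto
  then show ?thesis by force
qed

lemma smooth_sectionD: "smooth_section A B a \<Longrightarrow> (U, \<Phi>) \<in> B \<Longrightarrow> smooth_on_mfd A U (\<lambda>p. \<Phi> p (a p))"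
  unfolding smooth_section_def by fastforce

text \<open>One trivialization near each point is enough, because passing to another multiplies the
  components by a smooth matrix. Transition maps are smooth only at fixed vectors by definition, so
  \<Phi> q (a q) is first expanded in the standard basis.\<close>

lemma smooth_section_localI:
  assumes "\<And>p. \<exists>U \<Phi> N. (U, \<Phi>) \<in> B \<and> open N \<and> p \<in> N \<and> N \<subseteq> U \<and> smooth_on_mfd A N (\<lambda>q. \<Phi> q (a q))"
  shows "smooth_section A B a"
proof -
  have "smooth_on_mfd A V (\<lambda>p. \<Psi> p (a p))" if V: "(V, \<Psi>) \<in> B" for V \<Psi>
  proof (rule smooth_on_mfd_local)
    fix p assume "p \<in> V"
    obtain U \<Phi> N where U: "(U, \<Phi>) \<in> B" and N: "open N" "p \<in> N" "N \<subseteq> U"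
      and s: "smooth_on_mfd A N (\<lambda>q. \<Phi> q (a q))"
      using assms by blast
    have o: "open (N \<inter> V)" using N open_triv[OF V] by auto
    have e: "(\<Sum>i\<in>UNIV. \<Phi> q (a q) $ i *\<^sub>R \<Psi> q (inv (\<Phi> q) (axis i 1))) = \<Psi> q (a q)" if "q \<in> N \<inter> V" for q
    proof -
      have q: "q \<in> U" "q \<in> V" using that N by auto
      have "linear (\<Psi> q \<circ> inv (\<Phi> q))"
        using linear_compose linear_inv_triv[OF U q(1)] linear_triv[OF V q(2)] by blast
      then have "(\<Psi> q \<circ> inv (\<Phi> q)) (\<Sum>i\<in>UNIV. \<Phi> q (a q) $ i *\<^sub>R axis i 1) =
          (\<Sum>i\<in>UNIV. \<Phi> q (a q) $ i *\<^sub>R (\<Psi> q \<circ> inv (\<Phi> q)) (axis i 1))"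
        by (simp only: linear_sum linear_cmul)
      then show ?thesis
        using basis_expansion[of "\<Phi> q (a q)"] inv_triv[OF U q(1)] by (simp add: scalar_mult_eq_scaleR)
    qed
    have "smooth_on_mfd A (N \<inter> V) (\<lambda>q. \<Sum>i\<in>UNIV. \<Phi> q (a q) $ i *\<^sub>R \<Psi> q (inv (\<Phi> q) (axis i 1)))"
      by (intro smooth_on_mfd_sum smooth_on_mfd_scaleR smooth_on_mfd_component o
          smooth_on_mfd_subset[OF triv_transition[OF U V]] smooth_on_mfd_subset[OF s])
        (use N(3) in auto)
    then have "smooth_on_mfd A (N \<inter> V) (\<lambda>q. \<Psi> q (a q))"
      by (rule smooth_on_mfd_cong[OF o, rotated]) (rule e)
    then show "\<exists>N. open N \<and> p \<in> N \<and> smooth_on_mfd A N (\<lambda>q. \<Psi> q (a q))"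
      using o N \<open>p \<in> V\<close> by blast
  qed
  then show ?thesis unfolding smooth_section_def by auto
qed

lemma smooth_section_add:
  assumes "smooth_section A B a" "smooth_section A B b"
  shows "smooth_section A B (\<lambda>q. a q + b q)"
  unfolding smooth_section_def
proof (clarify)
  fix U \<Phi> assume U: "(U, \<Phi>) \<in> B"
  have "smooth_on_mfd A U (\<lambda>p. \<Phi> p (a p) + \<Phi> p (b p))"
    using assms U by (intro smooth_on_mfd_add open_triv[OF U] smooth_sectionD)
  then show "smooth_on_mfd A U (\<lambda>p. \<Phi> p (a p + b p))"
    by (rule smooth_on_mfd_cong[OF open_triv[OF U], rotated]) (simp add: linear_add[OF linear_triv[OF U]])
qed

lemma smooth_section_scaleR:
  assumes "smooth_on_mfd A UNIV f" "smooth_section A B a"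
  shows "smooth_section A B (\<lambda>q. f q *\<^sub>R a q)"
  unfolding smooth_section_def
proof (clarify)
  fix U \<Phi> assume U: "(U, \<Phi>) \<in> B"
  have "smooth_on_mfd A U (\<lambda>p. f p *\<^sub>R \<Phi> p (a p))"
    using assms(2) U smooth_on_mfd_subset[OF assms(1), of U]
    by (intro smooth_on_mfd_scaleR open_triv[OF U] smooth_sectionD) auto
  then show "smooth_on_mfd A U (\<lambda>p. \<Phi> p (f p *\<^sub>R a p))"
    by (rule smooth_on_mfd_cong[OF open_triv[OF U], rotated]) (simp add: linear_cmul[OF linear_triv[OF U]])
qed

lemma smooth_section_cscaleR: "smooth_section A B a \<Longrightarrow> smooth_section A B (\<lambda>q. k *\<^sub>R a q)"
  by (rule smooth_section_scaleR[OF smooth_on_mfd_const]) auto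

lemma smooth_section_diff:
  assumes "smooth_section A B a" "smooth_section A B b"
  shows "smooth_section A B (\<lambda>q. a q - b q)"
  using smooth_section_add[OF assms(1) smooth_section_cscaleR[OF assms(2), of "- 1"]] by simp

lemma smooth_section_zero: "smooth_section A B (\<lambda>q. 0)"
  unfolding smooth_section_def
proof (clarify)
  fix U \<Phi> assume U: "(U, \<Phi>) \<in> B"
  show "smooth_on_mfd A U (\<lambda>p. \<Phi> p 0)"
    by (rule smooth_on_mfd_cong[OF open_triv[OF U] _ smooth_on_mfd_const[OF open_triv[OF U], of 0]])
      (simp add: linear_0[OF linear_triv[OF U]])
qed

lemma smooth_section_sum:
  "(\<And>i. i \<in> J \<Longrightarrow> smooth_section A B (a i)) \<Longrightarrow> smooth_section A B (\<lambda>q. \<Sum>i\<in>J. a i q)"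
  by (induction J rule: infinite_finite_induct) (auto simp: smooth_section_zero smooth_section_add)

lemma smooth_section_bump:
  assumes U: "(U, \<Phi>) \<in> B" and "smooth_on_mfd A UNIV \<phi>" "closed K" "K \<subseteq> U" "\<forall>q. q \<notin> K \<longrightarrow> \<phi> q = 0"
  shows "smooth_section A B (\<lambda>q. \<phi> q *\<^sub>R inv (\<Phi> q) v)"
proof -
  have "smooth_on_mfd A V (\<lambda>q. \<Psi> q (\<phi> q *\<^sub>R inv (\<Phi> q) v))" if V: "(V, \<Psi>) \<in> B" for V \<Psi>
  proof (rule smooth_on_mfd_local)
    fix p assume p: "p \<in> V"
    show "\<exists>N. open N \<and> p \<in> N \<and> smooth_on_mfd A N (\<lambda>q. \<Psi> q (\<phi> q *\<^sub>R inv (\<Phi> q) v))"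
    proof (cases "p \<in> U")
      case True
      have o: "open (U \<inter> V)" using open_triv U V by auto
      have "smooth_on_mfd A (U \<inter> V) (\<lambda>q. \<phi> q *\<^sub>R \<Psi> q (inv (\<Phi> q) v))"
        using assms(2) by (intro smooth_on_mfd_scaleR o triv_transition[OF U V]) (auto intro: smooth_on_mfd_subset)
      then have "smooth_on_mfd A (U \<inter> V) (\<lambda>q. \<Psi> q (\<phi> q *\<^sub>R inv (\<Phi> q) v))"
        by (rule smooth_on_mfd_cong[OF o, rotated]) (simp add: linear_cmul[OF linear_triv[OF V]])
      then show ?thesis using o p True by blast
    next
      case False
      have o: "open (V \<inter> - K)" using open_triv[OF V] assms(3) by auto
      have "smooth_on_mfd A (V \<inter> - K) (\<lambda>q. \<Psi> q (\<phi> q *\<^sub>R inv (\<Phi> q) v))"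
        by (rule smooth_on_mfd_cong[OF o _ smooth_on_mfd_const[OF o, of 0]])
          (simp add: assms(5) linear_0[OF linear_triv[OF V]])
      then show ?thesis using o p False assms(4) by (intro exI[of _ "V \<inter> - K"]) auto
    qed
  qed
  then show ?thesis unfolding smooth_section_def by auto
qed

lemma ex_smooth_section: "\<exists>a. smooth_section A B a \<and> a p = v"
proof -
  obtain U \<Phi> where U: "(U, \<Phi>) \<in> B" "p \<in> U" using ex_triv by blast
  obtain \<phi> :: "'m \<Rightarrow> real" and K where "smooth_on_mfd A UNIV \<phi>" "\<phi> p = 1" "closed K" "K \<subseteq> U" "\<forall>q. q \<notin> K \<longrightarrow> \<phi> q = 0"
    using manifold_bump[OF open_triv[OF U(1)] U(2)] by blast
  then show ?thesis
    using smooth_section_bump[OF U(1), of \<phi> K "\<Phi> p v"] inv_triv[OF U] by fastforce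
qed

text \<open>Hadamard's lemma for sections, multiplied by a bump function to make it global.\<close>

lemma smooth_section_vanishing:
  assumes a: "smooth_section A B a" and "a p = 0"
  obtains \<psi> :: "'m \<Rightarrow> real" and f :: "'r \<Rightarrow> 'm \<Rightarrow> real" and E where
    "smooth_on_mfd A UNIV \<psi>" "\<psi> p = 1" "\<forall>i. smooth_on_mfd A UNIV (f i)" "\<forall>i. f i p = 0"
    "\<forall>i. smooth_section A B (E i)" "\<forall>q. \<psi> q *\<^sub>R a q = (\<Sum>i\<in>UNIV. f i q *\<^sub>R E i q)"
proof -
  obtain U \<Phi> where U: "(U, \<Phi>) \<in> B" "p \<in> U" using ex_triv by blast
  obtain \<phi> :: "'m \<Rightarrow> real" and K where \<phi>: "smooth_on_mfd A UNIV \<phi>" "\<phi> p = 1" "closed K" "K \<subseteq> U" "\<forall>q. q \<notin> K \<longrightarrow> \<phi> q = 0"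
    using manifold_bump[OF open_triv[OF U(1)] U(2)] by blast
  define f where "f i q = \<phi> q *\<^sub>R (\<Phi> q (a q) $ i)" for i q
  define E where "E i q = \<phi> q *\<^sub>R inv (\<Phi> q) (axis i 1)" for i q
  \<comment> \<open>One factor \<phi> extends the components by zero and another one extends the
    frame, so the multiplier is \<phi> squared.\<close>
  show thesis
  proof (rule that[of "\<lambda>q. \<phi> q * \<phi> q" f E])
    show "\<forall>i. smooth_on_mfd A UNIV (f i)"
      unfolding f_def
      by (rule allI, rule smooth_extend_zero[OF \<phi>(1,3,5,4) open_triv[OF U(1)]
            smooth_on_mfd_component[OF open_triv[OF U(1)] smooth_sectionD[OF a U(1)]]])
    show "\<forall>i. smooth_section A B (E i)"
      unfolding E_def by (rule allI, rule smooth_section_bump[OF U(1) \<phi>(1,3,4,5)])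
    show "\<forall>i. f i p = 0"
      using assms(2) linear_0[OF linear_triv[OF U]] by (simp add: f_def)
    have "(\<phi> q * \<phi> q) *\<^sub>R a q = (\<Sum>i\<in>UNIV. f i q *\<^sub>R E i q)" for q
    proof (cases "q \<in> U")
      case True
      have "(\<Sum>i\<in>UNIV. f i q *\<^sub>R E i q) = (\<phi> q * \<phi> q) *\<^sub>R (\<Sum>i\<in>UNIV. \<Phi> q (a q) $ i *\<^sub>R inv (\<Phi> q) (axis i 1))"
        by (simp add: f_def E_def scaleR_sum_right mult_ac)
      also have "(\<Sum>i\<in>UNIV. \<Phi> q (a q) $ i *\<^sub>R inv (\<Phi> q) (axis i 1)) = inv (\<Phi> q) (\<Sum>i\<in>UNIV. \<Phi> q (a q) $ i *\<^sub>R axis i 1)"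
        using linear_inv_triv[OF U(1) True] by (simp only: linear_sum linear_cmul)
      finally show ?thesis
        using basis_expansion[of "\<Phi> q (a q)"] inv_triv[OF U(1) True] by (simp add: scalar_mult_eq_scaleR)
    next
      case False
      then have "\<phi> q = 0" using \<phi> by blast
      then show ?thesis by (simp add: f_def)
    qed
    then show "\<forall>q. (\<phi> q * \<phi> q) *\<^sub>R a q = (\<Sum>i\<in>UNIV. f i q *\<^sub>R E i q)" ..
  qed (use \<phi> in \<open>auto intro: smooth_on_mfd_mult\<close>)
qed

text \<open>In a trivialization, b solves a linear system whose matrix and right-hand side are
  smooth, and Cramer's rule expresses the solution smoothly. Injectivity of K keeps the determinant
  away from zero.\<close>

lemma smooth_section_inverse_endo:
  assumes lin: "\<And>q. linear (K q)" and inj: "\<And>q x. K q x = 0 \<Longrightarrow> x = 0"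
    and sm: "\<And>a. smooth_section A B a \<Longrightarrow> smooth_section A B (\<lambda>q. K q (a q))"
    and Kb: "smooth_section A B (\<lambda>q. K q (b q))"
  shows "smooth_section A B b"
proof (rule smooth_section_localI)
  fix p
  obtain U \<Phi> where U: "(U, \<Phi>) \<in> B" "p \<in> U" using ex_triv by blast
  obtain \<phi> :: "'m \<Rightarrow> real" and L where \<phi>: "smooth_on_mfd A UNIV \<phi>" "\<phi> p = 1" "closed L" "L \<subseteq> U" "\<forall>q. q \<notin> L \<longrightarrow> \<phi> q = 0"
    using manifold_bump[OF open_triv[OF U(1)] U(2)] by blast
  define N where "N = {q. \<phi> q \<noteq> 0}"
  have "open (\<phi> -` (- {0}))"
    using smooth_on_mfd_continuous[OF \<phi>(1)] by (intro open_vimage) auto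
  then have N: "open N" "p \<in> N" "N \<subseteq> U" and N0: "\<And>q. q \<in> N \<Longrightarrow> \<phi> q \<noteq> 0"
    using \<phi> by (auto simp: N_def vimage_def Compl_eq)
  define E where "E i q = \<phi> q *\<^sub>R inv (\<Phi> q) (axis i 1)" for i q
  have E: "smooth_section A B (E i)" for i
    unfolding E_def by (rule smooth_section_bump[OF U(1) \<phi>(1,3,4,5)])
  define M where "M q = matrix (\<lambda>x. \<Phi> q (K q (inv (\<Phi> q) x)))" for q
  have lM: "linear (\<lambda>x. \<Phi> q (K q (inv (\<Phi> q) x)))" if "q \<in> U" for q
    using linear_inv_triv[OF U(1) that] lin linear_triv[OF U(1) that] by (auto simp: linear_iff)
  have Mv: "M q *v x = \<Phi> q (K q (inv (\<Phi> q) x))" if "q \<in> U" for q x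
    unfolding M_def using matrix_works[of "\<lambda>x. \<Phi> q (K q (inv (\<Phi> q) x))" x] lM[OF that] by (simp add: linear_matrix_vector_mul_eq)
  have inN: "smooth_on_mfd A N f" if "smooth_on_mfd A U f" for f :: "'m \<Rightarrow> real ^ 'r"
    using smooth_on_mfd_subset[OF that N(3)] .
  have Msm: "smooth_on_mfd A N (\<lambda>q. M q $ i $ j)" for i j
  proof (rule smooth_on_mfd_cong[OF N(1)])
    \<comment> \<open>K is known to preserve smoothness of global sections only. Its columns are
      therefore read off from the frame cut off by \<phi>, and \<phi> is divided out on the set N
      where it does not vanish.\<close>
    show "smooth_on_mfd A N (\<lambda>q. inverse (\<phi> q) * \<Phi> q (K q (E j q)) $ i)"
      using \<phi>(1) N0 by (intro smooth_on_mfd_mult smooth_on_mfd_inverse smooth_on_mfd_component N(1)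
          inN smooth_sectionD[OF sm[OF E] U(1)]) (auto intro: smooth_on_mfd_subset)
    show "inverse (\<phi> q) * \<Phi> q (K q (E j q)) $ i = M q $ i $ j" if "q \<in> N" for q
      using that N N0 by (auto simp: M_def matrix_def E_def linear_cmul[OF lin] linear_cmul[OF linear_triv[OF U(1)]])
  qed
  have det: "det (M q) \<noteq> 0" if "q \<in> N" for q
  proof -
    have q: "q \<in> U" using that N by auto
    have "linear ((*v) (M q))" by simp
    moreover have "x = 0" if "M q *v x = 0" for x
    proof -
      have "inv (\<Phi> q) (\<Phi> q (K q (inv (\<Phi> q) x))) = 0"
        using that Mv[OF q] linear_0[OF linear_inv_triv[OF U(1) q]] by simp
      then have "inv (\<Phi> q) x = 0" using inv_triv[OF U(1) q] inj by simp
      then show ?thesis using triv_inv[OF U(1) q, of x] linear_0[OF linear_triv[OF U(1) q]] by simp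
    qed
    ultimately have "inj ((*v) (M q))" using linear_injective_0 by blast
    then show ?thesis
      using matrix_left_invertible_injective invertible_left_inverse invertible_det_nz by blast
  qed
  define w where "w q = \<Phi> q (K q (b q))" for q
  have w: "smooth_on_mfd A N (\<lambda>q. w q $ i)" for i
    unfolding w_def using inN[OF smooth_sectionD[OF Kb U(1)]] by (intro smooth_on_mfd_component N(1))
  have smooth_if: "smooth_on_mfd A N (\<lambda>q. if j = k then w q $ i else M q $ i $ j)" for i j k
    by (cases "j = k") (simp_all add: w Msm)
  have "\<Phi> q (b q) = (\<chi> k. det (\<chi> i j. if j = k then w q $ i else M q $ i $ j) / det (M q))" if "q \<in> N" for q
  proof -
    have q: "q \<in> U" using that N by auto
    have "M q *v \<Phi> q (b q) = w q" using Mv[OF q] inv_triv[OF U(1) q] by (simp add: w_def)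
    then show ?thesis using cramer[OF det[OF that]] by blast
  qed
  moreover have "smooth_on_mfd A N (\<lambda>q. \<chi> k. det (\<chi> i j. if j = k then w q $ i else M q $ i $ j) / det (M q))"
  proof (rule smooth_on_mfd_vecI[OF N(1)])
    fix k
    have "smooth_on_mfd A N (\<lambda>q. det (\<chi> i j. if j = k then w q $ i else M q $ i $ j) * inverse (det (M q)))"
      by (intro smooth_on_mfd_mult smooth_on_mfd_inverse smooth_on_mfd_det N(1) det Msm)
        (auto simp: w Msm split: if_split intro: smooth_if)
    then show "smooth_on_mfd A N (\<lambda>q. (\<chi> k. det (\<chi> i j. if j = k then w q $ i else M q $ i $ j) / det (M q)) $ k)"
      by (simp add: divide_inverse)
  qed
  ultimately have "smooth_on_mfd A N (\<lambda>q. \<Phi> q (b q))"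
    using smooth_on_mfd_cong[OF N(1)] by (metis (no_types, lifting))
  then show "\<exists>U \<Phi> N. (U, \<Phi>) \<in> B \<and> open N \<and> p \<in> N \<and> N \<subseteq> U \<and> smooth_on_mfd A N (\<lambda>q. \<Phi> q (b q))"
    using U N by blast
qed

text \<open>The difference c of the sections vanishes at p, so \<psi> c is a sum of sections f_i E_i
  with f_i p = 0 and \<psi> p = 1. Linearity over functions then gives T c = T (\<psi> c) =
  0.\<close>

lemma tensorial_eq:
  fixes T :: "('m \<Rightarrow> real ^ 'r) \<Rightarrow> real"
  assumes add: "\<And>a b. smooth_section A B a \<Longrightarrow> smooth_section A B b \<Longrightarrow> T (\<lambda>q. a q + b q) = T a + T b"
    and scale: "\<And>f a. smooth_on_mfd A UNIV f \<Longrightarrow> smooth_section A B a \<Longrightarrow> T (\<lambda>q. f q *\<^sub>R a q) = f p * T a"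
    and a: "smooth_section A B a" and b: "smooth_section A B b" and "a p = b p"
  shows "T a = T b"
proof -
  have sum0: "T (\<lambda>q. \<Sum>i\<in>J. c i q) = (\<Sum>i\<in>J. T (c i))" if "finite J" "\<And>i. smooth_section A B (c i)"
    for J :: "'r set" and c
    using that
  proof (induction J)
    case empty
    then show ?case
      using scale[OF smooth_on_mfd_const[of UNIV 0] smooth_section_zero] by simp
  qed (simp add: add smooth_section_sum)
  define c where "c q = a q + (- 1) *\<^sub>R b q" for q
  have c: "smooth_section A B c"
    unfolding c_def by (intro smooth_section_add smooth_section_cscaleR a b)
  have c0: "c p = 0" using assms(5) by (simp add: c_def)
  obtain \<psi> :: "'m \<Rightarrow> real" and f and E where \<psi>: "smooth_on_mfd A UNIV \<psi>" "\<psi> p = 1" "\<forall>i. smooth_on_mfd A UNIV (f i)"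
    "\<forall>i::'r. f i p = 0" "\<forall>i. smooth_section A B (E i)" "\<forall>q. \<psi> q *\<^sub>R c q = (\<Sum>i\<in>UNIV. f i q *\<^sub>R E i q)"
    using smooth_section_vanishing[OF c c0] by blast
  have "T c = T (\<lambda>q. \<Sum>i\<in>UNIV. f i q *\<^sub>R E i q)"
    using scale[OF \<psi>(1) c] \<psi>(2,6) by simp
  also have "\<dots> = 0"
    using \<psi> by (subst sum0) (simp_all add: smooth_section_scaleR scale)
  finally have "T c = 0" .
  moreover have "T c = T a + (- 1) * T b"
    unfolding c_def using scale[OF smooth_on_mfd_const[of UNIV "- 1"] b]
    by (simp only: add[OF a smooth_section_cscaleR[OF b]] open_UNIV)
  ultimately show ?thesis by simp
qed

end

section \<open>Exact Courant algebroids\<close>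

text \<open>Components place covectors in a normed space, where families of them can be
  differentiated and inverted by matrices.\<close>

definition covec :: "(real ^ 'n \<Rightarrow> real) \<Rightarrow> real ^ 'n" where
  "covec \<xi> = (\<chi> i. \<xi> (axis i 1))"

lemma covec_inner: "linear \<xi> \<Longrightarrow> covec \<xi> \<bullet> y = \<xi> y"
proof -
  assume l: "linear \<xi>"
  have "\<xi> y = \<xi> (\<Sum>i\<in>UNIV. y $ i *\<^sub>R axis i 1)"
    using basis_expansion[of y] by (simp add: scalar_mult_eq_scaleR)
  also have "\<dots> = covec \<xi> \<bullet> y"
    by (simp add: linear_sum[OF l] linear_cmul[OF l] covec_def inner_vec_def mult.commute)
  finally show ?thesis by simp
qed

locale exact_courant =
  fixes C :: "('m::{t2_space,second_countable_topology}, 'n::finite, 'r::finite) courant_data"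
  assumes exact: "exact_courant_algebroid C"
begin

sublocale smooth_manifold "atlas C"
  using exact by unfold_locales (simp add: exact_courant_algebroid_def)

sublocale E: smooth_bundle "atlas C" "trivs C"
  using exact by unfold_locales (simp add: exact_courant_algebroid_def)

sublocale T: smooth_bundle "atlas C" "tangent_triv (atlas C)"
  by unfold_locales (rule tangent_bundle)

abbreviation "sec \<equiv> csection C"
abbreviation "vf \<equiv> smooth_vf (atlas C)"
abbreviation "sf \<equiv> smooth_on_mfd (atlas C) UNIV"
abbreviation "dir \<equiv> mderiv (atlas C)"
abbreviation "lie \<equiv> lie_bracket (atlas C)"
abbreviation "pr \<equiv> pairing C"
abbreviation "br \<equiv> cbracket C"
abbreviation "anc \<equiv> anchor C"
abbreviation "eps \<equiv> anchor_dual C"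
abbreviation "ext \<equiv> vf_ext (atlas C)"

lemma vf_add: "vf X \<Longrightarrow> vf Y \<Longrightarrow> vf (\<lambda>q. X q + Y q)"
  unfolding smooth_vf_def by (rule T.smooth_section_add)

lemma vf_diff: "vf X \<Longrightarrow> vf Y \<Longrightarrow> vf (\<lambda>q. X q - Y q)"
  unfolding smooth_vf_def by (rule T.smooth_section_diff)

lemma vf_scaleR: "sf f \<Longrightarrow> vf X \<Longrightarrow> vf (\<lambda>q. f q *\<^sub>R X q)"
  unfolding smooth_vf_def by (rule T.smooth_section_scaleR)

lemma vf_cscaleR: "vf X \<Longrightarrow> vf (\<lambda>q. k *\<^sub>R X q)"
  unfolding smooth_vf_def by (rule T.smooth_section_cscaleR)

lemma sf_const: "sf (\<lambda>q. k)"
  by (simp add: smooth_on_mfd_const)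

lemma vf_ext: "vf (ext p v)" and ext_at [simp]: "ext p v p = v"
proof -
  have "\<exists>X. vf X \<and> X p = v"
    using T.ex_smooth_section[of p v] by (simp add: smooth_vf_def)
  from someI_ex[OF this] show "vf (ext p v)" "ext p v p = v"
    by (auto simp: vf_ext_def)
qed

text \<open>The conjunction is peeled one conjunct at a time, so that each axiom below is taken from
  a short formula. The number is the position of the first conjunct that is left.\<close>

lemmas courant_tail3 = exact[unfolded exact_courant_algebroid_def, THEN conjunct2, THEN conjunct2]
lemmas courant_tail4 = courant_tail3[THEN conjunct2]
lemmas courant_tail5 = courant_tail4[THEN conjunct2]
lemmas courant_tail6 = courant_tail5[THEN conjunct2]
lemmas courant_tail7 = courant_tail6[THEN conjunct2]
lemmas courant_tail8 = courant_tail7[THEN conjunct2]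
lemmas courant_tail9 = courant_tail8[THEN conjunct2]
lemmas courant_tail10 = courant_tail9[THEN conjunct2]
lemmas courant_tail11 = courant_tail10[THEN conjunct2]
lemmas courant_tail12 = courant_tail11[THEN conjunct2]
lemmas courant_tail13 = courant_tail12[THEN conjunct2]
lemmas courant_tail14 = courant_tail13[THEN conjunct2]
lemmas courant_tail15 = courant_tail14[THEN conjunct2]

lemma pr_bilinear: "bilinear (pr p)"
  using courant_tail3[THEN conjunct1] by blast

lemma pr_sym: "pr p x y = pr p y x"
  using courant_tail3[THEN conjunct1] by blast

lemma pr_nondeg: "(\<And>y. pr p x y = 0) \<Longrightarrow> x = 0"
  using courant_tail3[THEN conjunct1] by blast

lemma pr_smooth: "sec a \<Longrightarrow> sec b \<Longrightarrow> sf (\<lambda>q. pr q (a q) (b q))"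
  using courant_tail4[THEN conjunct1] by blast

lemma linear_anchor: "linear (anc p)"
  using courant_tail5[THEN conjunct1] by blast

lemma anchor_smooth: "sec a \<Longrightarrow> vf (\<lambda>q. anc q (a q))"
  using courant_tail6[THEN conjunct1] by blast

lemma br_smooth: "sec a \<Longrightarrow> sec b \<Longrightarrow> sec (br a b)"
  using courant_tail7[THEN conjunct1] by blast

lemma br_add_left: "sec a \<Longrightarrow> sec a' \<Longrightarrow> sec b \<Longrightarrow> br (\<lambda>q. a q + a' q) b p = br a b p + br a' b p"
  using courant_tail8[THEN conjunct1] by blast

lemma br_add_right: "sec a \<Longrightarrow> sec a' \<Longrightarrow> sec b \<Longrightarrow> br b (\<lambda>q. a q + a' q) p = br b a p + br b a' p"
  using courant_tail8[THEN conjunct1] by blast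

lemma br_cmul_left: "sec a \<Longrightarrow> sec b \<Longrightarrow> br (\<lambda>q. k *\<^sub>R a q) b p = k *\<^sub>R br a b p"
  using courant_tail9[THEN conjunct1] by blast

lemma br_cmul_right: "sec a \<Longrightarrow> sec b \<Longrightarrow> br a (\<lambda>q. k *\<^sub>R b q) p = k *\<^sub>R br a b p"
  using courant_tail9[THEN conjunct1] by blast

lemma br_jacobi: "sec a \<Longrightarrow> sec b \<Longrightarrow> sec c \<Longrightarrow> br a (br b c) p = br (br a b) c p + br b (br a c) p"
  using courant_tail10[THEN conjunct1] by blast

lemma anchor_br: "sec a \<Longrightarrow> sec b \<Longrightarrow> anc p (br a b p) = lie (\<lambda>q. anc q (a q)) (\<lambda>q. anc q (b q)) p"
  using courant_tail11[THEN conjunct1] by blast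

lemma br_leibniz: "sf f \<Longrightarrow> sec a \<Longrightarrow> sec b \<Longrightarrow>
    br a (\<lambda>q. f q *\<^sub>R b q) p = f p *\<^sub>R br a b p + dir f p (anc p (a p)) *\<^sub>R b p"
  using courant_tail12[THEN conjunct1] by blast

lemma br_metric: "sec a \<Longrightarrow> sec b \<Longrightarrow> sec c \<Longrightarrow> dir (\<lambda>q. pr q (b q) (c q)) p (anc p (a p)) =
    pr p (br a b p) (c p) + pr p (b p) (br a c p)"
  using courant_tail13[THEN conjunct1] by blast

lemma br_sym: "sec a \<Longrightarrow> sec b \<Longrightarrow> br a b p + br b a p = eps p (dir (\<lambda>q. pr q (a q) (b q)) p)"
  using courant_tail14[THEN conjunct1] by blast

lemma eps_inj: "inj_on (eps p) {\<xi>. linear \<xi>}"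
  using courant_tail15 by blast

lemma eps_range: "eps p ` {\<xi>. linear \<xi>} = {e. anc p e = 0}"
  using courant_tail15 by blast

lemmas pr_simps =
  bilinear_ladd[OF pr_bilinear] bilinear_radd[OF pr_bilinear]
  bilinear_lmul[OF pr_bilinear] bilinear_rmul[OF pr_bilinear]
  bilinear_lneg[OF pr_bilinear] bilinear_rneg[OF pr_bilinear]
  bilinear_lzero[OF pr_bilinear] bilinear_rzero[OF pr_bilinear]
  bilinear_lsub[OF pr_bilinear] bilinear_rsub[OF pr_bilinear]

lemmas anc_simps = linear_add[OF linear_anchor] linear_cmul[OF linear_anchor]
  linear_diff[OF linear_anchor] linear_0[OF linear_anchor] linear_neg[OF linear_anchor]

lemma pr_eqI: "(\<And>y. pr p x y = pr p x' y) \<Longrightarrow> x = x'"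
  using pr_nondeg[of p "x - x'"] by (simp add: pr_simps)

text \<open>Nondegeneracy makes the map from a vector to its pairings with the basis injective; it
  is an endomorphism of a space of finite dimension, hence onto.\<close>

lemma pr_represents:
  assumes "linear \<phi>"
  shows "\<exists>e. \<forall>e'. pr p e e' = \<phi> e'"
proof -
  define L where "L e = (\<chi> i. pr p e (axis i 1))" for e
  have L: "linear L"
    by (rule linearI) (simp_all add: L_def pr_simps vec_eq_iff)
  have ext: "\<psi> = \<psi>'" if "linear \<psi>" "linear \<psi>'" "\<And>i. \<psi> (axis i 1) = \<psi>' (axis i (1::real))"
    for \<psi> \<psi>' :: "real ^ 'r \<Rightarrow> real"
    using that by (intro linear_eq_stdbasis) (auto simp: Basis_vec_def)
  have lin: "linear (pr p e)" for e
    using pr_bilinear by (simp add: bilinear_def)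
  have "x = 0" if "L x = 0" for x
  proof (rule pr_nondeg)
    have "pr p x = (\<lambda>_. 0)"
      using that by (intro ext lin) (auto simp: L_def vec_eq_iff intro: linear_zero)
    then show "pr p x y = 0" for y by simp
  qed
  then have "surj L"
    using L linear_injective_0 linear_injective_imp_surjective by blast
  then obtain e where "L e = (\<chi> i. \<phi> (axis i 1))" by (metis surjD)
  then have "pr p e = \<phi>"
    by (intro ext lin assms) (simp add: L_def vec_eq_iff)
  then show ?thesis by auto
qed

lemma eps_eqI:
  assumes "\<And>e'. pr p e e' = \<xi> (anc p e')"
  shows "eps p \<xi> = e"
  unfolding anchor_dual_def
proof (rule the_equality)
  show "e' = e" if "\<forall>e''. pr p e' e'' = \<xi> (anc p e'')" for e'
    by (rule pr_eqI[of p]) (simp add: that assms)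
qed (simp add: assms)

lemma pr_eps:
  assumes "linear \<xi>"
  shows "pr p (eps p \<xi>) e = \<xi> (anc p e)"
proof -
  have "linear (\<lambda>e. \<xi> (anc p e))"
    using linear_compose[OF linear_anchor assms] by (simp add: comp_def)
  then obtain e' where e': "\<forall>e''. pr p e' e'' = \<xi> (anc p e'')"
    using pr_represents by blast
  then show ?thesis using eps_eqI[of p e' \<xi>] by simp
qed

lemma pr_eps_right: "linear \<xi> \<Longrightarrow> pr p e (eps p \<xi>) = \<xi> (anc p e)"
  using pr_eps pr_sym by metis

lemma anc_eps [simp]: "linear \<xi> \<Longrightarrow> anc p (eps p \<xi>) = 0"
  using eps_range by auto

lemma ker_anchor: "anc p e = 0 \<Longrightarrow> \<exists>\<xi>. linear \<xi> \<and> e = eps p \<xi>"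
  using eps_range[of p] by auto

lemma eps_zero [simp]: "eps p (\<lambda>_. 0) = 0"
  by (rule eps_eqI) (simp add: pr_simps)

lemma eps_add: "linear \<xi> \<Longrightarrow> linear \<zeta> \<Longrightarrow> eps p (\<lambda>y. \<xi> y + \<zeta> y) = eps p \<xi> + eps p \<zeta>"
  by (rule eps_eqI) (simp add: pr_simps pr_eps)

lemma eps_cmul: "linear \<xi> \<Longrightarrow> eps p (\<lambda>y. k * \<xi> y) = k *\<^sub>R eps p \<xi>"
  by (rule eps_eqI) (simp add: pr_simps pr_eps)

lemma pairing_adjoint_eqI:
  assumes "\<And>x y. pr p (S x) y = pr p x (S' y)"
  shows "pairing_adjoint C p S = S'"
  unfolding pairing_adjoint_def
proof (rule the_equality)
  show "\<forall>x y. pr p (S x) y = pr p x (S' y)" using assms by simp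
  fix S'' assume S'': "\<forall>x y. pr p (S x) y = pr p x (S'' y)"
  then have "pr p (S'' y) x = pr p (S' y) x" for x y
    using assms pr_sym by metis
  then show "S'' = S'" using pr_eqI by blast
qed

lemma pr_adjoint:
  assumes "linear S"
  shows "pr p (S x) y = pr p x (pairing_adjoint C p S y)"
proof -
  have "linear (\<lambda>x. pr p (S x) y)" for y
    using assms by (intro linearI) (simp_all add: pr_simps linear_add linear_cmul)
  then have "\<forall>y. \<exists>e. \<forall>x. pr p e x = pr p (S x) y" using pr_represents by blast
  then obtain S' where "\<forall>y x. pr p (S' y) x = pr p (S x) y" by metis
  then have "pr p (S x) y = pr p x (S' y)" for x y using pr_sym by metis
  then show ?thesis using pairing_adjoint_eqI by metis
qed

lemma eps_dir_pairing: "sf f \<Longrightarrow> pr p (eps p (dir f p)) e = dir f p (anc p e)"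
  by (rule pr_eps[OF linear_mderiv])

lemma sec_add: "sec a \<Longrightarrow> sec b \<Longrightarrow> sec (\<lambda>q. a q + b q)"
  by (rule E.smooth_section_add)
lemma sec_cscaleR: "sec a \<Longrightarrow> sec (\<lambda>q. k *\<^sub>R a q)"
  by (rule E.smooth_section_cscaleR)
lemma sec_diff: "sec a \<Longrightarrow> sec b \<Longrightarrow> sec (\<lambda>q. a q - b q)"
  by (rule E.smooth_section_diff)
lemma sec_scaleR: "sf f \<Longrightarrow> sec a \<Longrightarrow> sec (\<lambda>q. f q *\<^sub>R a q)"
  by (rule E.smooth_section_scaleR)

lemma br_skew:
  assumes "sec a" "sec b" "\<And>q. pr q (a q) (b q) = 0"
  shows "br a b p = - br b a p"
proof -
  have "dir (\<lambda>q. pr q (a q) (b q)) p = (\<lambda>_. 0)" using assms(3) by auto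
  then show ?thesis using br_sym[OF assms(1,2)] by (simp add: eq_neg_iff_add_eq_0)
qed

text \<open>In general there is a further term, the pairing of a and b times
  \<open>\<pi>\<^sup>* df\<close>, and orthogonality removes it. The lifts of X and Y to opposite
  eigenbundles of \<open>G\<close> are orthogonal, which is why the Bismut connections are linear
  over functions in X.\<close>

lemma br_leibniz_left:
  assumes "sf f" "sec a" "sec b" "\<And>q. pr q (a q) (b q) = 0"
  shows "br (\<lambda>q. f q *\<^sub>R a q) b p = f p *\<^sub>R br a b p - dir f p (anc p (b p)) *\<^sub>R a p"
proof -
  have "br (\<lambda>q. f q *\<^sub>R a q) b p = - br b (\<lambda>q. f q *\<^sub>R a q) p"
    using assms by (intro br_skew sec_scaleR) (auto simp: pr_simps)
  then show ?thesis
    using br_skew[OF assms(2-4), of p] br_leibniz[OF assms(1,3,2), of p] by simp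
qed

lemma lie_skew: "lie X Y p = - lie Y X p"
  by (simp add: lie_bracket_def Let_def)

text \<open>The Leibniz rule contains the derivative as a coefficient: [a, f b] - f [a, b] is a(f)
  b. Pairing with c and dividing by the pairing of b and c, which is nonzero near p, isolates
  it.\<close>

lemma dir_smooth:
  assumes f: "sf f" and a: "sec a"
  shows "sf (\<lambda>q. dir f q (anc q (a q)))"
proof (rule smooth_on_mfd_local)
  fix p
  have "\<exists>v::real^'r. v \<noteq> 0"
    by (rule exI[of _ "axis undefined 1"]) (simp add: axis_eq_0_iff)
  then obtain v :: "real^'r" and w where "pr p v w \<noteq> 0" using pr_nondeg by blast
  then obtain b c where b: "sec b" and c: "sec c" and bc: "pr p (b p) (c p) \<noteq> 0"
    using E.ex_smooth_section by metis
  define N where "N = {q. pr q (b q) (c q) \<noteq> 0}"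
  have "open ((\<lambda>q. pr q (b q) (c q)) -` (- {0}))"
    using smooth_on_mfd_continuous[OF pr_smooth[OF b c]] by (intro open_vimage) auto
  then have N: "open N" "p \<in> N" using bc by (auto simp: N_def vimage_def Compl_eq)
  define h where "h q = pr q (br a (\<lambda>q. f q *\<^sub>R b q) q - f q *\<^sub>R br a b q) (c q)" for q
  have "sf h"
    unfolding h_def using f a b c by (intro pr_smooth sec_diff br_smooth sec_scaleR)
  then have "smooth_on_mfd (atlas C) N (\<lambda>q. h q * inverse (pr q (b q) (c q)))"
    using pr_smooth[OF b c] by (intro smooth_on_mfd_mult smooth_on_mfd_inverse N(1))
      (auto intro: smooth_on_mfd_subset simp: N_def)
  moreover have "h q * inverse (pr q (b q) (c q)) = dir f q (anc q (a q))" if "q \<in> N" for q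
    using that br_leibniz[OF f a b, of q] by (simp add: h_def N_def pr_simps)
  ultimately have "smooth_on_mfd (atlas C) N (\<lambda>q. dir f q (anc q (a q)))"
    by (intro smooth_on_mfd_cong[OF N(1) _ \<open>smooth_on_mfd _ N _\<close>])
  then show "\<exists>N. open N \<and> p \<in> N \<and> smooth_on_mfd (atlas C) N (\<lambda>q. dir f q (anc q (a q)))"
    using N by blast
qed

text \<open>The derivation property of \<open>[X, Y]\<close> follows from the Jacobi identity for \<open>[a, [b, f c]]\<close>.\<close>

lemma dir_lie_anchor:
  assumes f: "sf f" and a: "sec a" and b: "sec b"
  shows "dir f p (lie (\<lambda>q. anc q (a q)) (\<lambda>q. anc q (b q)) p) =
    dir (\<lambda>q. dir f q (anc q (b q))) p (anc p (a p)) - dir (\<lambda>q. dir f q (anc q (a q))) p (anc p (b p))"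
proof -
  have "\<exists>v::real^'r. v \<noteq> 0"
    by (rule exI[of _ "axis undefined 1"]) (simp add: axis_eq_0_iff)
  then obtain c where c: "sec c" "c p \<noteq> 0"
    using E.ex_smooth_section by metis
  have fl: "br b (\<lambda>q. f q *\<^sub>R c q) = (\<lambda>q. f q *\<^sub>R br b c q + dir f q (anc q (b q)) *\<^sub>R c q)" if "sec b" for b
    using br_leibniz[OF f that c(1)] by auto
  \<comment> \<open>In the difference of this expansion and the one with a and b exchanged, the
    mixed terms a(f) [b, c] and b(f) [a, c] cancel.\<close>
  have two: "br a (br b (\<lambda>q. f q *\<^sub>R c q)) p =
      f p *\<^sub>R br a (br b c) p + dir f p (anc p (a p)) *\<^sub>R br b c p
      + (dir f p (anc p (b p)) *\<^sub>R br a c p + dir (\<lambda>q. dir f q (anc q (b q))) p (anc p (a p)) *\<^sub>R c p)"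
    if a: "sec a" and b: "sec b" for a b
    unfolding fl[OF b]
    by (subst br_add_right)
      (auto intro!: sec_scaleR f dir_smooth[OF f] a b br_smooth c(1) simp: br_leibniz f dir_smooth[OF f] a b br_smooth c(1))
  have "br (br a b) (\<lambda>q. f q *\<^sub>R c q) p =
      f p *\<^sub>R br (br a b) c p + dir f p (lie (\<lambda>q. anc q (a q)) (\<lambda>q. anc q (b q)) p) *\<^sub>R c p"
    using br_leibniz[OF f br_smooth[OF a b] c(1)] anchor_br[OF a b] by simp
  then have "dir f p (lie (\<lambda>q. anc q (a q)) (\<lambda>q. anc q (b q)) p) *\<^sub>R c p =
    (dir (\<lambda>q. dir f q (anc q (b q))) p (anc p (a p)) - dir (\<lambda>q. dir f q (anc q (a q))) p (anc p (b p))) *\<^sub>R c p"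
    using br_jacobi[OF a b sec_scaleR[OF f c(1)], of p] br_jacobi[OF a b c(1), of p] two[OF a b] two[OF b a]
    by (simp add: algebra_simps)
  then show ?thesis using c(2) by simp
qed

text \<open>This is \<open>\<pi>\<^sup>*\<close> on covectors given by their components, so that its
  domain is a vector space type.\<close>

definition "iota p c = eps p (\<lambda>y. c \<bullet> y)"

lemma pr_iota: "pr p (iota p c) e = c \<bullet> anc p e" "pr p e (iota p c) = c \<bullet> anc p e"
proof -
  have "linear (\<lambda>y. c \<bullet> y)"
    by (simp add: bounded_linear_inner_right bounded_linear.linear)
  then show "pr p (iota p c) e = c \<bullet> anc p e" "pr p e (iota p c) = c \<bullet> anc p e"
    by (simp_all add: iota_def pr_eps pr_eps_right)
qed

lemma linear_iota: "linear (iota p)"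
  by (rule linearI; rule pr_eqI[of p]) (simp_all add: pr_simps pr_iota inner_add_left)

lemmas iota_simps = linear_add[OF linear_iota] linear_cmul[OF linear_iota]
  linear_diff[OF linear_iota] linear_0[OF linear_iota] linear_neg[OF linear_iota]

lemma iota_covec: "linear \<xi> \<Longrightarrow> iota p (covec \<xi>) = eps p \<xi>"
  by (simp add: iota_def covec_inner)

lemma ker_anchor_iota: "anc p e = 0 \<Longrightarrow> \<exists>c. e = iota p c"
  using ker_anchor iota_covec by metis

end

section \<open>Isotropic splittings\<close>

locale split_courant = exact_courant C
  for C :: "('m::{t2_space,second_countable_topology}, 'n::finite, 'r::finite) courant_data" +
  fixes s :: "'m \<Rightarrow> real ^ 'n \<Rightarrow> real ^ 'r"
  assumes splitting: "isotropic_splitting C s"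
begin

lemma linear_s: "linear (s p)"
  and anc_s [simp]: "anc p (s p x) = x"
  and pr_s_s [simp]: "pr p (s p x) (s p y) = 0"
  and sec_s: "vf X \<Longrightarrow> sec (\<lambda>q. s q (X q))"
  using splitting unfolding isotropic_splitting_def by blast+

lemmas s_simps = linear_add[OF linear_s] linear_cmul[OF linear_s]
  linear_diff[OF linear_s] linear_0[OF linear_s] linear_neg[OF linear_s]

text \<open>Every vector field lifts to a section, so the rules for the Lie bracket are the
  images under the anchor of the axioms for the Courant bracket.\<close>

lemma lie_eq_anchor: "vf X \<Longrightarrow> vf Y \<Longrightarrow> lie X Y p = anc p (br (\<lambda>q. s q (X q)) (\<lambda>q. s q (Y q)) p)"
  using anchor_br[OF sec_s sec_s] by simp

lemma vf_lie:
  assumes "vf X" "vf Y"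
  shows "vf (lie X Y)"
proof -
  have "lie X Y = (\<lambda>p. anc p (br (\<lambda>q. s q (X q)) (\<lambda>q. s q (Y q)) p))"
    by (rule HOL.ext) (rule lie_eq_anchor[OF assms])
  then show ?thesis
    using anchor_smooth[OF br_smooth[OF sec_s[OF assms(1)] sec_s[OF assms(2)]]] by simp
qed

lemma dir_smooth_vf: "sf f \<Longrightarrow> vf X \<Longrightarrow> sf (\<lambda>q. dir f q (X q))"
  using dir_smooth[OF _ sec_s] by simp

lemma dir_lie:
  assumes "sf f" "vf X" "vf Y"
  shows "dir f p (lie X Y p) = dir (\<lambda>q. dir f q (Y q)) p (X p) - dir (\<lambda>q. dir f q (X q)) p (Y p)"
  using dir_lie_anchor[OF assms(1) sec_s[OF assms(2)] sec_s[OF assms(3)]] by simp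

lemma lie_jacobi:
  assumes X: "vf X" and Y: "vf Y" and Z: "vf Z"
  shows "lie X (lie Y Z) p = lie (lie X Y) Z p + lie Y (lie X Z) p"
proof -
  have l: "lie U (lie V W) p = anc p (br (\<lambda>q. s q (U q)) (br (\<lambda>q. s q (V q)) (\<lambda>q. s q (W q))) p)"
    "lie (lie V W) U p = anc p (br (br (\<lambda>q. s q (V q)) (\<lambda>q. s q (W q))) (\<lambda>q. s q (U q)) p)"
    if "vf U" "vf V" "vf W" for U V W
    using that by (simp_all add: anchor_br br_smooth sec_s)
  show ?thesis
    using br_jacobi[OF sec_s[OF X] sec_s[OF Y] sec_s[OF Z], of p] X Y Z by (simp add: l anc_simps)
qed

definition Hform :: "('m \<Rightarrow> real ^ 'n) \<Rightarrow> ('m \<Rightarrow> real ^ 'n) \<Rightarrow> ('m \<Rightarrow> real ^ 'n) \<Rightarrow> 'm \<Rightarrow> real" where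
  "Hform X Y Z p = pr p (br (\<lambda>q. s q (X q)) (\<lambda>q. s q (Y q)) p) (s p (Z p))"

lemma Hform_skew12: "vf X \<Longrightarrow> vf Y \<Longrightarrow> Hform X Y Z p = - Hform Y X Z p"
  using br_skew[OF sec_s sec_s, of X Y p] by (simp add: Hform_def pr_simps)

text \<open>The bracket preserves the pairing, and the pairing of s Y with s Z is the constant 0, so
  its derivative along X vanishes.\<close>

lemma Hform_skew23:
  assumes "vf X" "vf Y" "vf Z"
  shows "Hform X Y Z p = - Hform X Z Y p"
  using br_metric[OF sec_s sec_s sec_s, OF assms, of p]
    pr_sym[of p "s p (Y p)" "br (\<lambda>q. s q (X q)) (\<lambda>q. s q (Z q)) p"]
  by (simp add: Hform_def)

lemma Hform_third_eq:
  assumes "Z p = Z' p"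
  shows "Hform X Y Z p = Hform X Y Z' p"
  using assms by (simp add: Hform_def)

text \<open>Dependence on Z only through its value at p is evident from the formula. The skew
  symmetries bring the other two arguments into the third slot in turn, so no bump functions enter
  here.\<close>

lemma Hform_eq:
  assumes vf: "vf X" "vf Y" "vf Z" "vf X'" "vf Y'" "vf Z'"
    and eq: "X p = X' p" "Y p = Y' p" "Z p = Z' p"
  shows "Hform X Y Z p = Hform X' Y' Z' p"
proof -
  have "Hform X Y Z p = - Hform X Z' Y p"
    using Hform_third_eq[of Z p Z' X Y] Hform_skew23[of X Y Z' p] vf eq by simp
  also have "\<dots> = - Hform Y' X Z' p"
    using Hform_third_eq[of Y p Y' X Z'] Hform_skew23[of X Z' Y' p] Hform_skew12[of X Y' Z' p] vf eq by simp
  also have "\<dots> = Hform Y' Z' X' p"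
    using Hform_skew23[of Y' X Z' p] Hform_third_eq[of X p X' Y' Z'] vf eq by simp
  also have "\<dots> = Hform X' Y' Z' p"
    using Hform_skew23[of Y' Z' X' p] Hform_skew12[of Y' X' Z' p] vf by simp
  finally show ?thesis .
qed

definition H :: "('m, 'n) form3" where
  "H = splitting_form C s"

lemma H_eq: "vf X \<Longrightarrow> vf Y \<Longrightarrow> vf Z \<Longrightarrow> H p (X p) (Y p) (Z p) = Hform X Y Z p"
  unfolding H_def splitting_form_def tensor3_def Hform_def[symmetric]
  by (rule Hform_eq) (simp_all add: vf_ext)

lemma H_ext: "H p x y z = Hform (ext p x) (ext p y) (ext p z) p"
  using H_eq[OF vf_ext vf_ext vf_ext, of p p x p y p z] by simp

lemma H_skew12: "H p x y z = - H p y x z"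
  unfolding H_ext by (rule Hform_skew12[OF vf_ext vf_ext])

lemma H_skew23: "H p x y z = - H p x z y"
  unfolding H_ext by (rule Hform_skew23[OF vf_ext vf_ext vf_ext])

lemma H_cyclic: "H p x y z = H p z x y"
  using H_skew12[of p x y z] H_skew23[of p y x z] H_skew12[of p y z x] H_skew23[of p z y x] by simp

lemma linear_H: "linear (H p x y)"
  unfolding H_ext Hform_def by (intro linearI) (simp_all add: s_simps pr_simps)

end

section \<open>Generalized metrics\<close>

locale gen_metric = split_courant C s0
  for C :: "('m::{t2_space,second_countable_topology}, 'n::finite, 'r::finite) courant_data"
    and s0 :: "'m \<Rightarrow> real ^ 'n \<Rightarrow> real ^ 'r" +
  fixes G :: "'m \<Rightarrow> real ^ 'r \<Rightarrow> real ^ 'r"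
  assumes gmetric: "generalized_metric C G"
begin

lemma linear_G: "linear (G p)"
  and G_G [simp]: "G p (G p e) = e"
  and adjoint_G: "pairing_adjoint C p (G p) = G p"
  and G_pos: "e \<noteq> 0 \<Longrightarrow> pr p (G p e) e > 0"
  and sec_G: "sec a \<Longrightarrow> sec (\<lambda>q. G q (a q))"
  using gmetric unfolding generalized_metric_def by blast+

lemmas G_simps = linear_add[OF linear_G] linear_cmul[OF linear_G]
  linear_diff[OF linear_G] linear_0[OF linear_G] linear_neg[OF linear_G]

lemma pr_G: "pr p (G p x) y = pr p x (G p y)"
  using pr_adjoint[OF linear_G[of p], where p = p] adjoint_G by simp

text \<open>The pairing of \<open>G\<close> (\<open>\<pi>\<^sup>* \<xi>\<close>) with
  \<open>\<pi>\<^sup>* \<xi>\<close> is \<xi> evaluated at the anchor of the former, hence 0, and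
  positivity forces \<open>\<pi>\<^sup>* \<xi>\<close> = 0.\<close>

lemma inv_g_inj:
  assumes "linear \<xi>" "anc p (G p (eps p \<xi>)) = 0"
  shows "eps p \<xi> = 0" "\<xi> = (\<lambda>_. 0)"
proof -
  have "pr p (G p (eps p \<xi>)) (eps p \<xi>) = 0"
    using assms by (simp add: pr_eps_right linear_0)
  then show e: "eps p \<xi> = 0" using G_pos[of "eps p \<xi>" p] by (cases "eps p \<xi> = 0") auto
  have "linear (\<lambda>_::real^'n. 0::real)" by (rule linear_zero)
  then show "\<xi> = (\<lambda>_. 0)"
    using inj_onD[OF eps_inj, of p \<xi> "\<lambda>_. 0"] e assms(1) by simp
qed

lemma linear_fun_diff: "linear \<xi> \<Longrightarrow> linear \<zeta> \<Longrightarrow> linear (\<lambda>y. \<xi> y + k * \<zeta> y)"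
  for \<xi> \<zeta> :: "real ^ 'n \<Rightarrow> real"
  by (intro linearI) (simp_all add: linear_add linear_cmul algebra_simps)

lemma inv_g_bij: "bij_betw (\<lambda>\<xi>. anc p (G p (eps p \<xi>))) {\<xi>. linear \<xi>} UNIV"
proof (rule bij_betwI')
  fix \<xi> \<zeta> :: "real ^ 'n \<Rightarrow> real" assume l: "\<xi> \<in> {\<xi>. linear \<xi>}" "\<zeta> \<in> {\<xi>. linear \<xi>}"
  show "anc p (G p (eps p \<xi>)) = anc p (G p (eps p \<zeta>)) \<longleftrightarrow> \<xi> = \<zeta>"
  proof
    assume eq: "anc p (G p (eps p \<xi>)) = anc p (G p (eps p \<zeta>))"
    have z: "linear (\<lambda>y. - 1 * \<zeta> y)" using l by (intro linearI) (simp_all add: linear_add linear_cmul)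
    have "eps p (\<lambda>y. \<xi> y + - 1 * \<zeta> y) = eps p \<xi> + (- 1) *\<^sub>R eps p \<zeta>"
      using l eps_add[OF _ z, of \<xi>] eps_cmul[of \<zeta> p "- 1"] by simp
    then have "anc p (G p (eps p (\<lambda>y. \<xi> y + - 1 * \<zeta> y))) = 0"
      using eq by (simp add: G_simps anc_simps)
    then have "(\<lambda>y. \<xi> y + - 1 * \<zeta> y) = (\<lambda>_. 0)"
      using inv_g_inj(2) linear_fun_diff l by blast
    then show "\<xi> = \<zeta>" by (simp add: fun_eq_iff)
  qed simp
next
  define L where "L v = anc p (G p (iota p v))" for v
  have L: "linear L"
    by (intro linearI) (simp_all add: L_def iota_simps G_simps anc_simps)
  have lin: "linear (\<lambda>y. v \<bullet> y)" for v :: "real ^ 'n"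
    by (simp add: bounded_linear_inner_right bounded_linear.linear)
  have "v = 0" if "L v = 0" for v
    using inv_g_inj(2)[OF lin that[unfolded L_def iota_def]] by (metis inner_eq_zero_iff)
  then have "surj L" using L linear_injective_0 linear_injective_imp_surjective by blast
  then show "\<exists>\<xi>\<in>{\<xi>. linear \<xi>}. x = anc p (G p (eps p \<xi>))" for x
    using lin by (metis L_def iota_def mem_Collect_eq surjD)
qed simp

abbreviation "g \<equiv> induced_metric C G"

lemma linear_g: "linear (g p x)"
  and inv_g_g [simp]: "anc p (G p (eps p (g p x))) = x"
  and g_inv_g: "linear \<xi> \<Longrightarrow> g p (anc p (G p (eps p \<xi>))) = \<xi>"
proof -
  have "x \<in> (\<lambda>\<xi>. anc p (G p (eps p \<xi>))) ` {\<xi>. linear \<xi>}"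
    using inv_g_bij[of p] by (simp add: bij_betw_def)
  from inv_into_into[OF this] f_inv_into_f[OF this]
  show "linear (g p x)" "anc p (G p (eps p (g p x))) = x"
    by (simp_all add: induced_metric_def)
  show "linear \<xi> \<Longrightarrow> g p (anc p (G p (eps p \<xi>))) = \<xi>"
    using inv_into_f_f[OF bij_betw_imp_inj_on[OF inv_g_bij[of p]], of \<xi>] by (simp add: induced_metric_def)
qed

text \<open>These are \<open>\<pi>\<^sup>* g\<close> and the induced splitting. \<open>G\<close>
  exchanges \<open>ee p x\<close> and \<open>sG p x\<close>, and every vector of the fibre is a sum
  of one of each kind, so computations with \<open>G\<close> reduce to this swap.\<close>

definition "ee p x = eps p (g p x)"
definition "sG p x = G p (ee p x)"

lemma pr_ee: "pr p (ee p x) e = g p x (anc p e)"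
  by (simp add: ee_def pr_eps linear_g)

lemma pr_ee_right: "pr p e (ee p x) = g p x (anc p e)"
  using pr_ee pr_sym by metis

lemma anc_ee [simp]: "anc p (ee p x) = 0"
  by (simp add: ee_def linear_g)

lemma anc_sG [simp]: "anc p (sG p x) = x"
  by (simp add: sG_def ee_def)

lemma G_ee: "G p (ee p x) = sG p x"
  by (simp add: sG_def)

lemma G_sG [simp]: "G p (sG p x) = ee p x"
  by (simp add: sG_def)

lemma g_sym: "g p x y = g p y x"
  using pr_G[of p "ee p y" "ee p x"] by (simp add: G_ee pr_ee pr_ee_right)

lemma g_pos: "x \<noteq> 0 \<Longrightarrow> g p x x > 0"
proof -
  assume "x \<noteq> 0"
  then have "ee p x \<noteq> 0" by (metis anc_sG anc_simps(4) G_simps(4) sG_def)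
  from G_pos[OF this, of p] show ?thesis by (simp add: G_ee pr_ee_right)
qed

lemma g_nondeg: "(\<And>y. g p x y = 0) \<Longrightarrow> x = 0"
  using g_pos[of x p] by (cases "x = 0") auto

lemma bilinear_g: "bilinear (g p)"
proof -
  have "(\<lambda>x. g p x y) = g p y" for y by (rule HOL.ext) (rule g_sym)
  then show ?thesis by (simp add: bilinear_def linear_g)
qed

lemmas g_simps =
  bilinear_ladd[OF bilinear_g] bilinear_radd[OF bilinear_g]
  bilinear_lmul[OF bilinear_g] bilinear_rmul[OF bilinear_g]
  bilinear_lneg[OF bilinear_g] bilinear_rneg[OF bilinear_g]
  bilinear_lzero[OF bilinear_g] bilinear_rzero[OF bilinear_g]
  bilinear_lsub[OF bilinear_g] bilinear_rsub[OF bilinear_g]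

lemma g_eqI: "(\<And>y. g p x y = g p x' y) \<Longrightarrow> x = x'"
  using g_nondeg[of p "x - x'"] by (simp add: g_simps)

lemma linear_ee: "linear (ee p)"
proof (rule linearI)
  show "ee p (x + y) = ee p x + ee p y" for x y
    by (rule pr_eqI[of p]) (simp add: pr_simps pr_ee g_simps)
  show "ee p (r *\<^sub>R x) = r *\<^sub>R ee p x" for r x
    by (rule pr_eqI[of p]) (simp add: pr_simps pr_ee g_simps)
qed

lemmas ee_simps = linear_add[OF linear_ee] linear_cmul[OF linear_ee]
  linear_diff[OF linear_ee] linear_0[OF linear_ee] linear_neg[OF linear_ee]

lemma linear_sG: "linear (sG p)"
  unfolding sG_def using linear_compose[OF linear_ee linear_G] by (simp add: comp_def)

lemma pr_sG_sG [simp]: "pr p (sG p x) (sG p y) = 0"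
  using pr_G[of p "ee p x" "sG p y"] by (simp add: G_ee pr_ee linear_0[OF linear_g])

lemma induced_splitting_eq: "induced_splitting C G p x = sG p x"
  by (simp add: induced_splitting_def sG_def ee_def)

lemma glift_eq: "glift C G \<sigma> X p = sG p (X p) + \<sigma> *\<^sub>R ee p (X p)"
  by (simp add: glift_def Let_def sG_def ee_def)

lemma decompose: "\<exists>y. e = sG p (anc p e) + ee p y"
proof -
  have "anc p (e - sG p (anc p e)) = 0" by (simp add: anc_simps)
  then obtain \<xi> where \<xi>: "linear \<xi>" "e - sG p (anc p e) = eps p \<xi>" using ker_anchor by blast
  then have "eps p \<xi> = ee p (anc p (G p (eps p \<xi>)))"
    by (simp add: ee_def g_inv_g)
  then show ?thesis using \<xi> by (metis add.commute diff_add_cancel)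
qed

text \<open>\<open>X\<^sup>\<sigma>\<close> is the unique solution \<open>e\<close> of \<open>K e = s0 X\<close> for the smooth invertible
  endomorphism \<open>K = s0 \<pi> P\<^sub>\<sigma> + (1 - s0 \<pi>) P\<^sub>-\<^sub>\<sigma>\<close>, hence smooth.\<close>

lemma glift_smooth:
  assumes \<sigma>: "\<sigma> = 1 \<or> \<sigma> = - 1" and X: "vf X"
  shows "sec (glift C G \<sigma> X)"
proof (rule E.smooth_section_inverse_endo)
  define K where "K p e = s0 p (anc p (gproj G \<sigma> p e)) + (gproj G (- \<sigma>) p e - s0 p (anc p (gproj G (- \<sigma>) p e)))" for p e
  have \<sigma>2: "\<sigma> * \<sigma> = 1" using \<sigma> by auto
  have lP: "linear (gproj G \<tau> p)" for \<tau> p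
    by (intro linearI) (simp_all add: gproj_def G_simps algebra_simps)
  show "linear (K p)" for p
    unfolding K_def
    by (intro linearI) (simp_all add: linear_add[OF lP] linear_cmul[OF lP] s_simps anc_simps algebra_simps)
  show "x = 0" if "K p x = 0" for p x
  proof -
    \<comment> \<open>These are the components of x in the two eigenbundles of \<open>G\<close>,
      where the pairing is definite. The anchor of K x = 0 makes u vertical, and then w lies in the
      image of \<open>s0\<close>; both are isotropic, hence zero.\<close>
    define u w where "u = gproj G \<sigma> p x" and "w = gproj G (- \<sigma>) p x"
    have Gu: "G p u = \<sigma> *\<^sub>R u" and Gw: "G p w = - (\<sigma> *\<^sub>R w)"
      using \<sigma>2 by (simp_all add: u_def w_def gproj_def G_simps algebra_simps)
    have x: "x = u + w" by (simp add: u_def w_def gproj_def algebra_simps flip: scaleR_add_left)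
    have K0: "s0 p (anc p u) + (w - s0 p (anc p w)) = 0"
      using that by (simp add: K_def u_def w_def)
    then have "anc p (s0 p (anc p u) + (w - s0 p (anc p w))) = 0" by (simp add: anc_simps)
    then have u0: "anc p u = 0" by (simp add: anc_simps)
    then obtain \<xi> where "linear \<xi>" "u = eps p \<xi>" using ker_anchor by blast
    then have "pr p u u = 0" using u0 by (simp add: pr_eps linear_0)
    then have "pr p (G p u) u = 0" by (simp add: Gu pr_simps)
    then have u: "u = 0" using G_pos[of u p] by (cases "u = 0") auto
    have "w = s0 p (anc p w)" using K0 u0 by (simp add: s_simps)
    then have "pr p w w = 0" by (metis pr_s_s)
    then have "pr p (G p w) w = 0" by (simp add: Gw pr_simps)
    then have "w = 0" using G_pos[of w p] by (cases "w = 0") auto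
    then show "x = 0" using x u by simp
  qed
  have sP: "sec (\<lambda>q. gproj G \<tau> q (a q))" if "sec a" for \<tau> a
    unfolding gproj_def using that by (intro sec_cscaleR sec_add sec_G)
  show "sec (\<lambda>q. K q (a q))" if "sec a" for a
    unfolding K_def using that by (intro sec_add sec_diff sec_s anchor_smooth sP)
  have "K q (glift C G \<sigma> X q) = s0 q (X q)" for q
  proof -
    have "gproj G \<sigma> q (glift C G \<sigma> X q) = glift C G \<sigma> X q" "gproj G (- \<sigma>) q (glift C G \<sigma> X q) = 0"
      using \<sigma>2 by (simp_all add: gproj_def glift_eq G_simps G_ee algebra_simps flip: scaleR_add_left)
    then show ?thesis by (simp add: K_def anc_simps s_simps glift_eq)
  qed
  then show "sec (\<lambda>q. K q (glift C G \<sigma> X q))" using sec_s[OF X] by simp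
qed

lemma sec_sG: "vf X \<Longrightarrow> sec (\<lambda>q. sG q (X q))"
  using sec_cscaleR[OF sec_add[OF glift_smooth[of 1 X] glift_smooth[of "- 1" X]], of "1 / 2"]
  by (simp add: glift_eq algebra_simps flip: scaleR_add_left)

lemma sec_ee: "vf X \<Longrightarrow> sec (\<lambda>q. ee q (X q))"
  using sec_G[OF sec_sG] by simp

lemma g_smooth: "vf X \<Longrightarrow> vf Y \<Longrightarrow> sf (\<lambda>q. g q (X q) (Y q))"
  using pr_smooth[OF sec_ee sec_sG, of X Y] by (simp add: pr_ee)

text \<open>All facts about splittings become available a second time: \<open>SG.H\<close> is the
  induced three-form, while \<open>H\<close> belongs to the fixed background splitting.\<close>

sublocale SG: split_courant C sG
  by unfold_locales (simp add: isotropic_splitting_def linear_sG sec_sG)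

abbreviation "b \<equiv> torsion_potential C s0 G"

lemma sG_minus_s0: "sG p x - s0 p x = eps p (\<lambda>y. pr p (sG p x) (s0 p y))"
proof -
  have "anc p (sG p x - s0 p x) = 0" by (simp add: anc_simps)
  then obtain \<xi> where \<xi>: "linear \<xi>" "sG p x - s0 p x = eps p \<xi>" using ker_anchor by blast
  have "\<xi> y = pr p (sG p x) (s0 p y)" for y
    using pr_eps[OF \<xi>(1), of p "s0 p y"] by (simp add: \<xi>(2)[symmetric] pr_simps)
  then show ?thesis using \<xi>(2) by presburger
qed

lemma linear_pr_s0: "linear (\<lambda>y. pr p e (s0 p y))"
  by (intro linearI) (simp_all add: s_simps pr_simps)

text \<open>Pairing the defining equation of b with \<open>s0 p y\<close> leaves b x y because
  \<open>s0\<close> is isotropic; isotropy of \<open>sG\<close> makes this form alternating. The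
  formula also exhibits b as smooth.\<close>

lemma torsion_potential_eq: "b p x y = pr p (sG p x) (s0 p y)"
proof -
  define \<beta> where "\<beta> x y = pr p (sG p x) (s0 p y)" for x y
  have lin: "linear (\<beta> x)" for x unfolding \<beta>_def by (rule linear_pr_s0)
  have "b p = \<beta>"
    unfolding torsion_potential_def
  proof (rule the_equality)
    have "\<beta> x x = 0" for x
    proof -
      have "sG p x = s0 p x + eps p (\<beta> x)"
        using sG_minus_s0[of p x] by (simp add: \<beta>_def[abs_def] algebra_simps)
      then have "pr p (s0 p x + eps p (\<beta> x)) (s0 p x + eps p (\<beta> x)) = 0"
        using pr_sG_sG[of p x x] by simp
      then show ?thesis
        using lin by (simp add: pr_simps pr_eps pr_eps_right linear_0)
    qed
    moreover have "bilinear \<beta>"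
      unfolding bilinear_def using lin
      by (auto intro!: linearI simp: \<beta>_def pr_simps linear_add[OF linear_sG] linear_cmul[OF linear_sG])
    moreover have "induced_splitting C G p x = exp_form2 C p \<beta> (s0 p x)" for x
      using sG_minus_s0[of p x] by (simp add: induced_splitting_eq exp_form2_def \<beta>_def[abs_def] algebra_simps)
    ultimately show "bilinear \<beta> \<and> (\<forall>x. \<beta> x x = 0) \<and>
        (\<forall>x. induced_splitting C G p x = exp_form2 C p \<beta> (s0 p x))" by blast
  next
    fix \<beta>' assume \<beta>': "bilinear \<beta>' \<and> (\<forall>x. \<beta>' x x = 0) \<and>
        (\<forall>x. induced_splitting C G p x = exp_form2 C p \<beta>' (s0 p x))"
    have "\<beta>' x y = \<beta> x y" for x y
    proof -
      have l: "linear (\<beta>' x)" using \<beta>' by (simp add: bilinear_def)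
      have "sG p x = s0 p x + eps p (\<beta>' x)"
        using \<beta>' by (metis anc_s exp_form2_def induced_splitting_eq)
      then show ?thesis by (simp add: \<beta>_def pr_simps pr_eps[OF l])
    qed
    then show "\<beta>' = \<beta>" by blast
  qed
  then show ?thesis by (simp add: \<beta>_def)
qed

lemma linear_b: "linear (b p x)"
proof -
  have "b p x = (\<lambda>y. pr p (sG p x) (s0 p y))" by (rule HOL.ext) (rule torsion_potential_eq)
  then show ?thesis using linear_pr_s0 by simp
qed

lemma sG_eq: "sG p x = s0 p x + eps p (b p x)"
proof -
  have "b p x = (\<lambda>y. pr p (sG p x) (s0 p y))" by (rule HOL.ext) (rule torsion_potential_eq)
  then show ?thesis using sG_minus_s0[of p x] by (simp add: algebra_simps)
qed

lemma b_skew: "b p x y = - b p y x"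
proof -
  have "pr p (sG p x) (sG p y) = 0" by simp
  then show ?thesis
    unfolding sG_eq by (simp add: pr_simps pr_eps pr_eps_right linear_b linear_0[OF linear_b])
qed

lemma b_smooth: "vf X \<Longrightarrow> vf Y \<Longrightarrow> sf (\<lambda>q. b q (X q) (Y q))"
  unfolding torsion_potential_eq by (intro pr_smooth sec_sG sec_s)

lemma lie_zero: "vf X \<Longrightarrow> lie (\<lambda>q. 0) X p = 0" "vf X \<Longrightarrow> lie X (\<lambda>q. 0) p = 0"
  using br_cmul_left[OF sec_s sec_s, of X X 0 p] lie_eq_anchor[of "\<lambda>q. 0" X p] vf_cscaleR[of X 0]
    lie_skew[of X "\<lambda>q. 0" p]
  by (simp_all add: s_simps anc_simps)

text \<open>Substituting \<open>sG\<close> = \<open>s0\<close> + B gives eight terms. Those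
  containing B at least twice vanish, since vertical sections are orthogonal to each other, and the
  three that contain it once add up to db.\<close>

lemma Hform_sG:
  assumes X: "vf X" and Y: "vf Y" and Z: "vf Z"
  shows "SG.Hform X Y Z p = Hform X Y Z p
     + (dir (\<lambda>q. b q (Y q) (Z q)) p (X p)
     - dir (\<lambda>q. b q (X q) (Z q)) p (Y p)
     + dir (\<lambda>q. b q (X q) (Y q)) p (Z p)
     - b p (lie X Y p) (Z p) + b p (lie X Z p) (Y p) - b p (lie Y Z p) (X p))"
proof -
  define B where "B X q = eps q (b q (X q))" for X q
  have B: "B X = (\<lambda>q. sG q (X q) - s0 q (X q))" for X
    by (rule HOL.ext) (simp add: B_def sG_eq)
  have secB: "sec (B X)" if "vf X" for X
    unfolding B using that by (intro sec_diff sec_sG sec_s)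
  have prB: "pr q (B X q) e = b q (X q) (anc q e)" "pr q e (B X q) = b q (X q) (anc q e)" for X q e
    by (simp_all add: B_def pr_eps pr_eps_right linear_b)
  have ancB [simp]: "anc q (B X q) = 0" for X q
    by (simp add: B_def linear_b)
  let ?s = "\<lambda>X q. s0 q (X q)"
  have sG: "(\<lambda>q. sG q (X q)) = (\<lambda>q. ?s X q + B X q)" for X
    by (simp add: B_def sG_eq)
  have BB: "pr p (br (B X) (B Y) p) e = 0" if X: "vf X" and Y: "vf Y" for X Y e
  proof -
    have "\<exists>c. sec c \<and> c p = e" by (rule E.ex_smooth_section)
    then obtain c where c: "sec c" "c p = e" by blast
    have "pr p (br (B X) (B Y) p) (c p) + pr p (B Y p) (br (B X) c p) = 0"
      using br_metric[OF secB[OF X] secB[OF Y] c(1), of p]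
      by (simp add: linear_0[OF linear_mderiv[OF pr_smooth[OF secB[OF Y] c(1)]]])
    moreover have "anc p (br (B X) c p) = 0"
      using anchor_br[OF secB[OF X] c(1)] lie_zero[OF anchor_smooth[OF c(1)]] by simp
    ultimately show ?thesis using c by (simp add: prB linear_0[OF linear_b])
  qed
  have sB: "pr p (br (?s X) (B Y) p) (?s Z p) = dir (\<lambda>q. b q (Y q) (Z q)) p (X p) - b p (Y p) (lie X Z p)"
    if X: "vf X" and Y: "vf Y" and Z: "vf Z" for X Y Z
    using br_metric[OF sec_s[OF X] secB[OF Y] sec_s[OF Z], of p]
    by (simp add: prB lie_eq_anchor[OF X Z])
  have ssB: "pr p (br (?s X) (?s Y) p) (B Z p) = b p (Z p) (lie X Y p)"
    if X: "vf X" and Y: "vf Y" and Z: "vf Z" for X Y Z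
    by (simp add: prB lie_eq_anchor[OF X Y])
  have sBB: "pr p (br (?s X) (B Y) p) (B Z p) = 0" if X: "vf X" and Y: "vf Y" and Z: "vf Z" for X Y Z
    using anchor_br[OF sec_s[OF X] secB[OF Y], of p] lie_zero[OF X]
    by (simp add: prB linear_0[OF linear_b])
  \<comment> \<open>A vertical first argument is moved to the second place, at the cost of an exact
    term; paired with \<open>s0\<close> Z, that term supplies the derivative along Z in db.\<close>
  have Bs: "br (B X) (?s Y) p = eps p (dir (\<lambda>q. b q (X q) (Y q)) p) - br (?s Y) (B X) p"
    if X: "vf X" and Y: "vf Y" for X Y
    using br_sym[OF secB[OF X] sec_s[OF Y], of p] by (simp add: prB algebra_simps)
  have "br (\<lambda>q. ?s X q + B X q) (\<lambda>q. ?s Y q + B Y q) p =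
    br (?s X) (?s Y) p + br (B X) (?s Y) p + (br (?s X) (B Y) p + br (B X) (B Y) p)"
    using X Y by (simp add: br_add_left br_add_right sec_s secB sec_add)
  then have "SG.Hform X Y Z p = pr p (br (?s X) (?s Y) p + br (B X) (?s Y) p + (br (?s X) (B Y) p + br (B X) (B Y) p)) (?s Z p + B Z p)"
    by (simp add: SG.Hform_def sG) (simp add: B_def sG_eq)
  also have "\<dots> = Hform X Y Z p + b p (Z p) (lie X Y p)
     + (dir (\<lambda>q. b q (X q) (Y q)) p (Z p) - (dir (\<lambda>q. b q (X q) (Z q)) p (Y p) - b p (X p) (lie Y Z p)))
     + (dir (\<lambda>q. b q (Y q) (Z q)) p (X p) - b p (Y p) (lie X Z p))"
    using X Y Z
    by (simp add: pr_simps BB ssB sB sBB Bs eps_dir_pairing b_smooth Hform_def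
        linear_0[OF linear_mderiv[OF b_smooth]])
  finally show ?thesis
    using b_skew[of p "Z p" "lie X Y p"] b_skew[of p "Y p" "lie X Z p"] b_skew[of p "X p" "lie Y Z p"] by simp
qed

lemma H_sG: "splitting_form C sG p x y z = splitting_form C s0 p x y z + ext_deriv2 (atlas C) b p x y z"
  using Hform_sG[OF vf_ext vf_ext vf_ext, of p x p y p z p]
  by (simp add: splitting_form_def ext_deriv2_def tensor3_def Hform_def SG.Hform_def)

section \<open>Bismut connections\<close>

text \<open>Invariance of the pairing moves the bracket from a' to an arbitrary section c. The
  anchor of [a, c] is a Lie bracket with the zero field, so [a, c] is vertical and orthogonal to
  a'.\<close>

lemma br_vertical:
  assumes a: "sec a" and a': "sec a'" and "\<And>q. anc q (a q) = 0" "\<And>q. anc q (a' q) = 0"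
  shows "br a a' p = 0"
proof (rule pr_nondeg)
  fix e
  have "\<exists>c. sec c \<and> c p = e" by (rule E.ex_smooth_section)
  then obtain c where c: "sec c" "c p = e" by blast
  obtain \<xi> where \<xi>: "linear \<xi>" "a' p = eps p \<xi>" using ker_anchor assms(4) by blast
  have "pr p (br a a' p) (c p) + pr p (a' p) (br a c p) = 0"
    using br_metric[OF a a' c(1), of p] assms(3)
    by (simp add: linear_0[OF linear_mderiv[OF pr_smooth[OF a' c(1)]]])
  moreover have "anc p (br a c p) = 0"
    using anchor_br[OF a c(1)] assms(3) lie_zero[OF anchor_smooth[OF c(1)]] by simp
  ultimately show "pr p (br a a' p) e = 0" using c \<xi> by (simp add: pr_eps linear_0)
qed

abbreviation "lift \<equiv> glift C G"
abbreviation "bis \<equiv> bismut C G"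

lemma linear_gproj: "linear (gproj G \<sigma> p)"
  by (intro linearI) (simp_all add: gproj_def G_simps algebra_simps)

lemmas gproj_simps = linear_add[OF linear_gproj] linear_cmul[OF linear_gproj]
  linear_diff[OF linear_gproj] linear_0[OF linear_gproj] linear_neg[OF linear_gproj]

text \<open>The projection of e is the lift of its own anchor x, and the pairing on lifts is 2
  \<sigma> g. Pairing e with the lift of z sees only that projection.\<close>

lemma g_anc_gproj:
  assumes "\<sigma> * \<sigma> = 1"
  shows "2 * \<sigma> * g p (anc p (gproj G \<sigma> p e)) z = pr p e (sG p z + \<sigma> *\<^sub>R ee p z)"
proof -
  obtain y where y: "e = sG p (anc p e) + ee p y" using decompose by blast
  define x where "x = anc p e"
  have e: "e = sG p x + ee p y" using y x_def by simp
  have "\<sigma> * (\<sigma> * r) = r" for r using assms by (metis mult.assoc mult_1)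
  then show ?thesis
    by (simp add: e gproj_def G_simps G_ee anc_simps g_simps pr_simps pr_ee pr_ee_right algebra_simps g_sym)
qed

lemma lift_add: "lift \<sigma> (\<lambda>q. X q + Y q) = (\<lambda>q. lift \<sigma> X q + lift \<sigma> Y q)"
  by (rule HOL.ext) (simp add: glift_eq linear_add[OF linear_sG] ee_simps algebra_simps)

lemma lift_scaleR: "lift \<sigma> (\<lambda>q. f q *\<^sub>R X q) = (\<lambda>q. f q *\<^sub>R lift \<sigma> X q)"
  by (rule HOL.ext) (simp add: glift_eq linear_cmul[OF linear_sG] ee_simps algebra_simps)

lemma anc_lift: "anc p (lift \<sigma> X p) = X p"
  by (simp add: glift_eq anc_simps)

context
  fixes \<sigma> :: real
  assumes \<sigma>: "\<sigma> = 1 \<or> \<sigma> = - 1"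
begin

lemma \<sigma>2: "\<sigma> * \<sigma> = 1" "\<sigma> * (\<sigma> * r) = r"
  using \<sigma> by auto

lemma sec_lift: "vf X \<Longrightarrow> sec (lift \<sigma> X)" "vf X \<Longrightarrow> sec (lift (- \<sigma>) X)"
  using \<sigma> glift_smooth by auto

lemma pr_lift_opp: "pr p (lift (- \<sigma>) X p) (lift \<sigma> Y p) = 0"
  using \<sigma>2 g_sym[of p "X p" "Y p"] by (simp add: glift_eq pr_simps pr_ee pr_ee_right anc_simps algebra_simps)

lemma pr_lift: "pr p (lift \<sigma> X p) (lift \<sigma> Y p) = 2 * \<sigma> * g p (X p) (Y p)"
  using \<sigma>2 g_sym[of p "X p" "Y p"] by (simp add: glift_eq pr_simps pr_ee pr_ee_right anc_simps algebra_simps)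

lemma anc_gproj_lift: "anc p (gproj G \<sigma> p (lift \<sigma> X p)) = X p"
  and anc_gproj_lift_opp: "anc p (gproj G \<sigma> p (lift (- \<sigma>) X p)) = 0"
  using \<sigma>2 by (simp_all add: glift_eq gproj_def G_simps G_ee anc_simps flip: scaleR_add_left)

lemma bis_smooth: "vf X \<Longrightarrow> vf Y \<Longrightarrow> vf (bis \<sigma> X Y)"
proof -
  assume "vf X" "vf Y"
  then have "vf (\<lambda>q. anc q (gproj G \<sigma> q (br (lift (- \<sigma>) X) (lift \<sigma> Y) q)))"
    unfolding gproj_def by (intro anchor_smooth sec_cscaleR sec_add sec_G br_smooth sec_lift)
  then show ?thesis by (simp add: bismut_def[abs_def])
qed

lemma bis_add_left: "vf X \<Longrightarrow> vf X' \<Longrightarrow> vf Y \<Longrightarrow> bis \<sigma> (\<lambda>q. X q + X' q) Y p = bis \<sigma> X Y p + bis \<sigma> X' Y p"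
  by (simp add: bismut_def lift_add br_add_left sec_lift gproj_simps anc_simps)

lemma bis_add_right: "vf X \<Longrightarrow> vf Y \<Longrightarrow> vf Y' \<Longrightarrow> bis \<sigma> X (\<lambda>q. Y q + Y' q) p = bis \<sigma> X Y p + bis \<sigma> X Y' p"
  by (simp add: bismut_def lift_add br_add_right sec_lift gproj_simps anc_simps)

lemma bis_scale_left:
  assumes "sf f" "vf X" "vf Y"
  shows "bis \<sigma> (\<lambda>q. f q *\<^sub>R X q) Y p = f p *\<^sub>R bis \<sigma> X Y p"
  using br_leibniz_left[OF assms(1) sec_lift(2)[OF assms(2)] sec_lift(1)[OF assms(3)] pr_lift_opp]
  by (simp add: bismut_def lift_scaleR gproj_simps anc_simps anc_gproj_lift_opp)

lemma bis_scale_right: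
  assumes "sf f" "vf X" "vf Y"
  shows "bis \<sigma> X (\<lambda>q. f q *\<^sub>R Y q) p = dir f p (X p) *\<^sub>R Y p + f p *\<^sub>R bis \<sigma> X Y p"
  using br_leibniz[OF assms(1) sec_lift(2)[OF assms(2)] sec_lift(1)[OF assms(3)]]
  by (simp add: bismut_def lift_scaleR gproj_simps anc_simps anc_gproj_lift anc_lift)

lemma g_bis: "2 * \<sigma> * g p (bis \<sigma> X Y p) (Z p) = pr p (br (lift (- \<sigma>) X) (lift \<sigma> Y) p) (lift \<sigma> Z p)"
  unfolding bismut_def glift_eq[of \<sigma> Z] by (rule g_anc_gproj[OF \<sigma>2(1)])

text \<open>This is the invariance of the pairing under the bracket, restricted to the eigenbundle
  of \<sigma>, where the pairing is 2 \<sigma> g; the opposite lift of X still has anchor X.\<close>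

lemma bis_metric:
  assumes X: "vf X" and Y: "vf Y" and Z: "vf Z"
  shows "dir (\<lambda>q. g q (Y q) (Z q)) p (X p) = g p (bis \<sigma> X Y p) (Z p) + g p (Y p) (bis \<sigma> X Z p)"
proof -
  have "(2 * \<sigma>) * dir (\<lambda>q. g q (Y q) (Z q)) p (X p) =
      (2 * \<sigma>) * g p (bis \<sigma> X Y p) (Z p) + (2 * \<sigma>) * g p (bis \<sigma> X Z p) (Y p)"
    using br_metric[OF sec_lift(2)[OF X] sec_lift(1)[OF Y] sec_lift(1)[OF Z], of p]
      pr_sym[of p "lift \<sigma> Y p"]
    by (simp only: pr_lift anc_lift mderiv_cmult[OF g_smooth[OF Y Z]] g_bis)
  then have "(2 * \<sigma>) * dir (\<lambda>q. g q (Y q) (Z q)) p (X p) =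
      (2 * \<sigma>) * (g p (bis \<sigma> X Y p) (Z p) + g p (bis \<sigma> X Z p) (Y p))"
    by (simp only: distrib_left)
  moreover have "2 * \<sigma> \<noteq> 0" using \<sigma> by auto
  ultimately have "dir (\<lambda>q. g q (Y q) (Z q)) p (X p) = g p (bis \<sigma> X Y p) (Z p) + g p (bis \<sigma> X Z p) (Y p)"
    by (rule mult_left_cancel[THEN iffD1, rotated])
  then show ?thesis using g_sym[of p "Y p" "bis \<sigma> X Z p"] by simp
qed

text \<open>After skew symmetrization, the brackets with one vertical argument combine into the
  differentials of g (X, Y) and g (Y, X), which cancel. What is left is twice the bracket of
  \<open>sG\<close> X and \<open>sG\<close> Y: its pairing with \<open>sG\<close> Z is H and its
  anchor is [X, Y].\<close>

lemma bis_torsion: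
  assumes X: "vf X" and Y: "vf Y"
  shows "g p (bis \<sigma> X Y p) z - g p (bis \<sigma> Y X p) z = g p (lie X Y p) z + \<sigma> * SG.H p (X p) (Y p) z"
proof -
  let ?s = "\<lambda>X q. sG q (X q)" and ?e = "\<lambda>X q. ee q (X q)"
  have L: "lift \<tau> U = (\<lambda>q. ?s U q + \<tau> *\<^sub>R ?e U q)" for \<tau> U
    by (rule HOL.ext) (rule glift_eq)
  have exp: "br (lift (- \<sigma>) U) (lift \<sigma> V) p =
      br (?s U) (?s V) p + \<sigma> *\<^sub>R br (?s U) (?e V) p - \<sigma> *\<^sub>R br (?e U) (?s V) p" if U: "vf U" and V: "vf V" for U V
    unfolding L using br_vertical[OF sec_ee[OF U] sec_ee[OF V], of p] U V
    by (simp add: br_add_left br_add_right br_cmul_left br_cmul_right sec_add sec_cscaleR sec_ee SG.sec_s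
      del: scaleR_minus_left) (simp add: algebra_simps)
  have se: "br (?s U) (?e V) p + br (?e V) (?s U) p = eps p (dir (\<lambda>q. g q (U q) (V q)) p)"
    if U: "vf U" and V: "vf V" for U V
    using br_sym[OF SG.sec_s[OF U] sec_ee[OF V], of p] by (simp add: pr_ee_right g_sym)
  have gs: "(\<lambda>q. g q (Y q) (X q)) = (\<lambda>q. g q (X q) (Y q))" by (rule HOL.ext) (rule g_sym)
  have "br (lift (- \<sigma>) X) (lift \<sigma> Y) p - br (lift (- \<sigma>) Y) (lift \<sigma> X) p =
     br (?s X) (?s Y) p - br (?s Y) (?s X) p
     + \<sigma> *\<^sub>R (br (?s X) (?e Y) p + br (?e Y) (?s X) p) - \<sigma> *\<^sub>R (br (?s Y) (?e X) p + br (?e X) (?s Y) p)"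
    unfolding exp[OF X Y] exp[OF Y X] by (simp add: algebra_simps)
  also have "\<dots> = 2 *\<^sub>R br (?s X) (?s Y) p"
    using br_skew[OF SG.sec_s[OF X] SG.sec_s[OF Y], of p]
    unfolding se[OF X Y] se[OF Y X] gs by (simp add: scaleR_2)
  finally have d: "br (lift (- \<sigma>) X) (lift \<sigma> Y) p - br (lift (- \<sigma>) Y) (lift \<sigma> X) p = 2 *\<^sub>R br (?s X) (?s Y) p" .
  define Z where "Z = ext p z"
  have Z: "vf Z" "Z p = z" by (simp_all add: Z_def vf_ext)
  have "2 * \<sigma> * (g p (bis \<sigma> X Y p) z - g p (bis \<sigma> Y X p) z) = pr p (2 *\<^sub>R br (?s X) (?s Y) p) (lift \<sigma> Z p)"
    unfolding d[symmetric] using g_bis[of p X Y Z] g_bis[of p Y X Z] Z by (simp add: pr_simps algebra_simps)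
  also have "\<dots> = 2 * SG.H p (X p) (Y p) z + 2 * \<sigma> * g p (lie X Y p) z"
    using SG.H_eq[OF X Y Z(1), of p] SG.lie_eq_anchor[OF X Y, of p] Z(2) g_sym
    by (simp add: glift_eq pr_simps pr_ee_right SG.Hform_def anc_simps g_simps)
  finally have "2 * \<sigma> * (g p (bis \<sigma> X Y p) z - g p (bis \<sigma> Y X p) z) =
      2 * SG.H p (X p) (Y p) z + 2 * \<sigma> * g p (lie X Y p) z" .
  then show ?thesis using \<sigma> by auto
qed

end

section \<open>The Levi-Civita connection\<close>

definition koszul where
  "koszul X Y Z p = dir (\<lambda>q. g q (Y q) (Z q)) p (X p) + dir (\<lambda>q. g q (X q) (Z q)) p (Y p)
     - dir (\<lambda>q. g q (X q) (Y q)) p (Z p)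
     + g p (lie X Y p) (Z p) - g p (lie X Z p) (Y p) - g p (lie Y Z p) (X p)"

text \<open>The torsion is \<tau> times \<open>g\<^sup>-\<^sup>1 H\<close>, so that \<tau> = 0
  covers the Levi-Civita connection and \<tau> = 1, -1 the Bismut connections. The three torsion
  terms contribute H with coefficients 1, 1 and -1 after reordering, hence H once.\<close>

lemma koszul_formula:
  assumes metric: "\<And>X Y Z. vf X \<Longrightarrow> vf Y \<Longrightarrow> vf Z \<Longrightarrow>
      dir (\<lambda>q. g q (Y q) (Z q)) p (X p) = g p (D X Y p) (Z p) + g p (Y p) (D X Z p)"
    and torsion: "\<And>X Y z. vf X \<Longrightarrow> vf Y \<Longrightarrow>
      g p (D X Y p) z - g p (D Y X p) z = g p (lie X Y p) z + \<tau> * SG.H p (X p) (Y p) z"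
    and X: "vf X" and Y: "vf Y" and Z: "vf Z"
  shows "2 * g p (D X Y p) (Z p) = koszul X Y Z p + \<tau> * SG.H p (X p) (Y p) (Z p)"
proof -
  have h: "SG.H p (X p) (Z p) (Y p) = - SG.H p (X p) (Y p) (Z p)"
    "SG.H p (Y p) (Z p) (X p) = SG.H p (X p) (Y p) (Z p)"
    using SG.H_skew23[of p "X p" "Z p" "Y p"] SG.H_cyclic[of p "Y p" "Z p" "X p"] by simp_all
  note s = g_sym[of p "Z p" "D X Y p"] g_sym[of p "Y p" "D X Z p"] g_sym[of p "X p" "D Y Z p"]
    g_sym[of p "Z p" "D Y X p"] g_sym[of p "X p" "D Z Y p"] g_sym[of p "Y p" "D Z X p"]
  show ?thesis
    unfolding koszul_def
    using metric[OF X Y Z] metric[OF Y X Z] metric[OF Z X Y]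
      torsion[OF X Y, of "Z p"] torsion[OF X Z, of "Y p"] torsion[OF Y Z, of "X p"] s
    by (simp add: h)
qed

lemma g_vf_eqI:
  assumes "\<And>Z. vf Z \<Longrightarrow> g p x (Z p) = g p y (Z p)"
  shows "x = y"
  using g_eqI[of p x y] assms[OF vf_ext] by (metis ext_at)

lemma bis_koszul:
  assumes "\<sigma> = 1 \<or> \<sigma> = - 1" "vf X" "vf Y" "vf Z"
  shows "2 * g p (bis \<sigma> X Y p) (Z p) = koszul X Y Z p + \<sigma> * SG.H p (X p) (Y p) (Z p)"
  by (rule koszul_formula) (use assms bis_metric bis_torsion in auto)

abbreviation "nab \<equiv> levi_civita (atlas C) g"

lemma levi_civita_exists:
  defines "D \<equiv> (\<lambda>X Y p. (1 / 2) *\<^sub>R (bis 1 X Y p + bis (- 1) X Y p))"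
  shows "connection (atlas C) D \<and> torsion_free (atlas C) D \<and> metric_compatible (atlas C) g D"
proof (intro conjI)
  have half: "(r / 2) *\<^sub>R (v * 2) = r *\<^sub>R v" for r and v :: "real ^ 'n"
    by (simp add: vec_eq_iff)
  show "connection (atlas C) D"
    unfolding connection_def D_def
    by (auto simp: half bis_add_left bis_add_right bis_scale_left bis_scale_right algebra_simps
        intro!: vf_cscaleR vf_add bis_smooth simp flip: scaleR_add_left)
  show "metric_compatible (atlas C) g D"
    unfolding metric_compatible_def
  proof (intro allI impI, elim conjE)
    fix X Y Z p assume v: "vf X" "vf Y" "vf Z"
    show "dir (\<lambda>q. g q (Y q) (Z q)) p (X p) = g p (D X Y p) (Z p) + g p (Y p) (D X Z p)"
      using bis_metric[of 1, OF _ v, of p] bis_metric[of "- 1", OF _ v, of p]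
      by (simp add: D_def g_simps field_simps)
  qed
  show "torsion_free (atlas C) D"
    unfolding torsion_free_def
  proof (intro allI impI, elim conjE)
    fix X Y p assume v: "vf X" "vf Y"
    show "D X Y p - D Y X p = lie X Y p"
    proof (rule g_eqI)
      fix z
      show "g p (D X Y p - D Y X p) z = g p (lie X Y p) z"
        using bis_torsion[of 1, OF _ v, of p z] bis_torsion[of "- 1", OF _ v, of p z]
        by (simp add: D_def g_simps field_simps)
    qed
  qed
qed

lemma nab_connection: "connection (atlas C) nab"
  and nab_torsion_free: "torsion_free (atlas C) nab"
  and nab_metric_compatible: "metric_compatible (atlas C) g nab"
  using someI[of "\<lambda>D. connection (atlas C) D \<and> torsion_free (atlas C) D \<and> metric_compatible (atlas C) g D",
      OF levi_civita_exists]
  by (auto simp: levi_civita_def)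

lemma nab_smooth: "vf X \<Longrightarrow> vf Y \<Longrightarrow> vf (nab X Y)"
  and nab_add_left: "vf X \<Longrightarrow> vf X' \<Longrightarrow> vf Y \<Longrightarrow> nab (\<lambda>q. X q + X' q) Y p = nab X Y p + nab X' Y p"
  and nab_scale_left: "sf f \<Longrightarrow> vf X \<Longrightarrow> vf Y \<Longrightarrow> nab (\<lambda>q. f q *\<^sub>R X q) Y p = f p *\<^sub>R nab X Y p"
  and nab_add_right: "vf X \<Longrightarrow> vf Y \<Longrightarrow> vf Y' \<Longrightarrow> nab X (\<lambda>q. Y q + Y' q) p = nab X Y p + nab X Y' p"
  and nab_scale_right: "sf f \<Longrightarrow> vf X \<Longrightarrow> vf Y \<Longrightarrow>
    nab X (\<lambda>q. f q *\<^sub>R Y q) p = dir f p (X p) *\<^sub>R Y p + f p *\<^sub>R nab X Y p"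
  using nab_connection unfolding connection_def by blast+

lemma nab_torsion: "vf X \<Longrightarrow> vf Y \<Longrightarrow> nab X Y p - nab Y X p = lie X Y p"
  using nab_torsion_free unfolding torsion_free_def by blast

lemma nab_metric: "vf X \<Longrightarrow> vf Y \<Longrightarrow> vf Z \<Longrightarrow>
    dir (\<lambda>q. g q (Y q) (Z q)) p (X p) = g p (nab X Y p) (Z p) + g p (Y p) (nab X Z p)"
  using nab_metric_compatible unfolding metric_compatible_def by blast

lemma nab_cscale_right: "vf X \<Longrightarrow> vf Y \<Longrightarrow> nab X (\<lambda>q. k *\<^sub>R Y q) p = k *\<^sub>R nab X Y p"
  using nab_scale_right[OF sf_const] by simp

lemma nab_diff_right: "vf X \<Longrightarrow> vf Y \<Longrightarrow> vf Y' \<Longrightarrow> nab X (\<lambda>q. Y q - Y' q) p = nab X Y p - nab X Y' p"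
  using nab_add_right[of X Y "\<lambda>q. (- 1) *\<^sub>R Y' q" p] nab_cscale_right[of X Y' "- 1" p] vf_cscaleR[of Y' "- 1"] by simp

lemma nab_neg_left: "vf X \<Longrightarrow> vf Y \<Longrightarrow> nab (\<lambda>q. - X q) Y p = - nab X Y p"
  using nab_scale_left[OF sf_const[of "- 1"]] by simp

lemma nab_koszul:
  assumes "vf X" "vf Y" "vf Z"
  shows "2 * g p (nab X Y p) (Z p) = koszul X Y Z p"
proof -
  have "2 * g p (nab X Y p) (Z p) = koszul X Y Z p + 0 * SG.H p (X p) (Y p) (Z p)"
    by (rule koszul_formula)
      (use assms nab_metric nab_torsion[symmetric] in \<open>auto simp: g_simps\<close>)
  then show ?thesis by simp
qed

text \<open>This is \<open>g\<^sup>-\<^sup>1 H\<close>. As a difference of two connections it is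
  smooth at once, without a discussion of the smoothness of the inverse metric.\<close>

definition "AA X Y p = bis 1 X Y p - bis (- 1) X Y p"

lemma vf_AA: "vf X \<Longrightarrow> vf Y \<Longrightarrow> vf (AA X Y)"
  unfolding AA_def[abs_def] by (intro vf_diff bis_smooth) auto

lemma g_AA:
  assumes "vf X" "vf Y"
  shows "g p (AA X Y p) z = SG.H p (X p) (Y p) z"
  using bis_koszul[of 1 X Y "ext p z" p] bis_koszul[of "- 1" X Y "ext p z" p] assms
  by (simp add: AA_def g_simps vf_ext)

lemma bis_minus:
  assumes "vf X" "vf Y"
  shows "bis (- 1) X Y = (\<lambda>p. nab X Y p - (1 / 2) *\<^sub>R AA X Y p)"
proof
  fix p
  show "bis (- 1) X Y p = nab X Y p - (1 / 2) *\<^sub>R AA X Y p"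
  proof (rule g_vf_eqI)
    fix Z assume "vf Z"
    then show "g p (bis (- 1) X Y p) (Z p) = g p (nab X Y p - (1 / 2) *\<^sub>R AA X Y p) (Z p)"
      using bis_koszul[of "- 1" X Y Z p] nab_koszul[of X Y Z p] assms by (simp add: g_simps g_AA)
  qed
qed

section \<open>Ricci curvature of the Bismut connection\<close>

abbreviation "curv \<equiv> curvature (atlas C)"

section \<open>Symmetries of the Levi-Civita curvature\<close>

definition "Rm X Y Z W p = g p (curv nab X Y Z p) (W p)"

lemma Rm_eq: "Rm X Y Z W p =
    g p (nab X (nab Y Z) p) (W p) - g p (nab Y (nab X Z) p) (W p) - g p (nab (lie X Y) Z p) (W p)"
  by (simp add: Rm_def curvature_def g_simps)

lemma Rm_skew12:
  assumes "vf X" "vf Y" "vf Z"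
  shows "Rm X Y Z W p = - Rm Y X Z W p"
proof -
  have "lie Y X = (\<lambda>q. - lie X Y q)" by (rule HOL.ext) (rule lie_skew)
  then show ?thesis
    using nab_neg_left[OF vf_lie[OF assms(1,2)] assms(3), of p] by (simp add: Rm_eq g_simps)
qed

text \<open>The second derivatives of g (Z, W) along X and Y commute up to the derivative along
  [X, Y]. Metric compatibility, used twice, turns this into the claim, and the products of first
  derivatives cancel.\<close>

lemma Rm_skew34:
  assumes X: "vf X" and Y: "vf Y" and Z: "vf Z" and W: "vf W"
  shows "Rm X Y Z W p = - Rm X Y W Z p"
proof -
  let ?f = "\<lambda>q. g q (Z q) (W q)"
  have f: "sf ?f" by (rule g_smooth[OF Z W])
  have d: "dir (\<lambda>q. dir ?f q (V q)) p (U p) =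
      g p (nab U (nab V Z) p) (W p) + g p (nab V Z p) (nab U W p)
      + (g p (nab U Z p) (nab V W p) + g p (Z p) (nab U (nab V W) p))" if U: "vf U" and V: "vf V" for U V
  proof -
    have e: "(\<lambda>q. dir ?f q (V q)) = (\<lambda>q. g q (nab V Z q) (W q) + g q (Z q) (nab V W q))"
      by (rule HOL.ext) (rule nab_metric[OF V Z W])
    show ?thesis
      unfolding e
      using nab_metric[OF U nab_smooth[OF V Z] W, of p] nab_metric[OF U Z nab_smooth[OF V W], of p]
      by (simp add: mderiv_add g_smooth nab_smooth U V Z W)
  qed
  show ?thesis
    using dir_lie[OF f X Y, of p] d[OF X Y] d[OF Y X] nab_metric[OF vf_lie[OF X Y] Z W, of p]
      g_sym[of p "Z p"] by (simp add: Rm_eq)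
qed

text \<open>Absence of torsion replaces differences of covariant derivatives by Lie brackets, until
  the cyclic sum is the Jacobi identity.\<close>

lemma Rm_bianchi:
  assumes X: "vf X" and Y: "vf Y" and Z: "vf Z"
  shows "Rm X Y Z W p + Rm Y Z X W p + Rm Z X Y W p = 0"
proof -
  have c: "nab U (nab V W) p - nab U (nab W V) p = nab U (lie V W) p" if "vf U" "vf V" "vf W" for U V W
  proof -
    have "(\<lambda>q. nab V W q - nab W V q) = lie V W"
      by (rule HOL.ext) (rule nab_torsion[OF that(2,3)])
    then show ?thesis
      using nab_diff_right[OF that(1) nab_smooth[OF that(2,3)] nab_smooth[OF that(3,2)], of p] by simp
  qed
  have l: "nab U (lie V W) p - nab (lie V W) U p = lie U (lie V W) p" if "vf U" "vf V" "vf W" for U V W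
    using nab_torsion[OF that(1) vf_lie[OF that(2,3)]] .
  have lzx: "lie Z X = (\<lambda>q. - lie X Z q)" by (rule HOL.ext) (rule lie_skew)
  have n: "nab Y (lie Z X) p = - nab Y (lie X Z) p"
    unfolding lzx using nab_cscale_right[OF Y vf_lie[OF X Z], of "- 1" p] by simp
  have n2: "nab (lie Z X) Y p = - nab (lie X Z) Y p"
    unfolding lzx using nab_neg_left[OF vf_lie[OF X Z] Y, of p] by simp
  have "curv nab X Y Z p + curv nab Y Z X p + curv nab Z X Y p =
      (nab X (nab Y Z) p - nab X (nab Z Y) p) - nab (lie Y Z) X p
      + ((nab Y (nab Z X) p - nab Y (nab X Z) p) - nab (lie Z X) Y p)
      + ((nab Z (nab X Y) p - nab Z (nab Y X) p) - nab (lie X Y) Z p)"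
    by (simp add: curvature_def algebra_simps)
  also have "\<dots> = lie X (lie Y Z) p - lie Y (lie X Z) p + lie Z (lie X Y) p"
    unfolding c[OF X Y Z] c[OF Y Z X] c[OF Z X Y] n n2
    using l[OF X Y Z] l[OF Y X Z] l[OF Z X Y] by (simp add: algebra_simps)
  also have "\<dots> = 0"
    using lie_jacobi[OF X Y Z, of p] lie_skew[of Z "lie X Y" p] by simp
  finally have "g p (curv nab X Y Z p + curv nab Y Z X p + curv nab Z X Y p) (W p) = 0"
    by (simp add: g_simps)
  then show ?thesis by (simp add: Rm_def g_simps)
qed

text \<open>The classical linear combination of four cyclic identities, one for each vector kept in
  the last slot; the skew symmetries only bring the arguments into a common order.\<close>

lemma Rm_pair_sym:
  assumes v: "vf X" "vf Y" "vf Z" "vf W"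
  shows "Rm X Y Z W p = Rm Z W X Y p"
  using Rm_bianchi[OF v(1,2,3), of W p] Rm_bianchi[OF v(2,3,4), of X p]
    Rm_bianchi[OF v(3,4,1), of Y p] Rm_bianchi[OF v(4,1,2), of Z p]
    Rm_skew12[OF v(1,2,3), of W p] Rm_skew12[OF v(2,3,1), of W p] Rm_skew12[OF v(3,1,2), of W p]
    Rm_skew12[OF v(2,3,4), of X p] Rm_skew12[OF v(3,4,2), of X p] Rm_skew12[OF v(4,2,3), of X p]
    Rm_skew12[OF v(3,4,1), of Y p] Rm_skew12[OF v(4,1,3), of Y p] Rm_skew12[OF v(1,3,4), of Y p]
    Rm_skew12[OF v(4,1,2), of Z p] Rm_skew12[OF v(1,2,4), of Z p] Rm_skew12[OF v(2,4,1), of Z p]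
    Rm_skew34[OF v, of p] Rm_skew34[OF v(1,3,2,4), of p] Rm_skew34[OF v(1,4,2,3), of p]
    Rm_skew34[OF v(2,3,1,4), of p] Rm_skew34[OF v(2,4,1,3), of p] Rm_skew34[OF v(3,4,1,2), of p]
  by argo

section \<open>The covariant derivative of the three-form and the Bismut curvature\<close>

definition "covH W X Y Z p = dir (\<lambda>q. SG.H q (X q) (Y q) (Z q)) p (W p)
    - SG.H p (nab W X p) (Y p) (Z p) - SG.H p (X p) (nab W Y p) (Z p) - SG.H p (X p) (Y p) (nab W Z p)"

lemma H_lin1: "SG.H p (x + x') y z = SG.H p x y z + SG.H p x' y z" "SG.H p (r *\<^sub>R x) y z = r * SG.H p x y z"
  "SG.H p (x - x') y z = SG.H p x y z - SG.H p x' y z"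
  using SG.H_cyclic[of p _ y z] linear_add[OF SG.linear_H] linear_cmul[OF SG.linear_H] linear_diff[OF SG.linear_H]
  by (simp_all add: SG.H_cyclic[of p y z, symmetric])

lemma H_lin3: "SG.H p y z (x + x') = SG.H p y z x + SG.H p y z x'" "SG.H p y z (r *\<^sub>R x) = r * SG.H p y z x"
  "SG.H p y z (x - x') = SG.H p y z x - SG.H p y z x'"
  using linear_add[OF SG.linear_H] linear_cmul[OF SG.linear_H] linear_diff[OF SG.linear_H] by simp_all

lemma H_lin2: "SG.H p y (x + x') z = SG.H p y x z + SG.H p y x' z" "SG.H p y (r *\<^sub>R x) z = r * SG.H p y x z"
  "SG.H p y (x - x') z = SG.H p y x z - SG.H p y x' z"
  using SG.H_skew23[of p y _ z] H_lin3 by simp_all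

lemma dir_uminus: "sf f \<Longrightarrow> dir (\<lambda>q. - f q) p v = - dir f p v"
  using mderiv_cmult[of f "- 1"] by simp

lemma H_smooth:
  assumes "vf X" "vf Y" "vf Z"
  shows "sf (\<lambda>q. SG.H q (X q) (Y q) (Z q))"
proof -
  have "(\<lambda>q. SG.H q (X q) (Y q) (Z q)) = (\<lambda>q. pr q (br (\<lambda>q. sG q (X q)) (\<lambda>q. sG q (Y q)) q) (sG q (Z q)))"
    by (rule HOL.ext) (simp add: SG.H_eq assms SG.Hform_def)
  then show ?thesis using assms by (simp add: pr_smooth br_smooth SG.sec_s)
qed

lemma covH_skew13:
  assumes "vf W" "vf X" "vf Y" "vf Z"
  shows "covH W X Y Z p = - covH W Z Y X p"
proof -
  have h: "SG.H q x y z = - SG.H q z y x" for q x y z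
    using SG.H_skew12[of q x y z] SG.H_skew23[of q y x z] SG.H_cyclic[of q y z x] SG.H_cyclic[of q z x y]
      SG.H_skew12[of q z y x]  SG.H_skew23[of q z x y] by simp
  have "(\<lambda>q. SG.H q (Z q) (Y q) (X q)) = (\<lambda>q. - SG.H q (X q) (Y q) (Z q))"
    by (rule HOL.ext) (rule h)
  then show ?thesis
    using h[of p "Z p" "Y p" "nab W X p"] h[of p "Z p" "nab W Y p" "X p"] h[of p "nab W Z p" "Y p" "X p"]
    by (simp add: covH_def dir_uminus[OF H_smooth[OF assms(2-4)]])
qed

lemma covH_cyclic: "covH W X Y Z p = covH W Z X Y p"
proof -
  have "(\<lambda>q. SG.H q (Z q) (X q) (Y q)) = (\<lambda>q. SG.H q (X q) (Y q) (Z q))"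
    by (rule HOL.ext) (rule SG.H_cyclic[symmetric])
  then show ?thesis
    using SG.H_cyclic[of p "X p" "Y p" "nab W Z p"] SG.H_cyclic[of p "X p" "nab W Y p" "Z p"]
      SG.H_cyclic[of p "nab W X p" "Y p" "Z p"] by (simp add: covH_def)
qed

text \<open>With A = \<open>g\<^sup>-\<^sup>1 H\<close>, replacing \<nabla> by \<nabla> - A/2
  changes the curvature by -1/2 times the skew derivative of A and by 1/4 times the commutator of A
  X and A Y.\<close>

lemma curv_bismut:
  assumes X: "vf X" and Y: "vf Y" and Z: "vf Z" and W: "vf W"
  shows "g p (curv (bis (- 1)) X Y Z p) (W p) = Rm X Y Z W p
    - 1 / 2 * covH X Y Z W p + 1 / 2 * covH Y X Z W p
    + 1 / 4 * SG.H p (X p) (AA Y Z p) (W p) - 1 / 4 * SG.H p (Y p) (AA X Z p) (W p)"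
proof -
  have two: "g p (bis (- 1) U (bis (- 1) V Z) p) (W p) = g p (nab U (nab V Z) p) (W p)
      - 1 / 2 * (dir (\<lambda>q. SG.H q (V q) (Z q) (W q)) p (U p) - SG.H p (V p) (Z p) (nab U W p))
      - 1 / 2 * SG.H p (U p) (nab V Z p) (W p) + 1 / 4 * SG.H p (U p) (AA V Z p) (W p)"
    if U: "vf U" and V: "vf V" for U V
  proof -
    have A: "vf (AA V Z)" and N: "vf (nab V Z)" using vf_AA nab_smooth V Z by auto
    have B: "vf (bis (- 1) V Z)" using bis_smooth V Z by auto
    have e: "(\<lambda>q. g q (AA V Z q) (W q)) = (\<lambda>q. SG.H q (V q) (Z q) (W q))"
      by (rule HOL.ext) (rule g_AA[OF V Z])
    \<comment> \<open>Metric compatibility moves the derivative from A to the function H (V, Z, W),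
      where A no longer occurs.\<close>
    have 1: "g p (nab U (AA V Z) p) (W p) =
        dir (\<lambda>q. SG.H q (V q) (Z q) (W q)) p (U p) - SG.H p (V p) (Z p) (nab U W p)"
      using nab_metric[OF U A W, of p] unfolding e g_AA[OF V Z] by simp
    have 2: "nab U (bis (- 1) V Z) p = nab U (nab V Z) p - (1 / 2) *\<^sub>R nab U (AA V Z) p"
      unfolding bis_minus[OF V Z]
      using nab_diff_right[OF U N vf_cscaleR[OF A]] nab_cscale_right[OF U A] by simp
    have 3: "g p (AA U (bis (- 1) V Z) p) (W p) =
        SG.H p (U p) (nab V Z p) (W p) - 1 / 2 * SG.H p (U p) (AA V Z p) (W p)"
      unfolding g_AA[OF U B] unfolding bis_minus[OF V Z] by (simp add: H_lin2)
    show ?thesis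
      unfolding bis_minus[OF U B] by (simp add: g_simps 1 2 3 field_simps)
  qed
  \<comment> \<open>Writing [X, Y] as a difference of covariant derivatives supplies the terms that
    complete the derivatives of H to \<open>covH\<close>.\<close>
  have "g p (bis (- 1) (lie X Y) Z p) (W p) = g p (nab (lie X Y) Z p) (W p)
      - 1 / 2 * (SG.H p (nab X Y p) (Z p) (W p) - SG.H p (nab Y X p) (Z p) (W p))"
    unfolding bis_minus[OF vf_lie[OF X Y] Z]
    by (simp add: g_simps g_AA[OF vf_lie[OF X Y] Z] nab_torsion[OF X Y, symmetric] H_lin1)
  then show ?thesis
    using two[OF X Y] two[OF Y X] SG.H_skew12[of p "X p" "nab Y Z p" "W p"]
    by (simp add: curvature_def g_simps Rm_eq covH_def algebra_simps)
qed

section \<open>Contractions with the inverse metric\<close>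

definition "gi \<equiv> inv_metric g"

lemma gi_inverse: "(\<Sum>l\<in>UNIV. gi p i l * g p v (axis l 1)) = v $ i"
  and gi_sym: "gi p i l = gi p l i"
proof -
  define M :: "real ^ 'n ^ 'n" where "M = (\<chi> k l. g p (axis k 1) (axis l 1))"
  have Mv: "(M *v v) $ l = g p v (axis l 1)" for v l
  proof -
    have lin: "linear (\<lambda>v. g p v (axis l 1))"
      using bilinear_g by (simp add: bilinear_def)
    have "g p (\<Sum>k\<in>UNIV. v $ k *\<^sub>R axis k 1) (axis l 1) = (\<Sum>k\<in>UNIV. v $ k * g p (axis k 1) (axis l 1))"
      using linear_sum[OF lin, of "\<lambda>k. v $ k *\<^sub>R axis k 1" UNIV] by (simp add: g_simps)
    then show ?thesis
      using basis_expansion[of v] g_sym[of p "axis l 1"]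
      by (simp add: M_def matrix_vector_mult_def scalar_mult_eq_scaleR mult.commute)
  qed
  have "v = 0" if "M *v v = 0" for v
  proof (rule ccontr)
    assume "v \<noteq> 0"
    have "g p v (\<Sum>k\<in>UNIV. v $ k *\<^sub>R axis k 1) = (\<Sum>k\<in>UNIV. v $ k * g p v (axis k 1))"
      by (simp add: linear_sum[OF linear_g] linear_cmul[OF linear_g])
    also have "\<dots> = 0" using that Mv[of v] by simp
    finally have "g p v v = 0" using basis_expansion[of v] by (simp add: scalar_mult_eq_scaleR)
    then show False using g_pos[OF \<open>v \<noteq> 0\<close>, of p] by simp
  qed
  moreover have "linear ((*v) M)" by simp
  ultimately have "inj ((*v) M)" using linear_injective_0 by blast
  then have inv: "invertible M"
    using matrix_left_invertible_injective invertible_left_inverse by blast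
  have MM: "matrix_inv M ** M = mat 1" "M ** matrix_inv M = mat 1"
    using someI_ex[OF inv[unfolded invertible_def]] by (auto simp: matrix_inv_def)
  have "transpose M = M" by (simp add: M_def transpose_def vec_eq_iff g_sym)
  then have "transpose (matrix_inv M) ** M = mat 1"
    using MM(2) by (metis matrix_transpose_mul transpose_mat)
  then have "transpose (matrix_inv M) = matrix_inv M"
    using MM(2) by (metis matrix_mul_assoc matrix_mul_lid matrix_mul_rid)
  then have "transpose (matrix_inv M) $ i $ l = matrix_inv M $ i $ l" by simp
  then show "gi p i l = gi p l i"
    by (simp add: gi_def inv_metric_def M_def transpose_def)
  have "matrix_inv M *v (M *v v) = v"
    by (simp add: matrix_vector_mul_assoc MM)
  then have "(\<Sum>l\<in>UNIV. matrix_inv M $ i $ l * (M *v v) $ l) = v $ i"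
    by (metis matrix_vector_mul_component inner_vec_def inner_real_def)
  then show "(\<Sum>l\<in>UNIV. gi p i l * g p v (axis l 1)) = v $ i"
    by (simp add: Mv) (simp add: gi_def inv_metric_def M_def)
qed

lemma gi_skew_sum:
  assumes "\<And>i l. f i l = - f l i"
  shows "(\<Sum>i\<in>UNIV. \<Sum>l\<in>UNIV. gi p i l * f i l) = 0"
proof -
  have "(\<Sum>i\<in>UNIV. \<Sum>l\<in>UNIV. gi p i l * f i l) = (\<Sum>l\<in>UNIV. \<Sum>i\<in>UNIV. gi p i l * f i l)"
    by (rule sum.swap)
  also have "\<dots> = (\<Sum>l\<in>UNIV. \<Sum>i\<in>UNIV. - (gi p l i * f l i))"
    by (intro sum.cong refl) (metis assms gi_sym mult_minus_right)
  finally show ?thesis by (simp add: sum_negf)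
qed

text \<open>Contraction with the inverse metric plays the part of an orthonormal frame: the trace
  becomes a sum over two indices, where symmetries exchanging them can be used.\<close>

lemma ricci_eq: "ricci (atlas C) D p y z =
    (\<Sum>i\<in>UNIV. \<Sum>l\<in>UNIV. gi p i l * g p (curv D (ext p (axis i 1)) (ext p y) (ext p z) p) (axis l 1))"
  unfolding gi_inverse by (simp add: ricci_def trace_def matrix_def)

lemma ricci_nab_eq: "ricci (atlas C) nab p y z =
    (\<Sum>i\<in>UNIV. \<Sum>l\<in>UNIV. gi p i l * Rm (ext p (axis i 1)) (ext p y) (ext p z) (ext p (axis l 1)) p)"
  by (simp add: ricci_eq Rm_def)

lemma ricci_nab_sym: "ricci (atlas C) nab p y z = ricci (atlas C) nab p z y"
proof -
  have "Rm (ext p (axis i 1)) (ext p y) (ext p z) (ext p (axis l 1)) p =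
      Rm (ext p (axis l 1)) (ext p z) (ext p y) (ext p (axis i 1)) p" for i l
    using Rm_pair_sym[OF vf_ext vf_ext vf_ext vf_ext, of p "axis i 1" p y p z p "axis l 1" p]
      Rm_skew12[OF vf_ext vf_ext vf_ext, of p z p "axis l 1" p "axis i 1" "ext p y" p]
      Rm_skew34[OF vf_ext vf_ext vf_ext vf_ext, of p "axis l 1" p z p "axis i 1" p y p]
    by simp
  then have "ricci (atlas C) nab p y z =
      (\<Sum>i\<in>UNIV. \<Sum>l\<in>UNIV. gi p l i * Rm (ext p (axis l 1)) (ext p z) (ext p y) (ext p (axis i 1)) p)"
    unfolding ricci_nab_eq using gi_sym by simp
  also have "\<dots> = ricci (atlas C) nab p z y"
    unfolding ricci_nab_eq by (rule sum.swap)
  finally show ?thesis .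
qed

text \<open>A cyclic shift moves the contracted argument of H into its last slot, which is where the
  trace of \<open>curv_bismut\<close> has it.\<close>

lemma codiff_eq: "codiff3 (atlas C) g SG.H p y z =
    - (\<Sum>i\<in>UNIV. \<Sum>l\<in>UNIV. gi p i l * covH (ext p (axis i 1)) (ext p y) (ext p z) (ext p (axis l 1)) p)"
proof -
  have "cov_deriv3 (atlas C) nab SG.H p w x y z = covH (ext p w) (ext p x) (ext p y) (ext p z) p" for w x y z
    by (simp add: cov_deriv3_def tensor3_def covH_def Let_def)
  then have "codiff3 (atlas C) g SG.H p y z =
      - (\<Sum>k\<in>UNIV. \<Sum>l\<in>UNIV. gi p k l * covH (ext p (axis l 1)) (ext p (axis k 1)) (ext p y) (ext p z) p)"
    by (simp add: codiff3_def gi_def)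
  also have "\<dots> = - (\<Sum>k\<in>UNIV. \<Sum>l\<in>UNIV. gi p l k * covH (ext p (axis l 1)) (ext p y) (ext p z) (ext p (axis k 1)) p)"
  proof -
    have "gi p k l * covH (ext p (axis l 1)) (ext p (axis k 1)) (ext p y) (ext p z) p =
        gi p l k * covH (ext p (axis l 1)) (ext p y) (ext p z) (ext p (axis k 1)) p" for k l
      using covH_cyclic[of "ext p (axis l 1)" "ext p y" "ext p z" "ext p (axis k 1)" p] gi_sym[of p k l] by simp
    then show ?thesis by simp
  qed
  finally show ?thesis by (subst sum.swap)
qed

lemma codiff_skew: "codiff3 (atlas C) g SG.H p y z = - codiff3 (atlas C) g SG.H p z y"
proof -
  have "covH U (ext p y) (ext p z) W p = - covH U (ext p z) (ext p y) W p" if "vf U" "vf W" for U W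
    using covH_skew13[OF that(1) vf_ext vf_ext that(2), of p y p z p] covH_cyclic[of U "ext p z" "ext p y" W p]
      covH_cyclic[of U W "ext p z" "ext p y" p] by simp
  then show ?thesis by (simp add: codiff_eq vf_ext sum_negf)
qed

text \<open>The trace yields H contracted with \<open>AA\<close>; expanding \<open>AA\<close> in the
  basis introduces the second inverse metric.\<close>

lemma form3_square_eq: "form3_square g SG.H p y z =
    (\<Sum>i\<in>UNIV. \<Sum>l\<in>UNIV. gi p i l * SG.H p y (AA (ext p (axis i 1)) (ext p z) p) (axis l 1))"
proof -
  let ?H = "SG.H p" and ?e = "\<lambda>i. axis i (1::real)"
  define F where "F i l j m = gi p j m * gi p l i * ?H y (?e j) (?e l) * ?H z (?e m) (?e i)" for i l j m
  have "SG.H p y (AA (ext p (?e i)) (ext p z) p) (?e l) =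
      (\<Sum>j\<in>UNIV. \<Sum>m\<in>UNIV. gi p j m * ?H y (?e j) (?e l) * ?H z (?e m) (?e i))" for i l
  proof -
    define a where "a = AA (ext p (?e i)) (ext p z) p"
    have a: "a $ j = (\<Sum>m\<in>UNIV. gi p j m * ?H z (?e m) (?e i))" for j
    proof -
      have "g p a (?e m) = ?H z (?e m) (?e i)" for m
        using g_AA[OF vf_ext vf_ext, of p p "?e i" p z "?e m"] SG.H_cyclic[of p z "?e m" "?e i"]
        by (simp add: a_def)
      then show ?thesis using gi_inverse[where p = p and i = j and v = a] by simp
    qed
    have lin: "linear (\<lambda>x. ?H y x (?e l))"
      by (intro linearI) (simp_all add: H_lin2)
    have "?H y (\<Sum>j\<in>UNIV. a $ j *\<^sub>R ?e j) (?e l) = (\<Sum>j\<in>UNIV. a $ j * ?H y (?e j) (?e l))"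
      using linear_sum[OF lin, of "\<lambda>j. a $ j *\<^sub>R ?e j" UNIV] by (simp add: H_lin2)
    then have "?H y a (?e l) = (\<Sum>j\<in>UNIV. a $ j * ?H y (?e j) (?e l))"
      using basis_expansion[of a] by (simp add: scalar_mult_eq_scaleR)
    then show ?thesis
      by (simp add: a sum_distrib_left sum_distrib_right mult_ac flip: a_def)
  qed
  then have "(\<Sum>i\<in>UNIV. \<Sum>l\<in>UNIV. gi p i l * ?H y (AA (ext p (?e i)) (ext p z) p) (?e l)) =
      (\<Sum>i\<in>UNIV. \<Sum>l\<in>UNIV. \<Sum>j\<in>UNIV. \<Sum>m\<in>UNIV. F i l j m)"
    by (simp add: F_def sum_distrib_left mult_ac gi_sym[of p])
  \<comment> \<open>From here on only the order of summation changes, from i, l, j, m to the order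
    j, l, m, i of \<open>form3_square_def\<close>.\<close>
  also have "\<dots> = (\<Sum>l\<in>UNIV. \<Sum>i\<in>UNIV. \<Sum>j\<in>UNIV. \<Sum>m\<in>UNIV. F i l j m)"
    by (rule sum.swap)
  also have "\<dots> = (\<Sum>l\<in>UNIV. \<Sum>j\<in>UNIV. \<Sum>i\<in>UNIV. \<Sum>m\<in>UNIV. F i l j m)"
    by (rule sum.cong[OF refl], rule sum.swap)
  also have "\<dots> = (\<Sum>j\<in>UNIV. \<Sum>l\<in>UNIV. \<Sum>i\<in>UNIV. \<Sum>m\<in>UNIV. F i l j m)"
    by (rule sum.swap)
  also have "\<dots> = (\<Sum>j\<in>UNIV. \<Sum>l\<in>UNIV. \<Sum>m\<in>UNIV. \<Sum>i\<in>UNIV. F i l j m)"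
    by (rule sum.cong[OF refl], rule sum.cong[OF refl], rule sum.swap)
  also have "\<dots> = form3_square g SG.H p y z"
    by (simp add: form3_square_def F_def gi_def)
  finally show ?thesis by simp
qed

lemma form3_square_sym: "form3_square g SG.H p y z = form3_square g SG.H p z y"
proof -
  let ?F = "\<lambda>y z i j k l. inv_metric g p i k * inv_metric g p j l *
    SG.H p y (axis i 1) (axis j 1) * SG.H p z (axis k 1) (axis l 1)"
  have F: "?F y z i j k l = ?F z y k l i j" for i j k l
    using gi_sym[of p] by (simp add: gi_def mult_ac)
  have "form3_square g SG.H p y z = (\<Sum>i\<in>UNIV. \<Sum>j\<in>UNIV. \<Sum>k\<in>UNIV. \<Sum>l\<in>UNIV. ?F z y k l i j)"
    unfolding form3_square_def by (simp only: F[symmetric])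
  also have "\<dots> = (\<Sum>i\<in>UNIV. \<Sum>k\<in>UNIV. \<Sum>j\<in>UNIV. \<Sum>l\<in>UNIV. ?F z y k l i j)"
    by (rule sum.cong[OF refl], rule sum.swap)
  also have "\<dots> = (\<Sum>k\<in>UNIV. \<Sum>i\<in>UNIV. \<Sum>j\<in>UNIV. \<Sum>l\<in>UNIV. ?F z y k l i j)"
    by (rule sum.swap)
  also have "\<dots> = (\<Sum>k\<in>UNIV. \<Sum>i\<in>UNIV. \<Sum>l\<in>UNIV. \<Sum>j\<in>UNIV. ?F z y k l i j)"
    by (rule sum.cong[OF refl], rule sum.cong[OF refl], rule sum.swap)
  also have "\<dots> = (\<Sum>k\<in>UNIV. \<Sum>l\<in>UNIV. \<Sum>i\<in>UNIV. \<Sum>j\<in>UNIV. ?F z y k l i j)"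
    by (rule sum.cong[OF refl], rule sum.swap)
  also have "\<dots> = form3_square g SG.H p z y"
    by (simp only: form3_square_def)
  finally show ?thesis .
qed

text \<open>Of the four corrections in \<open>curv_bismut\<close>, two are skew in the pair of
  traced arguments and drop out against the symmetric inverse metric. The others are the
  codifferential and the square of H.\<close>

lemma ricci_bismut: "ricci (atlas C) (bis (- 1)) p y z =
    ricci (atlas C) nab p y z + 1 / 2 * codiff3 (atlas C) g SG.H p y z - 1 / 4 * form3_square g SG.H p y z"
proof -
  let ?E = "\<lambda>i. ext p (axis i (1::real))" and ?Y = "ext p y" and ?Z = "ext p z"
  have 1: "ricci (atlas C) (bis (- 1)) p y z = (\<Sum>i\<in>UNIV. \<Sum>l\<in>UNIV. gi p i l *
      (Rm (?E i) ?Y ?Z (?E l) p - 1 / 2 * covH (?E i) ?Y ?Z (?E l) p + 1 / 2 * covH ?Y (?E i) ?Z (?E l) p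
       + 1 / 4 * SG.H p (axis i 1) (AA ?Y ?Z p) (axis l 1) - 1 / 4 * SG.H p y (AA (?E i) ?Z p) (axis l 1)))"
  proof -
    have "g p (curv (bis (- 1)) (?E i) ?Y ?Z p) (axis l 1) =
      Rm (?E i) ?Y ?Z (?E l) p - 1 / 2 * covH (?E i) ?Y ?Z (?E l) p + 1 / 2 * covH ?Y (?E i) ?Z (?E l) p
       + 1 / 4 * SG.H p (axis i 1) (AA ?Y ?Z p) (axis l 1) - 1 / 4 * SG.H p y (AA (?E i) ?Z p) (axis l 1)" for i l
      using curv_bismut[of "?E i" ?Y ?Z "?E l" p] by (simp add: vf_ext)
    then show ?thesis by (simp add: ricci_eq)
  qed
  have 2: "\<dots> = ricci (atlas C) nab p y z + 1 / 2 * codiff3 (atlas C) g SG.H p y z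
     + 1 / 2 * (\<Sum>i\<in>UNIV. \<Sum>l\<in>UNIV. gi p i l * covH ?Y (?E i) ?Z (?E l) p)
     + 1 / 4 * (\<Sum>i\<in>UNIV. \<Sum>l\<in>UNIV. gi p i l * SG.H p (axis i 1) (AA ?Y ?Z p) (axis l 1))
     - 1 / 4 * form3_square g SG.H p y z"
    unfolding ricci_nab_eq codiff_eq form3_square_eq
    by (simp add: algebra_simps sum.distrib sum_subtractf sum_distrib_left)
  have 3: "(\<Sum>i\<in>UNIV. \<Sum>l\<in>UNIV. gi p i l * covH ?Y (?E i) ?Z (?E l) p) = 0"
    by (rule gi_skew_sum) (rule covH_skew13[OF vf_ext vf_ext vf_ext vf_ext])
  have 4: "(\<Sum>i\<in>UNIV. \<Sum>l\<in>UNIV. gi p i l * SG.H p (axis i 1) (AA ?Y ?Z p) (axis l 1)) = 0"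
  proof (rule gi_skew_sum)
    fix i l :: 'n
    let ?x = "axis i (1::real)" and ?a = "AA ?Y ?Z p" and ?w = "axis l (1::real)"
    show "SG.H p ?x ?a ?w = - SG.H p ?w ?a ?x"
      using SG.H_skew12[of p ?x ?a ?w] SG.H_cyclic[of p ?a ?x ?w] SG.H_cyclic[of p ?w ?a ?x]
        SG.H_cyclic[of p ?x ?w ?a] SG.H_skew23[of p ?x ?a ?w] SG.H_skew12[of p ?x ?w ?a]
        SG.H_skew23[of p ?w ?x ?a] by argo
  qed
  show ?thesis unfolding 1 2 3 4 by simp
qed

section \<open>Tensoriality, and bilinearity of the Bismut Ricci tensor\<close>

lemma Rm_add1:
  assumes X: "vf X" and X': "vf X'" and Y: "vf Y" and Z: "vf Z"
  shows "Rm (\<lambda>q. X q + X' q) Y Z W p = Rm X Y Z W p + Rm X' Y Z W p"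
proof -
  have l: "lie (\<lambda>q. X q + X' q) Y = (\<lambda>q. lie X Y q + lie X' Y q)"
    by (rule HOL.ext) (simp add: X X' Y vf_add lie_eq_anchor s_simps br_add_left sec_s anc_simps)
  have n: "nab (\<lambda>q. X q + X' q) Z = (\<lambda>q. nab X Z q + nab X' Z q)"
    by (rule HOL.ext) (rule nab_add_left[OF X X' Z])
  show ?thesis
    by (simp add: Rm_eq l n nab_add_left nab_add_right nab_smooth vf_lie X X' Y Z g_simps)
qed

text \<open>The bracket of f X with Y contains - Y(f) X, and its contribution cancels the derivative
  of f produced by differentiating f times the derivative of Z along X.\<close>

lemma Rm_scale1:
  assumes f: "sf f" and X: "vf X" and Y: "vf Y" and Z: "vf Z"
  shows "Rm (\<lambda>q. f q *\<^sub>R X q) Y Z W p = f p * Rm X Y Z W p"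
proof -
  have fX: "vf (\<lambda>q. f q *\<^sub>R X q)" by (rule vf_scaleR[OF f X])
  have df: "sf (\<lambda>q. - dir f q (Y q))"
    using smooth_on_mfd_mult[OF open_UNIV sf_const[of "- 1"] dir_smooth_vf[OF f Y]] by simp
  have l: "lie (\<lambda>q. f q *\<^sub>R X q) Y = (\<lambda>q. f q *\<^sub>R lie X Y q + (- dir f q (Y q)) *\<^sub>R X q)"
    by (rule HOL.ext)
      (simp add: f X Y fX lie_eq_anchor s_simps br_leibniz_left[OF f] sec_s anc_simps)
  have n: "nab (\<lambda>q. f q *\<^sub>R X q) Z = (\<lambda>q. f q *\<^sub>R nab X Z q)"
    by (rule HOL.ext) (rule nab_scale_left[OF f X Z])
  have m: "nab (lie (\<lambda>q. f q *\<^sub>R X q) Y) Z p = f p *\<^sub>R nab (lie X Y) Z p + (- dir f p (Y p)) *\<^sub>R nab X Z p"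
    unfolding l using nab_add_left[OF vf_scaleR[OF f vf_lie[OF X Y]] vf_scaleR[OF df X] Z]
    by (simp only: nab_scale_left[OF f vf_lie[OF X Y] Z] nab_scale_left[OF df X Z])
  show ?thesis
    by (simp add: Rm_eq n m nab_scale_left[OF f] nab_scale_right[OF f] nab_smooth X Y Z g_simps algebra_simps)
qed

lemma Rm_cong1:
  assumes vf: "vf X" "vf X'" "vf Y" "vf Z" and "X p = X' p"
  shows "Rm X Y Z W p = Rm X' Y Z W p"
  by (rule T.tensorial_eq[where p = p and a = X and b = X'])
    (use assms in \<open>auto simp: Rm_add1 Rm_scale1 smooth_vf_def[symmetric]\<close>)

lemma covH_add2: "vf W \<Longrightarrow> vf X \<Longrightarrow> vf X' \<Longrightarrow> vf Y \<Longrightarrow> vf Z \<Longrightarrow>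
    covH W (\<lambda>q. X q + X' q) Y Z p = covH W X Y Z p + covH W X' Y Z p"
  by (simp add: covH_def H_lin1 mderiv_add H_smooth nab_add_right)

lemma covH_scale2: "sf f \<Longrightarrow> vf W \<Longrightarrow> vf X \<Longrightarrow> vf Y \<Longrightarrow> vf Z \<Longrightarrow>
    covH W (\<lambda>q. f q *\<^sub>R X q) Y Z p = f p * covH W X Y Z p"
  by (simp add: covH_def H_lin1 mderiv_mult H_smooth nab_scale_right algebra_simps)

lemma covH_cong2:
  assumes vf: "vf W" "vf X" "vf X'" "vf Y" "vf Z" and "X p = X' p"
  shows "covH W X Y Z p = covH W X' Y Z p"
  by (rule T.tensorial_eq[where p = p and a = X and b = X'])
    (use assms in \<open>auto simp: covH_add2 covH_scale2 smooth_vf_def[symmetric]\<close>)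

text \<open>The extension chosen for x + y need not be the sum of those for x and y. They agree at
  p, and by \<open>Rm_cong1\<close> nothing else matters.\<close>

lemma linear_Rm: "vf X \<Longrightarrow> vf Z \<Longrightarrow> vf W \<Longrightarrow> linear (\<lambda>y. Rm X (ext p y) Z W p)"
proof (rule linearI)
  assume v: "vf X" "vf Z" "vf W"
  have sw: "Rm X U Z W p = - Rm U X Z W p" if "vf U" for U
    by (rule Rm_skew12[OF v(1) that v(2)])
  fix x y and r :: real
  show "Rm X (ext p (x + y)) Z W p = Rm X (ext p x) Z W p + Rm X (ext p y) Z W p"
    using Rm_cong1[OF vf_ext[of p "x + y"] vf_add[OF vf_ext[of p x] vf_ext[of p y]] v(1,2), of p W]
    by (simp add: sw vf_ext Rm_add1 v)
  show "Rm X (ext p (r *\<^sub>R y)) Z W p = r *\<^sub>R Rm X (ext p y) Z W p"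
    using Rm_cong1[OF vf_ext[of p "r *\<^sub>R y"] vf_cscaleR[OF vf_ext[of p y], of r] v(1,2), of p W]
      Rm_scale1[OF sf_const vf_ext v(1,2), of r p y W p]
    by (simp add: sw vf_ext)
qed

lemma linear_covH: "vf U \<Longrightarrow> vf X \<Longrightarrow> vf Z \<Longrightarrow> linear (\<lambda>y. covH U X (ext p y) Z p)"
proof (rule linearI)
  assume v: "vf U" "vf X" "vf Z"
  have sw: "covH U X Y Z p = covH U Y Z X p" for Y
    using covH_cyclic[of U Y Z X p] by simp
  fix x y and r :: real
  show "covH U X (ext p (x + y)) Z p = covH U X (ext p x) Z p + covH U X (ext p y) Z p"
    using covH_cong2[OF v(1) vf_ext[of p "x + y"] vf_add[OF vf_ext[of p x] vf_ext[of p y]] v(3,2), of p]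
    by (simp add: sw vf_ext covH_add2 v)
  show "covH U X (ext p (r *\<^sub>R y)) Z p = r *\<^sub>R covH U X (ext p y) Z p"
    using covH_cong2[OF v(1) vf_ext[of p "r *\<^sub>R y"] vf_cscaleR[OF vf_ext[of p y], of r] v(3,2), of p]
      covH_scale2[OF sf_const v(1) vf_ext v(3,2), of r p y p]
    by (simp add: sw vf_ext)
qed

abbreviation "N \<equiv> ricci (atlas C) (bis (- 1)) "

text \<open>Each summand of \<open>ricci_bismut\<close> is linear in one argument by its trace
  formula, and its symmetry or skew symmetry gives the other. Bilinearity makes N x a covector, so
  that the endomorphism \<eta> and its adjoint can be evaluated.\<close>

lemma bilinear_N: "bilinear (N p)"
proof -
  note lin = linear_Rm[OF vf_ext vf_ext vf_ext] linear_covH[OF vf_ext vf_ext vf_ext]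
  note lin_simps = lin[THEN linear_add] lin[THEN linear_cmul]
  have Ric: "ricci (atlas C) nab p (x + y) z = ricci (atlas C) nab p x z + ricci (atlas C) nab p y z"
    "ricci (atlas C) nab p (r *\<^sub>R y) z = r * ricci (atlas C) nab p y z" for x y z r
    by (simp_all add: ricci_nab_eq lin_simps sum.distrib sum_distrib_left algebra_simps)
  have cod: "codiff3 (atlas C) g SG.H p z (x + y) = codiff3 (atlas C) g SG.H p z x + codiff3 (atlas C) g SG.H p z y"
    "codiff3 (atlas C) g SG.H p z (r *\<^sub>R y) = r * codiff3 (atlas C) g SG.H p z y" for x y z r
    by (simp_all add: codiff_eq lin_simps sum.distrib sum_distrib_left algebra_simps)
  have sq: "form3_square g SG.H p (x + y) z = form3_square g SG.H p x z + form3_square g SG.H p y z"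
    "form3_square g SG.H p (r *\<^sub>R y) z = r * form3_square g SG.H p y z" for x y z r
    by (simp_all add: form3_square_eq H_lin1 sum.distrib sum_distrib_left algebra_simps)
  have "linear (\<lambda>y. N p x y)" "linear (\<lambda>y. N p y x)" for x
    by (intro linearI; simp add: ricci_bismut ricci_nab_sym[of p x] form3_square_sym[of p x]
        codiff_skew[of p _ x] Ric cod sq algebra_simps)+
  then show ?thesis by (simp add: bilinear_def)
qed

section \<open>The flow equations\<close>

lemma ee_iota: "ee p x = iota p (covec (g p x))"
  by (simp add: ee_def iota_covec linear_g)

lemma sG_iota: "sG p x = s0 p x + iota p (covec (b p x))"
  by (simp add: sG_eq iota_covec linear_b)

lemma inv_g_iota: "anc p (G p (iota p (covec (g p x)))) = x"
  by (simp add: ee_iota[symmetric] G_ee)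

lemma g_inv_iota: "covec (g p (anc p (G p (iota p c)))) = c"
proof -
  have "g p (anc p (G p (iota p c))) = (\<lambda>y. c \<bullet> y)"
    unfolding iota_def by (rule g_inv_g) (simp add: bounded_linear_inner_right bounded_linear.linear)
  then show ?thesis by (simp add: covec_def inner_axis vec_eq_iff)
qed

lemma iota_ee: "iota p c = ee p (anc p (G p (iota p c)))"
  by (simp add: ee_iota g_inv_iota)

text \<open>With \<open>G_s0\<close>, this is the block form of \<open>G\<close> in the
  decomposition given by \<open>s0\<close>. Unlike the one given by \<open>sG\<close>, it does not
  depend on time, so it can be differentiated.\<close>

lemma G_iota: "G p (iota p c) = s0 p (anc p (G p (iota p c))) + iota p (covec (b p (anc p (G p (iota p c)))))"
  using iota_ee[of p c] G_ee sG_iota by metis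

lemma G_s0: "G p (s0 p x) = iota p (covec (g p x)) - G p (iota p (covec (b p x)))"
proof -
  have "G p (sG p x) = G p (s0 p x) + G p (iota p (covec (b p x)))"
    by (simp add: sG_iota G_simps)
  then show ?thesis by (simp add: ee_iota[symmetric])
qed

lemma linear_inv_g: "linear (\<lambda>c. anc p (G p (iota p c)))"
  by (intro linearI) (simp_all add: iota_simps G_simps anc_simps)

lemma linear_G_iota: "linear (\<lambda>c. G p (iota p c))"
  by (intro linearI) (simp_all add: iota_simps G_simps)

lemma linear_covec_g: "linear (\<lambda>x. covec (g p x))"
  by (intro linearI) (simp_all add: covec_def vec_eq_iff g_simps)

lemma b_add: "b p (x + y) z = b p x z + b p y z"
  and b_cmul: "b p (r *\<^sub>R x) z = r * b p x z"
  by (simp_all add: torsion_potential_eq linear_add[OF linear_sG] linear_cmul[OF linear_sG] pr_simps)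

lemma linear_covec_b: "linear (\<lambda>x. covec (b p x))"
  by (intro linearI) (simp_all add: covec_def vec_eq_iff b_add b_cmul)

section \<open>The right-hand side of the generalized flow in the induced splitting\<close>

definition "flow_rhs p e = (- 2) *\<^sub>R
  (generalized_ricci C G p (G p e) - G p (generalized_ricci C G p e))"

lemmas N_simps =
  bilinear_ladd[OF bilinear_N] bilinear_radd[OF bilinear_N]
  bilinear_lmul[OF bilinear_N] bilinear_rmul[OF bilinear_N]
  bilinear_lneg[OF bilinear_N] bilinear_rneg[OF bilinear_N]
  bilinear_lzero[OF bilinear_N] bilinear_rzero[OF bilinear_N]
  bilinear_lsub[OF bilinear_N] bilinear_rsub[OF bilinear_N]

lemma pr_gproj: "pr p (gproj G \<sigma> p x) y = pr p x (gproj G \<sigma> p y)"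
  by (simp add: gproj_def pr_simps pr_G)

abbreviation "ap p e \<equiv> anc p (gproj G 1 p e)"
abbreviation "am p e \<equiv> anc p (gproj G (- 1) p e)"

lemma pr_generalized_ricci:
  "pr p (generalized_ricci C G p e) e' = N p (ap p e) (am p e') - N p (ap p e') (am p e)"
proof -
  define \<eta> where "\<eta> e = eps p (N p (anc p e))" for e
  define \<eta>' where "\<eta>' e = eps p (\<lambda>y. N p y (anc p e))" for e
  have lin: "linear (N p x)" "linear (\<lambda>y. N p y x)" for x
    using bilinear_N by (auto simp: bilinear_def)
  have adj: "pairing_adjoint C p \<eta> = \<eta>'"
    by (rule pairing_adjoint_eqI) (simp add: \<eta>_def \<eta>'_def pr_eps pr_eps_right lin)
  have "(\<lambda>y. 1 / 2 * (N p x y + N p y x) + 1 / 2 * (N p x y - N p y x)) = N p x" for x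
    by (simp add: fun_eq_iff field_simps)
  then have "generalized_ricci C G p e = gproj G (- 1) p (\<eta> (gproj G 1 p e)) - gproj G 1 p (\<eta>' (gproj G (- 1) p e))"
    unfolding adj[symmetric] generalized_ricci_def ricci_endo_def Let_def \<eta>_def[abs_def] by simp
  then show ?thesis
    by (simp add: pr_simps pr_gproj \<eta>_def \<eta>'_def pr_eps lin)
qed

text \<open>The generalized Ricci tensor exchanges the eigenbundles of \<open>G\<close>, hence
  anticommutes with \<open>G\<close>, and its commutator with \<open>G\<close> is twice the product.
  Together with the factor -2 this is -4, which the halves in \<open>anc_gproj_split\<close>
  cancel.\<close>

lemma pr_flow_rhs: "pr p (flow_rhs p e) e' = - 4 * (N p (ap p e) (am p e') + N p (ap p e') (am p e))"
proof -
  have "ap p (G p x) = ap p x" "am p (G p x) = - am p x" for x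
    by (simp_all add: gproj_def G_simps anc_simps algebra_simps)
  then show ?thesis
    by (simp add: flow_rhs_def pr_simps pr_G pr_generalized_ricci N_simps)
qed

lemma linear_flow_rhs: "linear (flow_rhs p)"
  by (rule linearI; rule pr_eqI[of p])
    (simp_all add: pr_simps pr_flow_rhs N_simps anc_simps gproj_simps algebra_simps)

lemma anc_gproj_split [simp]: "ap p (sG p x) = (1 / 2) *\<^sub>R x" "am p (sG p x) = (1 / 2) *\<^sub>R x"
  "ap p (ee p x) = (1 / 2) *\<^sub>R x" "am p (ee p x) = - (1 / 2) *\<^sub>R x"
  by (simp_all add: gproj_def G_ee anc_simps)

lemma pr_flow_rhs_split:
  "pr p (flow_rhs p (sG p x)) (sG p y) = - (N p x y + N p y x)"
  "pr p (flow_rhs p (sG p x)) (ee p y) = N p x y - N p y x"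
  "pr p (flow_rhs p (ee p x)) (sG p y) = - (N p x y - N p y x)"
  "pr p (flow_rhs p (ee p x)) (ee p y) = N p x y + N p y x"
  by (simp_all add: pr_flow_rhs N_simps)

lemma N_sym_part: "- (N p x y + N p y x) =
    - 2 * ricci (atlas C) nab p x y + 1 / 2 * form3_square g SG.H p x y"
  using ricci_nab_sym[of p y x] form3_square_sym[of p y x] codiff_skew[of p y x]
  by (simp add: ricci_bismut)

lemma N_skew_part: "- (N p x y - N p y x) = - codiff3 (atlas C) g SG.H p x y"
  using ricci_nab_sym[of p y x] form3_square_sym[of p y x] codiff_skew[of p y x]
  by (simp add: ricci_bismut)

lemma split_eqI:
  assumes "\<And>y. pr p u (sG p y) = pr p v (sG p y)" "\<And>y. pr p u (ee p y) = pr p v (ee p y)"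
  shows "u = v"
proof (rule pr_eqI)
  show "pr p u e = pr p v e" for e
    using decompose[of e p] assms by (metis bilinear_radd[OF pr_bilinear])
qed

text \<open>These are the values that the product rule produces from \<open>G_iota\<close> and
  \<open>G_s0\<close> when g and b have the derivatives -(N + N^T) and -(N - N^T);
  \<open>imp_flow\<close> compares with them.\<close>

lemma flow_rhs_ee: "flow_rhs p (ee p w) =
    sG p (- anc p (G p (iota p (covec (\<lambda>y. - (N p w y + N p y w))))))
    + iota p (covec (\<lambda>y. - (N p w y - N p y w)))"
    and flow_rhs_sG: "flow_rhs p (sG p w) =
    iota p (covec (\<lambda>y. - (N p w y + N p y w)))
    - G p (iota p (covec (\<lambda>y. - (N p w y - N p y w))))"
proof -
  have l: "linear (\<lambda>y. - (N p w y + N p y w))" "linear (\<lambda>y. - (N p w y - N p y w))"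
    by (intro linearI; simp add: N_simps algebra_simps)+
  have gg: "pr p (sG p (anc p (G p (iota p c)))) (ee p y) = c \<bullet> y" for c y
    using covec_inner[OF linear_g, of p "anc p (G p (iota p c))" y] by (simp add: pr_ee_right g_inv_iota g_sym)
  show "flow_rhs p (ee p w) =
    sG p (- anc p (G p (iota p (covec (\<lambda>y. - (N p w y + N p y w))))))
    + iota p (covec (\<lambda>y. - (N p w y - N p y w)))"
    by (rule split_eqI[of p])
      (simp_all add: pr_flow_rhs_split pr_simps pr_iota covec_inner l gg linear_neg[OF linear_sG] del: minus_add_distrib minus_diff_eq)
  have G: "G p (iota p c) = sG p (anc p (G p (iota p c)))" for c
    by (metis iota_ee G_ee)
  show "flow_rhs p (sG p w) =
    iota p (covec (\<lambda>y. - (N p w y + N p y w)))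
    - G p (iota p (covec (\<lambda>y. - (N p w y - N p y w))))"
    by (subst G, rule split_eqI[of p])
      (simp_all add: pr_flow_rhs_split pr_simps pr_iota covec_inner l gg del: minus_add_distrib minus_diff_eq)
qed

end

section \<open>One-parameter families of generalized metrics at a fixed time and point\<close>

locale metric_family = split_courant C s0
  for C :: "('m::{t2_space,second_countable_topology}, 'n::finite, 'r::finite) courant_data"
    and s0 :: "'m \<Rightarrow> real ^ 'n \<Rightarrow> real ^ 'r" +
  fixes Gt :: "real \<Rightarrow> 'm \<Rightarrow> real ^ 'r \<Rightarrow> real ^ 'r" and I :: "real set"
  assumes gmetrics: "\<tau> \<in> I \<Longrightarrow> generalized_metric C (Gt \<tau>)"
begin

lemma gm: "\<tau> \<in> I \<Longrightarrow> gen_metric C s0 (Gt \<tau>)"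
  using gmetrics by unfold_locales

lemma anc_deriv: "(f has_vector_derivative d) F \<Longrightarrow> ((\<lambda>\<tau>. anc p (f \<tau>)) has_vector_derivative anc p d) F"
  using linear_anchor bounded_linear.has_vector_derivative linear_conv_bounded_linear by blast

lemma iota_deriv: "(f has_vector_derivative d) F \<Longrightarrow> ((\<lambda>\<tau>. iota p (f \<tau>)) has_vector_derivative iota p d) F"
  using linear_iota bounded_linear.has_vector_derivative linear_conv_bounded_linear by blast

lemma s0_deriv: "(f has_vector_derivative d) F \<Longrightarrow> ((\<lambda>\<tau>. s0 p (f \<tau>)) has_vector_derivative s0 p d) F"
  using linear_s bounded_linear.has_vector_derivative linear_conv_bounded_linear by blast

lemma pr_deriv: "(f has_vector_derivative d) F \<Longrightarrow> ((\<lambda>\<tau>. pr p (f \<tau>) e) has_real_derivative pr p d e) F"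
proof -
  assume f: "(f has_vector_derivative d) F"
  have "linear (\<lambda>x. pr p x e)" using pr_bilinear by (simp add: bilinear_def)
  then have "bounded_linear (\<lambda>x. pr p x e)" by (simp add: linear_conv_bounded_linear)
  from bounded_linear.has_vector_derivative[OF this f] show ?thesis
    by (simp add: has_real_derivative_iff_has_vector_derivative)
qed

context
  fixes t :: real and p :: 'm
  assumes t: "t \<in> I"
begin

interpretation gt: gen_metric C s0 "Gt t"
  by (rule gm[OF t])

abbreviation "gg \<tau> \<equiv> induced_metric C (Gt \<tau>)"
abbreviation "bb \<tau> \<equiv> torsion_potential C s0 (Gt \<tau>)"

text \<open>The metric is the inverse of \<open>\<pi> G \<pi>\<^sup>*\<close>, so its derivative
  comes from the rule for inverse families. Then b is the pairing of \<open>G\<close>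
  (\<open>\<pi>\<^sup>* g\<close> x) with \<open>s0\<close> y, in which both \<open>G\<close> and g
  vary.\<close>

lemma flow_imp:
  assumes G: "\<And>e. ((\<lambda>\<tau>. Gt \<tau> p e) has_vector_derivative gt.flow_rhs p e) (at t within I)"
  shows "((\<lambda>\<tau>. gg \<tau> p x y) has_real_derivative - (gt.N p x y + gt.N p y x)) (at t within I)"
    and "((\<lambda>\<tau>. bb \<tau> p x y) has_real_derivative - (gt.N p x y - gt.N p y x)) (at t within I)"
proof -
  let ?F = "gt.flow_rhs p"
  have lF: "linear (\<lambda>c. ?F (iota p c))" "linear (\<lambda>c. anc p (?F (iota p c)))"
    by (intro linearI; simp add: iota_simps linear_add[OF gt.linear_flow_rhs] linear_cmul[OF gt.linear_flow_rhs] anc_simps)+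
  have gv: "((\<lambda>\<tau>. covec (gg \<tau> p x)) has_vector_derivative - covec (gg t p (anc p (?F (gt.ee p x))))) (at t within I)" for x
    unfolding gt.ee_iota
    by (rule has_vector_derivative_inverse_family[OF t gen_metric.linear_inv_g[OF gm, of _ p] lF(2)
          gen_metric.inv_g_iota[OF gm] gen_metric.g_inv_iota[OF gm] anc_deriv[OF G]])
  have "((\<lambda>\<tau>. covec (gg \<tau> p x) \<bullet> y) has_real_derivative - covec (gg t p (anc p (?F (gt.ee p x)))) \<bullet> y) (at t within I)"
    using bounded_linear.has_vector_derivative[OF bounded_linear_inner_left gv]
    by (simp add: has_real_derivative_iff_has_vector_derivative)
  moreover have "- covec (gg t p (anc p (?F (gt.ee p x)))) \<bullet> y = - (gt.N p x y + gt.N p y x)"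
    using gt.pr_flow_rhs_split(4)[of p x y]
    by (simp add: covec_inner[OF gt.linear_g] gt.pr_ee_right gt.g_sym)
  ultimately have "((\<lambda>\<tau>. covec (gg \<tau> p x) \<bullet> y) has_real_derivative - (gt.N p x y + gt.N p y x)) (at t within I)"
    by simp
  then show "((\<lambda>\<tau>. gg \<tau> p x y) has_real_derivative - (gt.N p x y + gt.N p y x)) (at t within I)"
    unfolding has_real_derivative_iff_has_vector_derivative
    by (rule has_vector_derivative_transform[OF t, rotated]) (simp add: covec_inner[OF gen_metric.linear_g[OF gm]])
  have "((\<lambda>\<tau>. Gt \<tau> p (iota p (covec (gg \<tau> p x)))) has_vector_derivative
      ?F (iota p (covec (gg t p x))) + Gt t p (iota p (- covec (gg t p (anc p (?F (gt.ee p x))))))) (at t within I)"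
    by (rule has_vector_derivative_linear_family[OF t gen_metric.linear_G_iota[OF gm] lF(1) G gv])
  then have "((\<lambda>\<tau>. pr p (Gt \<tau> p (iota p (covec (gg \<tau> p x)))) (s0 p y)) has_real_derivative
      pr p (?F (gt.ee p x) - gt.sG p (anc p (?F (gt.ee p x)))) (s0 p y)) (at t within I)"
    using pr_deriv by (simp add: gt.ee_iota gt.sG_def iota_simps gt.G_simps)
  moreover have "pr p (?F (gt.ee p x) - gt.sG p (anc p (?F (gt.ee p x)))) (s0 p y) = - (gt.N p x y - gt.N p y x)"
  proof -
    have s: "s0 p y = gt.sG p y - iota p (covec (bb t p y))" by (simp add: gt.sG_iota)
    show ?thesis
      unfolding s using gt.pr_flow_rhs_split(3)[of p x y] by (simp add: pr_simps pr_iota anc_simps)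
  qed
  ultimately have "((\<lambda>\<tau>. pr p (Gt \<tau> p (iota p (covec (gg \<tau> p x)))) (s0 p y)) has_real_derivative
      - (gt.N p x y - gt.N p y x)) (at t within I)" by simp
  then show "((\<lambda>\<tau>. bb \<tau> p x y) has_real_derivative - (gt.N p x y - gt.N p y x)) (at t within I)"
    unfolding has_real_derivative_iff_has_vector_derivative
    by (rule has_vector_derivative_transform[OF t, rotated])
      (simp add: gen_metric.torsion_potential_eq[OF gm] gen_metric.sG_def[OF gm] gen_metric.ee_iota[OF gm])
qed

text \<open>The inverse of g is differentiated first. This gives \<open>G\<close> on the image of
  \<open>\<pi>\<^sup>*\<close> by \<open>G_iota\<close>, and only then on the image of
  \<open>s0\<close>, because \<open>G_s0\<close> contains \<open>G\<close> applied to the covector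
  of b.\<close>

lemma imp_flow:
  assumes g: "\<And>x y. ((\<lambda>\<tau>. gg \<tau> p x y) has_real_derivative - (gt.N p x y + gt.N p y x)) (at t within I)"
    and b: "\<And>x y. ((\<lambda>\<tau>. bb \<tau> p x y) has_real_derivative - (gt.N p x y - gt.N p y x)) (at t within I)"
  shows "((\<lambda>\<tau>. Gt \<tau> p e) has_vector_derivative gt.flow_rhs p e) (at t within I)"
proof -
  let ?F = "gt.flow_rhs p"
  define g' where "g' x = covec (\<lambda>y. - (gt.N p x y + gt.N p y x))" for x
  define b' where "b' x = covec (\<lambda>y. - (gt.N p x y - gt.N p y x))" for x
  have lin: "linear g'" "linear b'"
    by (intro linearI; simp add: g'_def b'_def covec_def vec_eq_iff gt.N_simps algebra_simps)+
  have lF: "linear (\<lambda>c. ?F (iota p c))"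
    by (intro linearI; simp add: iota_simps linear_add[OF gt.linear_flow_rhs] linear_cmul[OF gt.linear_flow_rhs])
  have gv: "((\<lambda>\<tau>. covec (gg \<tau> p x)) has_vector_derivative g' x) (at t within I)" for x
    by (rule has_vector_derivative_vecI) (use g in \<open>simp add: covec_def g'_def\<close>)
  have bv: "((\<lambda>\<tau>. covec (bb \<tau> p x)) has_vector_derivative b' x) (at t within I)" for x
    by (rule has_vector_derivative_vecI) (use b in \<open>simp add: covec_def b'_def\<close>)
  let ?\<gamma> = "\<lambda>\<tau> c. anc p (Gt \<tau> p (iota p c))"
  have \<gamma>: "((\<lambda>\<tau>. ?\<gamma> \<tau> c) has_vector_derivative - ?\<gamma> t (g' (?\<gamma> t c))) (at t within I)" for c
    by (rule has_vector_derivative_inverse_family[OF t gen_metric.linear_covec_g[OF gm, of _ p] lin(1)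
          gen_metric.g_inv_iota[OF gm] gen_metric.inv_g_iota[OF gm] gv])
  have Gi: "((\<lambda>\<tau>. Gt \<tau> p (iota p c)) has_vector_derivative ?F (iota p c)) (at t within I)" for c
  proof -
    define w where "w = ?\<gamma> t c"
    have "((\<lambda>\<tau>. s0 p (?\<gamma> \<tau> c) + iota p (covec (bb \<tau> p (?\<gamma> \<tau> c)))) has_vector_derivative
        s0 p (- ?\<gamma> t (g' w)) + iota p (b' w + covec (bb t p (- ?\<gamma> t (g' w))))) (at t within I)"
      unfolding w_def
      by (intro has_vector_derivative_add s0_deriv iota_deriv \<gamma>
          has_vector_derivative_linear_family[OF t gen_metric.linear_covec_b[OF gm, of _ p] lin(2) bv \<gamma>])
    moreover have "s0 p (- ?\<gamma> t (g' w)) + iota p (b' w + covec (bb t p (- ?\<gamma> t (g' w)))) = ?F (iota p c)"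
    proof -
      have "iota p c = gt.ee p w" unfolding w_def by (rule gt.iota_ee)
      moreover have "?F (gt.ee p w) = gt.sG p (- ?\<gamma> t (g' w)) + iota p (b' w)"
        unfolding g'_def b'_def
        by (rule gt.flow_rhs_ee)
      ultimately show ?thesis by (simp add: gt.sG_iota iota_simps)
    qed
    ultimately have "((\<lambda>\<tau>. s0 p (?\<gamma> \<tau> c) + iota p (covec (bb \<tau> p (?\<gamma> \<tau> c)))) has_vector_derivative
        ?F (iota p c)) (at t within I)" by simp
    then show ?thesis
      by (rule has_vector_derivative_transform[OF t, rotated]) (rule gen_metric.G_iota[OF gm])
  qed
  have Gs: "((\<lambda>\<tau>. Gt \<tau> p (s0 p x)) has_vector_derivative ?F (s0 p x)) (at t within I)" for x
  proof -
    have "((\<lambda>\<tau>. iota p (covec (gg \<tau> p x)) - Gt \<tau> p (iota p (covec (bb \<tau> p x)))) has_vector_derivative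
        iota p (g' x) - (?F (iota p (covec (bb t p x))) + Gt t p (iota p (b' x)))) (at t within I)"
      by (intro has_vector_derivative_diff iota_deriv gv
          has_vector_derivative_linear_family[OF t gen_metric.linear_G_iota[OF gm] lF Gi bv])
    moreover have "iota p (g' x) - (?F (iota p (covec (bb t p x))) + Gt t p (iota p (b' x))) = ?F (s0 p x)"
    proof -
      have "?F (gt.sG p x) = iota p (g' x) - Gt t p (iota p (b' x))"
        unfolding g'_def b'_def
        by (rule gt.flow_rhs_sG)
      then show ?thesis
        by (simp add: gt.sG_iota linear_add[OF gt.linear_flow_rhs] algebra_simps)
    qed
    ultimately have "((\<lambda>\<tau>. iota p (covec (gg \<tau> p x)) - Gt \<tau> p (iota p (covec (bb \<tau> p x)))) has_vector_derivative
        ?F (s0 p x)) (at t within I)" by simp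
    then show ?thesis
      by (rule has_vector_derivative_transform[OF t, rotated]) (rule gen_metric.G_s0[OF gm])
  qed
  have "anc p (e - s0 p (anc p e)) = 0" by (simp add: anc_simps)
  then obtain c where "e - s0 p (anc p e) = iota p c" using ker_anchor_iota by blast
  then have e: "e = s0 p (anc p e) + iota p c" by (simp add: algebra_simps)
  have "((\<lambda>\<tau>. Gt \<tau> p (s0 p (anc p e)) + Gt \<tau> p (iota p c)) has_vector_derivative
      ?F (s0 p (anc p e)) + ?F (iota p c)) (at t within I)"
    by (intro has_vector_derivative_add Gs Gi)
  then have "((\<lambda>\<tau>. Gt \<tau> p (s0 p (anc p e)) + Gt \<tau> p (iota p c)) has_vector_derivative ?F e) (at t within I)"
    using e linear_add[OF gt.linear_flow_rhs] by metis
  then show ?thesis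
    by (rule has_vector_derivative_transform[OF t, rotated]) (metis e linear_add gen_metric.linear_G[OF gm])
qed

lemma flow_iff:
  "(\<forall>e. (let R = generalized_ricci C (Gt t) in
        ((\<lambda>\<tau>. Gt \<tau> p e) has_vector_derivative (- 2) *\<^sub>R (R p (Gt t p e) - Gt t p (R p e)))
          (at t within I))) \<longleftrightarrow>
   (\<forall>x y. (let H = (\<lambda>q u v w. splitting_form C s0 q u v w + ext_deriv2 (atlas C) (bb t) q u v w) in
        ((\<lambda>\<tau>. gg \<tau> p x y) has_real_derivative
           - 2 * ricci (atlas C) (levi_civita (atlas C) (gg t)) p x y + 1 / 2 * form3_square (gg t) H p x y)
          (at t within I) \<and>
        ((\<lambda>\<tau>. bb \<tau> p x y) has_real_derivative - codiff3 (atlas C) (gg t) H p x y) (at t within I)))"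
  (is "?L \<longleftrightarrow> ?R")
proof -
  \<comment> \<open>By the formula for a change of splitting, the form in the flow equations is the
    one of the induced splitting, to which the Ricci identities refer.\<close>
  have H: "(\<lambda>q u v w. splitting_form C s0 q u v w + ext_deriv2 (atlas C) (bb t) q u v w) = gt.SG.H"
    by (intro HOL.ext) (simp add: gt.SG.H_def gt.H_sG)
  have "?L \<longleftrightarrow> (\<forall>e. ((\<lambda>\<tau>. Gt \<tau> p e) has_vector_derivative gt.flow_rhs p e) (at t within I))"
    by (simp add: gt.flow_rhs_def Let_def)
  also have "\<dots> \<longleftrightarrow> (\<forall>x y. ((\<lambda>\<tau>. gg \<tau> p x y) has_real_derivative - (gt.N p x y + gt.N p y x)) (at t within I) \<and>
      ((\<lambda>\<tau>. bb \<tau> p x y) has_real_derivative - (gt.N p x y - gt.N p y x)) (at t within I))"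
    using flow_imp imp_flow by blast
  also have "\<dots> \<longleftrightarrow> ?R"
    unfolding gt.N_sym_part gt.N_skew_part H Let_def ..
  finally show ?thesis .
qed

end

end

theorem theorem1p1:
  fixes C :: "('m::{t2_space,second_countable_topology}, 'n::finite, 'r::finite) courant_data"
    and s0 :: "'m \<Rightarrow> real ^ 'n \<Rightarrow> real ^ 'r"
    and I :: "real set"
    and G :: "real \<Rightarrow> 'm \<Rightarrow> real ^ 'r \<Rightarrow> real ^ 'r"
  assumes "exact_courant_algebroid C"
    and "isotropic_splitting C s0"
    and "is_interval I"
    and "\<And>t. t \<in> I \<Longrightarrow> generalized_metric C (G t)"
  shows "generalized_ricci_flow C I G \<longleftrightarrow>
    bfield_rg_flow (atlas C) (splitting_form C s0) I
      (\<lambda>t. induced_metric C (G t)) (\<lambda>t. torsion_potential C s0 (G t))"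
proof -
  interpret metric_family C s0 G I
    using assms by unfold_locales
  show ?thesis
    unfolding generalized_ricci_flow_def bfield_rg_flow_def
    by (rule ball_cong[OF refl], rule arg_cong[where f = All], rule HOL.ext, rule flow_iff)
qed

end
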